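(* Any ($C^\infty$-)smooth finite type $\mathbb C$-convex boundary point $a$ of a domain $D\subset\mathbb C^n$ is a local (holomorphic) peak point. Moreover, there are a neighborhood $U$ of $a$ and a domain $G\subset\mathbb C^n$ with $G\supset\overline{D\cap U}\setminus\{a\}$ such that $a\in\partial G$ and $a$ is a peak point with respect to the algebra $A(G)$.
   Context: A domain is $\mathbb C$-convex if every non-empty intersection of it with a complex (affine) line is a simply connected domain (in particular connected). A point $a\in\partial D$ is a $\mathbb C$-convex boundary point of $D$ if there is a neighborhood $U$ of $a$ such that $D\cap U$ is a $\mathbb C$-convex domain. Smooth means that there is a $C^\infty$ function $r$ near $a$ with $dr(a)\neq0$ and $D=\{r<0\}$ near $a$. Finite type means that $\sup_\varphi \operatorname{ord}_0(r\circ\varphi)/\operatorname{ord}_0(\varphi-a)<\infty$, the supremum over all non-constant holomorphic maps $\varphi$ from a neighborhood of $0\in\mathbb C$ to $\mathbb C^n$ with $\varphi(0)=a$, $\operatorname{ord}_0$ denoting order of vanishing at $0$. For a domain $G$, $A(G)$ is the algebra of functions holomorphic on $G$ and continuous on $\overline G$. A point $a\in\partial G$ is a peak point with respect to $A(G)$ if there is $f\in A(G)$ with $f(a)=1$ and $|f|<1$ on $\overline G\setminus\{a\}$. A point $a\in\partial D$ is a local (holomorphic) peak point of $D$ if there is a neighborhood $U$ of $a$ such that $a$ is a peak point with respect to $A(D\cap U)$. *)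

theory Defs
  imports "HOL-Complex_Analysis.Complex_Analysis"
begin

definition is_domain :: "'a::topological_space set \<Rightarrow> bool" where
  "is_domain D \<longleftrightarrow> open D \<and> connected D \<and> D \<noteq> {}"

definition complex_line :: "(complex ^ 'n) set \<Rightarrow> bool" where
  "complex_line L \<longleftrightarrow> (\<exists>p v. v \<noteq> 0 \<and> L = range (\<lambda>z. p + z *s v))"

text \<open>The intersection of an open set with a line \<open>L\<close> is automatically open in \<open>L\<close>.\<close>

definition C_convex :: "(complex ^ 'n) set \<Rightarrow> bool" where
  "C_convex D \<longleftrightarrow> is_domain D \<and>
     (\<forall>L. complex_line L \<and> D \<inter> L \<noteq> {} \<longrightarrow> connected (D \<inter> L) \<and> simply_connected (D \<inter> L))"

definition C_convex_boundary_point :: "(complex ^ 'n) set \<Rightarrow> complex ^ 'n \<Rightarrow> bool" where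
  "C_convex_boundary_point D a \<longleftrightarrow>
     a \<in> frontier D \<and> (\<exists>U. open U \<and> a \<in> U \<and> C_convex (D \<inter> U))"

text \<open>Iterated directional derivatives (over the reals). They are meaningful only where all
  the intermediate derivatives exist, which is what \<open>smooth_on\<close> demands on an open set.\<close>

primrec iter_deriv ::
    "'a list \<Rightarrow> ('a::real_normed_vector \<Rightarrow> 'b::real_normed_vector) \<Rightarrow> 'a \<Rightarrow> 'b" where
  "iter_deriv [] f = f"
| "iter_deriv (v # vs) f = (\<lambda>x. frechet_derivative (iter_deriv vs f) (at x) v)"

definition smooth_on ::
    "'a set \<Rightarrow> ('a::real_normed_vector \<Rightarrow> 'b::real_normed_vector) \<Rightarrow> bool" where
  "smooth_on W f \<longleftrightarrow> open W \<and> (\<forall>vs. \<forall>x\<in>W. iter_deriv vs f differentiable (at x))"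

text \<open>The least order of a non-vanishing derivative at \<open>p\<close>, i.e. the degree of the lowest
  non-zero term of the Taylor series; it is \<open>\<infinity>\<close> if all derivatives vanish.\<close>

definition vanishing_order ::
    "('a::real_normed_vector \<Rightarrow> 'b::real_normed_vector) \<Rightarrow> 'a \<Rightarrow> enat" where
  "vanishing_order f p = (INF vs\<in>{vs. iter_deriv vs f p \<noteq> 0}. enat (length vs))"

definition smooth_defining_function ::
    "(complex ^ 'n) set \<Rightarrow> complex ^ 'n \<Rightarrow> (complex ^ 'n \<Rightarrow> real) \<Rightarrow> bool" where
  "smooth_defining_function D a r \<longleftrightarrow>
     (\<exists>W. a \<in> W \<and> smooth_on W r \<and> D \<inter> W = {x \<in> W. r x < 0}) \<and>
     frechet_derivative r (at a) \<noteq> (\<lambda>v. 0)"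

definition smooth_boundary_point :: "(complex ^ 'n) set \<Rightarrow> complex ^ 'n \<Rightarrow> bool" where
  "smooth_boundary_point D a \<longleftrightarrow> a \<in> frontier D \<and> (\<exists>r. smooth_defining_function D a r)"

text \<open>The neighbourhood \<open>V\<close> is taken connected, so that a non-constant map is not
  constant near \<open>0\<close> and \<open>\<phi> - a\<close> vanishes to finite order there.\<close>

definition holomorphic_discs :: "complex ^ 'n \<Rightarrow> (complex \<Rightarrow> complex ^ 'n) set" where
  "holomorphic_discs a = {\<phi>. \<exists>V. open V \<and> connected V \<and> 0 \<in> V \<and>
     (\<forall>i. (\<lambda>z. \<phi> z $ i) holomorphic_on V) \<and> \<not> \<phi> constant_on V \<and> \<phi> 0 = a}"

definition contact_type :: "(complex ^ 'n \<Rightarrow> real) \<Rightarrow> complex ^ 'n \<Rightarrow> ereal" where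
  "contact_type r a = (SUP \<phi>\<in>holomorphic_discs a.
     ereal_of_enat (vanishing_order (r \<circ> \<phi>) 0) /
     ereal_of_enat (vanishing_order (\<lambda>z. \<phi> z - a) 0))"

text \<open>The type does not depend on the choice of \<open>r\<close>: two smooth local defining functions
  differ by a smooth positive factor.\<close>

definition finite_type_boundary_point :: "(complex ^ 'n) set \<Rightarrow> complex ^ 'n \<Rightarrow> bool" where
  "finite_type_boundary_point D a \<longleftrightarrow>
     a \<in> frontier D \<and> (\<exists>r. smooth_defining_function D a r \<and> contact_type r a < \<infinity>)"

text \<open>Holomorphy in several variables: the real Frechet derivative is complex linear.\<close>

definition holomorphic_vec_on :: "(complex ^ 'n \<Rightarrow> complex) \<Rightarrow> (complex ^ 'n) set \<Rightarrow> bool" where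
  "holomorphic_vec_on f G \<longleftrightarrow>
     (\<forall>x\<in>G. \<exists>f'. (f has_derivative f') (at x) \<and> (\<forall>c v. f' (c *s v) = c * f' v))"

definition algebra_A :: "(complex ^ 'n) set \<Rightarrow> (complex ^ 'n \<Rightarrow> complex) set" where
  "algebra_A G = {f. holomorphic_vec_on f G \<and> continuous_on (closure G) f}"

definition peak_point :: "(complex ^ 'n) set \<Rightarrow> complex ^ 'n \<Rightarrow> bool" where
  "peak_point G a \<longleftrightarrow> is_domain G \<and> a \<in> frontier G \<and>
     (\<exists>f\<in>algebra_A G. f a = 1 \<and> (\<forall>x\<in>closure G - {a}. cmod (f x) < 1))"

definition local_peak_point :: "(complex ^ 'n) set \<Rightarrow> complex ^ 'n \<Rightarrow> bool" where
  "local_peak_point D a \<longleftrightarrow>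
     a \<in> frontier D \<and> (\<exists>U. open U \<and> a \<in> U \<and> peak_point (D \<inter> U) a)"

end

theory Submission
  imports Defs
begin

text \<open>
  Let \<open>T\<close> be the complex tangent space at \<open>a\<close> and \<open>n\<close> a normal vector. A \<open>\<complex>\<close>-convex set misses
  the complex tangent plane at every smooth boundary point \<open>p\<close>: otherwise, turning a line through
  \<open>p\<close> near that plane, a point of the set near \<open>p\<close> winds once around \<open>p\<close> in the line while another
  one does not wind at all, and the logarithm on the simply connected slices gives a continuous
  logarithm on a circle. Consequently, every limit of \<open>r\<close> restricted to complex lines
  \<open>a + \<zeta> v\<close>, \<open>v \<in> T\<close>, \<open>v \<rightarrow> 0\<close>, rescaled by the size of its Taylor polynomial (which is not
  flat, by finite type) is a convex polynomial \<open>p\<close> on the plane. If \<open>p\<close> has a zero other than the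
  origin, it depends on one real coordinate only, and then the polynomial \<open>Q(v)\<close>, the sum of the
  Taylor terms of even order with \<open>\<partial>\<^sub>v\<close> replaced by \<open>2\<i> \<partial>\<^sub>v\<close> (\<open>\<partial>\<^sub>v\<close> the \<open>(1, 0)\<close>-derivative),
  has positive real part there. By compactness \<open>r(a + v) + \<epsilon> Re Q(v) > \<epsilon>\<^sup>2 |Q(v)|\<close> for small
  \<open>\<epsilon>\<close> and small \<open>v \<noteq> 0\<close>, which says that the complex hypersurface
  \<open>{a + v + \<epsilon> Q(v) n}\<close> touches the closure of the domain at \<open>a\<close> only. If \<open>w\<close> is the
  function \<open>\<epsilon> Q\<close> minus the normal coordinate, then \<open>w\<close> omits the negative real axis and \<open>0\<close> on the
  rest of the closure, and \<open>exp (- csqrt w)\<close> peaks at \<open>a\<close>.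
\<close>

subsection \<open>Lineal convexity\<close>

text \<open>The complex tangent plane itself cannot serve as the hypersurface, because the closure
  may meet it along real curves: for r = Re z_2 + (Im z_1)^2 the set z_2 = 0, Im z_1 = 0 lies in the
  boundary. There \<open>Q\<close> is z_1^2, and bending the plane by \<open>\<epsilon> * Q\<close>
  lifts it off along the bad directions, while elsewhere r itself dominates. The difficulty is to do
  this uniformly in v, as r has no homogeneous lower bound in terms of |v|. So each v is measured
  against the Taylor coefficients of its own complex line; rescaled polynomials of degree at most K
  form a compact family, and one K works for all lines because the supremum over discs is finite.
  The Taylor remainder disappears since the coefficients together have size at least a constant
  times |v|^K. Why (1, 0)-derivatives with the factor 2 \<i>: a limit vanishing on the real axis is
  a polynomial in y = Im \<zeta>, so the Taylor polynomial in (x, y) has to be evaluated where y =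
  1, and x = \<i> is the value that makes the result holomorphic in v.\<close>

lemma norm_vector_scalar_mult: "norm (c *s v) = cmod c * norm v"
  for v :: "complex ^ 'n"
proof -
  have "norm (c *s v) = sqrt (\<Sum>i\<in>UNIV. (cmod c)\<^sup>2 * (norm (v $ i))\<^sup>2)"
    by (simp add: norm_vec_def L2_set_def norm_mult power_mult_distrib)
  also have "\<dots> = cmod c * norm v"
    by (simp add: norm_vec_def L2_set_def real_sqrt_mult flip: sum_distrib_left)
  finally show ?thesis .
qed

lemma bounded_bilinear_vector_scalar_mult:
  "bounded_bilinear (\<lambda>(c::complex) (v :: complex ^ 'n). c *s v)"
proof (rule bounded_bilinear.intro)
  show "\<exists>K. \<forall>a b. norm (a *s b) \<le> norm (a::complex) * norm (b :: complex ^ 'n) * K"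
    by (rule exI[of _ 1]) (simp add: norm_vector_scalar_mult)
qed (auto simp: vector_sadd_rdistrib vector_add_ldistrib vec_eq_iff algebra_simps)

lemmas tendsto_vector_scalar_mult [tendsto_intros] =
    bounded_bilinear.tendsto[OF bounded_bilinear_vector_scalar_mult]
  and continuous_on_vector_scalar_mult [continuous_intros] =
    bounded_bilinear.continuous_on[OF bounded_bilinear_vector_scalar_mult]
  and bounded_linear_vector_scalar_mult_left =
    bounded_bilinear.bounded_linear_left[OF bounded_bilinear_vector_scalar_mult]

lemma scaleR_eq_vector_scalar_mult: "t *\<^sub>R v = complex_of_real t *s v"
  for v :: "complex ^ 'n"
  by (simp add: vec_eq_iff scaleR_conv_of_real[where 'a = complex])

lemma vector_scalar_mult_Re_Im: "c *s v = Re c *\<^sub>R v + Im c *\<^sub>R (\<i> *s v)"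
  for v :: "complex ^ 'n"
  by (subst (1) complex_eq[of c])
    (simp add: scaleR_eq_vector_scalar_mult vector_smult_assoc vector_sadd_rdistrib mult.commute)

section \<open>Logarithms on the slices of a \<complex>-convex set by complex lines\<close>

lemma exp_eq_imp_eq_if_close:
  assumes "exp w = exp z" "cmod (w - z) < 2 * pi"
  shows "w = z"
proof (rule exp_complex_eqI[OF _ assms(1)])
  show "\<bar>Im w - Im z\<bar> < 2 * pi"
    using abs_Im_le_cmod[of "w - z"] assms(2) by simp
qed

text \<open>Both are logarithms of one function, so their difference takes values in the multiples
  of \<open>2 * pi * \<i>\<close>, which lie \<open>2 * pi\<close> apart.\<close>

lemma continuous_logs_differ_by_const:
  fixes g h :: "'a::topological_space \<Rightarrow> complex"
  assumes "connected S" "continuous_on S g" "continuous_on S h"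
    and "\<And>x. x \<in> S \<Longrightarrow> exp (g x) = exp (h x)" "x \<in> S" "y \<in> S"
  shows "g x - h x = g y - h y"
proof -
  have "(\<lambda>x. g x - h x) constant_on S"
  proof (rule continuous_discrete_range_constant[OF assms(1)])
    show "continuous_on S (\<lambda>x. g x - h x)"
      using assms by (intro continuous_intros)
    fix x assume "x \<in> S"
    show "\<exists>e>0. \<forall>y. y \<in> S \<and> g y - h y \<noteq> g x - h x \<longrightarrow> e \<le> norm (g y - h y - (g x - h x))"
    proof (intro exI[of _ "2*pi"] conjI allI impI)
      fix y assume y: "y \<in> S \<and> g y - h y \<noteq> g x - h x"
      have "exp (g y - h y) = exp (g x - h x)"
        using assms(4) y \<open>x \<in> S\<close> by (simp add: exp_diff)
      then show "2*pi \<le> norm (g y - h y - (g x - h x))"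
        using exp_eq_imp_eq_if_close y by force
    qed auto
  qed
  then show ?thesis using assms(5,6) by (auto simp: constant_on_def)
qed

text \<open>Along the circle the explicit logarithm Ln (k d) + \<i> t gains 2 pi \<i>, whereas
  \<Lambda> returns to its initial value.\<close>

lemma no_continuous_log_on_circle:
  assumes "d > 0" "k \<noteq> 0" "continuous_on (sphere 0 d) \<Lambda>"
    and "\<And>c. cmod c = d \<Longrightarrow> exp (\<Lambda> c) = k * c"
  shows False
proof -
  define \<gamma> where "\<gamma> t = of_real d * exp (\<i> * of_real t)" for t
  have \<gamma>: "cmod (\<gamma> t) = d" for t
    using assms(1) by (simp add: \<gamma>_def norm_mult)
  have "continuous_on {0..2*pi} \<gamma>"
    unfolding \<gamma>_def by (intro continuous_intros)
  then have 1: "continuous_on {0..2*pi} (\<lambda>t. \<Lambda> (\<gamma> t))"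
    by (rule continuous_on_compose2[OF assms(3)]) (auto simp: \<gamma>)
  have 2: "continuous_on {0..2*pi} (\<lambda>t. Ln (k * of_real d) + \<i> * of_real t)"
    by (intro continuous_intros)
  have 3: "exp (\<Lambda> (\<gamma> t)) = exp (Ln (k * of_real d) + \<i> * of_real t)" for t
    using assms(4)[OF \<gamma>, of t] assms(1,2) by (simp only: exp_add exp_Ln mult_eq_0_iff of_real_eq_0_iff less_irrefl \<gamma>_def mult.assoc simp_thms)
  have "\<gamma> (2*pi) = \<gamma> 0" unfolding \<gamma>_def cis_conv_exp[symmetric]
    by simp
  moreover have "\<Lambda> (\<gamma> 0) - (Ln (k * of_real d) + \<i> * of_real 0) =
      \<Lambda> (\<gamma> (2*pi)) - (Ln (k * of_real d) + \<i> * of_real (2*pi))"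
    by (rule continuous_logs_differ_by_const[OF _ 1 2 3]) auto
  ultimately show False by simp
qed

text \<open>Parameters replace the points of the line, so that openness in the plane and the
  characterisation of simple connectedness by continuous logarithms become available.\<close>

lemma C_convex_line_slice:
  fixes E :: "(complex ^ 'n) set"
  assumes "C_convex E" "e \<noteq> 0" "p + \<zeta> *s e \<in> E"
  shows "open {z. p + z *s e \<in> E} \<and> connected {z. p + z *s e \<in> E} \<and>
    simply_connected {z. p + z *s e \<in> E}"
proof -
  define S where "S = {z. p + z *s e \<in> E}"
  define f where "f z = p + z *s e" for z
  have "open E" using assms(1) by (simp add: C_convex_def is_domain_def)
  have contf: "continuous_on A f" for A
    unfolding f_def by (intro continuous_intros)
  have S_vim: "S = f -` E" by (auto simp: S_def f_def)
  have "open S"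
    unfolding S_vim using \<open>open E\<close> contf[of UNIV] by (simp add: open_vimage)
  have im: "f ` S = E \<inter> range f" by (auto simp: S_vim)
  have "complex_line (range f)"
    unfolding complex_line_def f_def using assms(2) by blast
  moreover have "E \<inter> range f \<noteq> {}" using assms(3) by (auto simp: f_def)
  ultimately have c: "simply_connected (f ` S)"
    using assms(1) im unfolding C_convex_def by metis
  \<comment> \<open>A coordinate in which the direction does not vanish recovers the parameter
    continuously.\<close>
  obtain i where i: "e $ i \<noteq> 0" using assms(2) by (auto simp: vec_eq_iff)
  define g where "g x = (x $ i - p $ i) / e $ i" for x
  have contg: "continuous_on A g" for A
    unfolding g_def by (intro continuous_intros) (use i in auto)
  have "homeomorphism S (f ` S) f g"
    by (rule homeomorphismI) (use contf contg i in \<open>auto simp: f_def g_def\<close>)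
  then have "S homeomorphic f ` S" by (auto simp: homeomorphic_def)
  then have "simply_connected S" using c homeomorphic_simply_connected_eq by blast
  then show ?thesis using \<open>open S\<close> simply_connected_imp_connected by (simp add: S_def)
qed

text \<open>As the direction of the line turns once, the second point winds around \<open>p\<close>, while the
  first one does not; they are joined in the slice of \<open>E\<close>, on which \<open>log \<zeta>\<close> exists.\<close>

lemma C_convex_no_winding:
  fixes E :: "(complex ^ 'n) set"
  assumes E: "C_convex E" "p \<notin> E" and d: "d > 0" "s > 0"
    and 1: "\<And>c. cmod c = d \<Longrightarrow> p + (v + c *s n) \<in> E"
    and 2: "\<And>c. cmod c = d \<Longrightarrow> p + (of_real s * cnj c) *s (v + c *s n) \<in> E"
  shows False
proof -
  define S where "S c = {z. p + z *s (v + c *s n) \<in> E}" for c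
  have openE: "open E" using E by (simp add: C_convex_def is_domain_def)
  have nz: "v + c *s n \<noteq> 0" if "cmod c = d" for c
    using 1[OF that] E(2) by auto
  have S: "open (S c)" "connected (S c)" "simply_connected (S c)" if "cmod c = d" for c
    using C_convex_line_slice[OF E(1) nz[OF that], of p 1] 1[OF that] by (auto simp: S_def)
  have mem: "1 \<in> S c" "of_real s * cnj c \<in> S c" if "cmod c = d" for c
    using 1[OF that] 2[OF that] by (auto simp: S_def)
  have "0 \<notin> S c" for c using E(2) by (simp add: S_def)
  then have "\<exists>g. continuous_on (S c) g \<and> (\<forall>z\<in>S c. z = exp (g z))" if "cmod c = d" for c
    using S[OF that] simply_connected_eq_continuous_log[of "S c"]
    by (metis continuous_on_id)
  then obtain g where g: "\<And>c. cmod c = d \<Longrightarrow> continuous_on (S c) (g c)"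
      "\<And>c z. cmod c = d \<Longrightarrow> z \<in> S c \<Longrightarrow> exp (g c z) = z"
    by metis
  \<comment> \<open>The branches \<open>g c\<close> are chosen separately for each c, but the
    difference of two values of one branch on a connected slice does not depend on that
    choice.\<close>
  define \<Lambda> where "\<Lambda> c = g c 1 - g c (of_real s * cnj c)" for c
  have "\<exists>e>0. \<exists>h. isCont h c0 \<and> (\<forall>c\<in>sphere 0 d. dist c c0 < e \<longrightarrow> h c = \<Lambda> c)"
    if c0: "cmod c0 = d" for c0
  proof -
    define w0 where "w0 = of_real s * cnj c0"
    have "path_connected (S c0)"
      using S[OF c0] by (simp add: connected_open_path_connected)
    then obtain \<gamma> where \<gamma>: "path \<gamma>" "path_image \<gamma> \<subseteq> S c0" "pathstart \<gamma> = w0" "pathfinish \<gamma> = 1"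
      using mem[OF c0] unfolding path_connected_def w0_def by blast
    obtain \<rho> where \<rho>: "\<rho> > 0" "cball w0 \<rho> \<subseteq> S c0"
      using S(1)[OF c0] mem(2)[OF c0] open_contains_cball unfolding w0_def by blast
    \<comment> \<open>The disc around \<open>w0\<close> keeps the moving point
      \<open>of_real s * cnj c\<close> in one fixed compact connected set for c near
      \<open>c0\<close>. By the tube lemma this set stays inside the nearby slices, so both branches
      can be compared on it.\<close>
    define K where "K = path_image \<gamma> \<union> cball w0 \<rho>"
    have wK: "w0 \<in> path_image \<gamma>" "1 \<in> path_image \<gamma>"
      using \<gamma> by (metis pathstart_in_path_image, metis pathfinish_in_path_image)
    have K: "compact K" "connected K" "K \<subseteq> S c0"
      using \<gamma> \<rho> wK by (auto simp: K_def compact_path_image connected_path_image intro!: connected_Un)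
    define F where "F = (\<lambda>(c, z). p + z *s (v + c *s n))"
    have "continuous_on UNIV F"
      unfolding F_def case_prod_unfold by (intro continuous_intros)
    then have "open (F -` E)" using openE by (simp add: open_vimage)
    moreover have "{c0} \<times> K \<subseteq> F -` E" using K(3) by (auto simp: F_def S_def)
    ultimately obtain X where X: "c0 \<in> X" "open X" "X \<times> K \<subseteq> F -` E"
      using Elementary_Topology.tube_lemma[OF K(1)] by metis
    have KS: "K \<subseteq> S c" if "c \<in> X" for c
      using X(3) that by (auto simp: F_def S_def)
    obtain e1 where e1: "e1 > 0" "ball c0 e1 \<subseteq> X"
      using X openE by (meson open_contains_ball)
    define e where "e = min e1 (\<rho> / s)"
    have "\<Lambda> c = g c0 1 - g c0 (of_real s * cnj c)" if c: "cmod c = d" "dist c c0 < e" for c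
    proof -
      have "c \<in> X" using c(2) e1 by (auto simp: e_def dist_commute)
      have "dist w0 (of_real s * cnj c) = s * dist c c0"
      proof -
        have "w0 - of_real s * cnj c = of_real s * cnj (c0 - c)"
          by (simp add: w0_def algebra_simps)
        then show ?thesis
          using d by (simp add: dist_norm norm_mult norm_minus_commute del: complex_cnj_diff)
      qed
      also have "\<dots> \<le> \<rho>" using c(2) d by (simp add: e_def field_simps)
      finally have "of_real s * cnj c \<in> K" by (simp add: K_def)
      moreover have "1 \<in> K" using wK by (simp add: K_def)
      moreover have "continuous_on K (g c)" "continuous_on K (g c0)"
        using g(1) c c0 K(3) KS[OF \<open>c \<in> X\<close>] continuous_on_subset by blast+
      moreover have "exp (g c z) = exp (g c0 z)" if "z \<in> K" for z
        using g(2)[OF c(1), of z] g(2)[OF c0, of z] that K(3) KS[OF \<open>c \<in> X\<close>]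
        by (metis subsetD)
      ultimately have "g c 1 - g c0 1 = g c (of_real s * cnj c) - g c0 (of_real s * cnj c)"
        by (intro continuous_logs_differ_by_const[OF K(2)])
      then show ?thesis by (simp add: \<Lambda>_def algebra_simps)
    qed
    moreover have "isCont (\<lambda>c. g c0 1 - g c0 (of_real s * cnj c)) c0"
    proof -
      have "isCont (g c0) (of_real s * cnj c0)"
        using g(1)[OF c0] S(1)[OF c0] mem(2)[OF c0] continuous_on_eq_continuous_at by blast
      then have "isCont (\<lambda>c. g c0 (of_real s * cnj c)) c0"
        using isCont_o2[of c0 "\<lambda>c. of_real s * cnj c" "g c0"]
        by (simp add: continuous_intros)
      then show ?thesis by (rule isCont_diff[OF continuous_const])
    qed
    moreover have "e > 0" using e1 \<rho> d by (simp add: e_def)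
    ultimately show ?thesis by force
  qed
  note loc = this
  have "continuous_on (sphere 0 d) \<Lambda>"
    unfolding continuous_on_eq_continuous_within
  proof
    fix c0 assume "c0 \<in> sphere (0::complex) d"
    then obtain e h where "e > 0" "isCont h c0" "\<forall>c\<in>sphere 0 d. dist c c0 < e \<longrightarrow> h c = \<Lambda> c"
      using loc[of c0] by auto
    from \<open>isCont h c0\<close> have "continuous (at c0 within sphere 0 d) h"
      by (rule continuous_at_imp_continuous_at_within)
    then show "continuous (at c0 within sphere 0 d) \<Lambda>"
      using \<open>c0 \<in> sphere 0 d\<close> \<open>e > 0\<close> \<open>\<forall>c\<in>_. _\<close>
      by (rule_tac continuous_transform_within[where f = h and \<delta> = e]) auto
  qed
  \<comment> \<open>Since |c| = d, the quotient 1 / (s cnj c) is a constant multiple of c.\<close>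
  moreover have "exp (\<Lambda> c) = of_real (1 / (s * d\<^sup>2)) * c" if c: "cmod c = d" for c
  proof -
    have "exp (\<Lambda> c) = 1 / (of_real s * cnj c)"
      using g(2)[OF c] mem[OF c] by (simp add: \<Lambda>_def exp_diff)
    also have "\<dots> = c / (of_real s * (c * cnj c))"
      using c d by auto
    also have "c * cnj c = of_real (d\<^sup>2)" using c complex_norm_square[of c] by metis
    finally show ?thesis by simp
  qed
  ultimately show False
    using no_continuous_log_on_circle[of d "of_real (1 / (s * d\<^sup>2))" \<Lambda>] d by auto
qed

section \<open>The complex tangent plane at a boundary point\<close>

text \<open>For linear \<open>L\<close> this is the complex-linear functional with real part
  \<open>L\<close>; its kernel is the largest complex subspace of the kernel of
  \<open>L\<close>.\<close>

definition complex_linear_part :: "(complex ^ 'n \<Rightarrow> real) \<Rightarrow> complex ^ 'n \<Rightarrow> complex" where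
  "complex_linear_part L v = Complex (L v) (- L (\<i> *s v))"

lemma Re_complex_linear_part [simp]: "Re (complex_linear_part L v) = L v"
  by (simp add: complex_linear_part_def)

context
  fixes L :: "complex ^ 'n \<Rightarrow> real"
  assumes L: "linear L"
begin

lemma linear_vector_scalar_mult: "L (c *s v) = Re c * L v + Im c * L (\<i> *s v)"
  using L by (subst (1) vector_scalar_mult_Re_Im) (simp add: linear_add linear_scale)

lemma complex_linear_part_add:
  "complex_linear_part L (v + w) = complex_linear_part L v + complex_linear_part L w"
  using L by (simp add: complex_linear_part_def vector_add_ldistrib linear_add complex_eq_iff)

lemma complex_linear_part_scale:
  "complex_linear_part L (c *s v) = c * complex_linear_part L v"
  by (simp add: complex_linear_part_def complex_eq_iff vector_smult_assoc
      linear_vector_scalar_mult[of c] linear_vector_scalar_mult[of "\<i> * c"] algebra_simps)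

lemma complex_linear_part_minus: "complex_linear_part L (- w) = - complex_linear_part L w"
  using complex_linear_part_scale[of "-1" w] by (simp add: vector_sneg_minus1[symmetric])

lemma complex_linear_part_diff:
  "complex_linear_part L (v - w) = complex_linear_part L v - complex_linear_part L w"
  using complex_linear_part_add[of v "- w"] by (simp add: complex_linear_part_minus)

end

text \<open>If v = q - p were complex tangent, \<open>C_convex_no_winding\<close> would apply. The
  point \<open>p + (v + c *s n)\<close> is close to q, hence in E. The factor
  \<open>of_real s * cnj c\<close> turns the normal part - c into - s |c|^2, a real descent, so the
  second point lies in {r < 0} near p for every c on the circle.\<close>

lemma C_convex_misses_complex_tangent:
  fixes E :: "(complex ^ 'n) set"
  assumes E: "C_convex E" "p \<notin> E" and r: "(r has_derivative L) (at p)" "r p = 0" "L u \<noteq> 0"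
    and W: "open W" "p \<in> W" "\<And>x. x \<in> W \<Longrightarrow> r x < 0 \<Longrightarrow> x \<in> E" and "q \<in> E"
  shows "complex_linear_part L (q - p) \<noteq> 0"
proof
  assume tang: "complex_linear_part L (q - p) = 0"
  have L: "linear L" using r has_derivative_linear by blast
  have u: "complex_linear_part L u \<noteq> 0"
    using r(3) by (metis Re_complex_linear_part zero_complex.sel(1))
  define n where "n = (- 1 / complex_linear_part L u) *s u"
  define v where "v = q - p"
  have n: "complex_linear_part L n = -1"
    using u by (simp add: n_def complex_linear_part_minus[OF L] complex_linear_part_scale[OF L])
  have "open E" using E by (simp add: C_convex_def is_domain_def)
  then obtain \<rho> where \<rho>: "\<rho> > 0" "ball q \<rho> \<subseteq> E" using \<open>q \<in> E\<close> open_contains_ball by blast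
  define d where "d = \<rho> / (norm n + 1)"
  have npos: "norm n + 1 > 0" by (simp add: add_nonneg_pos)
  have d: "d > 0" using \<rho> npos by (simp add: d_def)
  have 1: "p + (v + c *s n) \<in> E" if "cmod c = d" for c
  proof -
    have "d * norm n < d * (norm n + 1)" using d by simp
    also have "\<dots> = \<rho>" using npos by (simp add: d_def)
    finally have "norm (c *s n) < \<rho>" by (simp add: norm_vector_scalar_mult that)
    then have "q + c *s n \<in> ball q \<rho>" by (simp add: dist_norm)
    then show ?thesis using \<rho>(2) by (auto simp: v_def algebra_simps)
  qed
  define M where "M = norm v + d * norm n + 1"
  have M: "M > 0" "M \<ge> 1" using d by (auto simp: M_def add_nonneg_pos)
  \<comment> \<open>The linear decrease is s d^2 and the remainder at most
    \<open>\<eta> * (s * d * M)\<close>; this value makes the remainder half of the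
    decrease.\<close>
  define \<eta> where "\<eta> = d / (2 * M)"
  have "\<eta> > 0" using d M by (simp add: \<eta>_def)
  then obtain \<tau>1 where \<tau>1: "\<tau>1 > 0"
      "\<And>y. norm (y - p) < \<tau>1 \<Longrightarrow> norm (r y - r p - L (y - p)) \<le> \<eta> * norm (y - p)"
    using r(1) unfolding has_derivative_at_alt by blast
  obtain \<tau>2 where \<tau>2: "\<tau>2 > 0" "ball p \<tau>2 \<subseteq> W"
    using W open_contains_ball by blast
  define \<tau> where "\<tau> = min \<tau>1 \<tau>2"
  define s where "s = \<tau> / (2 * d * M)"
  have s: "s > 0" using \<tau>1 \<tau>2 d M by (simp add: s_def \<tau>_def)
  have 2: "p + (of_real s * cnj c) *s (v + c *s n) \<in> E" if c: "cmod c = d" for c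
  proof -
    define h where "h = (of_real s * cnj c) *s (v + c *s n)"
    have "norm (v + c *s n) \<le> norm v + d * norm n"
      using norm_triangle_ineq[of v "c *s n"] by (simp add: norm_vector_scalar_mult c)
    then have "norm (v + c *s n) \<le> M" by (simp add: M_def)
    then have h: "norm h \<le> s * d * M"
      unfolding h_def norm_vector_scalar_mult using s d c by (simp add: norm_mult)
    also have "s * d * M = \<tau> / 2" using d M by (simp add: s_def)
    also have "\<tau> / 2 < \<tau>" using \<tau>1(1) \<tau>2(1) by (simp add: \<tau>_def min_def)
    finally have hs: "norm h < \<tau>1" "norm h < \<tau>2" by (auto simp: \<tau>_def)
    have "complex_linear_part L h = of_real s * cnj c * (0 - c)"
      using tang unfolding h_def v_def complex_linear_part_scale[OF L] complex_linear_part_add[OF L] n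
      by simp
    also have "\<dots> = - of_real s * (c * cnj c)" by (simp add: algebra_simps)
    also have "c * cnj c = of_real (d\<^sup>2)" using c complex_norm_square[of c] by metis
    finally have "L h = - s * d\<^sup>2"
      using Re_complex_linear_part[of L h] by simp
    moreover have "r (p + h) \<le> L h + \<eta> * norm h"
      using \<tau>1(2)[of "p + h"] hs(1) r(2) by (simp add: abs_le_iff)
    moreover have "\<eta> * norm h \<le> \<eta> * (s * d * M)"
      using h \<open>\<eta> > 0\<close> by (intro mult_left_mono) auto
    moreover have "\<eta> * (s * d * M) = s * d\<^sup>2 / 2"
      using M by (simp add: \<eta>_def power2_eq_square)
    moreover have "s * d\<^sup>2 > 0" using s d by simp
    ultimately have "r (p + h) < 0" by linarith
    moreover have "p + h \<in> W" using hs(2) \<tau>2(2) by (auto simp: dist_norm)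
    ultimately show ?thesis using W(3) by (simp add: h_def)
  qed
  show False
    using C_convex_no_winding[OF E d s 1 2] by blast
qed

subsection \<open>Iterated derivatives\<close>

lemma iter_deriv_append: "iter_deriv (us @ vs) f = iter_deriv us (iter_deriv vs f)"
  by (induction us) auto

lemma smooth_on_iter_deriv: "smooth_on W f \<Longrightarrow> smooth_on W (iter_deriv vs f)"
  unfolding smooth_on_def by (simp flip: iter_deriv_append)

lemma smooth_on_has_derivative:
  assumes "smooth_on W f" "x \<in> W"
  shows "(iter_deriv vs f has_derivative (\<lambda>v. iter_deriv (v # vs) f x)) (at x)"
proof -
  have "iter_deriv vs f differentiable (at x)" using assms by (auto simp: smooth_on_def)
  then show ?thesis by (simp add: frechet_derivative_works eta_contract_eq)
qed

lemma smooth_on_continuous_on: "smooth_on W f \<Longrightarrow> continuous_on W (iter_deriv vs f)"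
  by (intro continuous_at_imp_continuous_on ballI has_derivative_continuous[OF smooth_on_has_derivative])

text \<open>Formulas for iterated derivatives are available on W only; as W is open, they can still
  be differentiated at its points.\<close>

lemma iter_deriv_Cons_eqI:
  assumes "open W" "x \<in> W" "\<And>y. y \<in> W \<Longrightarrow> iter_deriv vs f y = g y" "(g has_derivative g') (at x)"
  shows "iter_deriv (v # vs) f x = g' v"
proof -
  have "(iter_deriv vs f has_derivative g') (at x)"
    by (rule has_derivative_transform_within_open[OF assms(4,1,2)]) (simp add: assms(3))
  then show ?thesis using frechet_derivative_at by fastforce
qed

text \<open>The head of the list is the argument of a Frechet derivative, hence linear. Linearity in
  a later slot is an identity at all points of W, so it survives the derivatives applied
  afterwards.\<close>

lemma iter_deriv_linear_slot:
  assumes f: "smooth_on W f" and "x \<in> W"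
  shows "linear (\<lambda>v. iter_deriv (us @ v # vs) f x)"
  using \<open>x \<in> W\<close>
proof (induction us arbitrary: x)
  case Nil
  then show ?case using smooth_on_has_derivative[OF f] has_derivative_linear by fastforce
next
  case (Cons u us)
  have W: "open W" using f by (simp add: smooth_on_def)
  note D = smooth_on_has_derivative[OF f Cons.prems]
  show ?case
  proof (rule linearI)
    fix v w
    show "iter_deriv ((u # us) @ (v + w) # vs) f x =
        iter_deriv ((u # us) @ v # vs) f x + iter_deriv ((u # us) @ w # vs) f x"
      unfolding append_Cons
      by (rule iter_deriv_Cons_eqI[OF W Cons.prems _ has_derivative_add[OF D D]])
        (simp add: linear_add[OF Cons.IH])
    fix c
    show "iter_deriv ((u # us) @ (c *\<^sub>R v) # vs) f x = c *\<^sub>R iter_deriv ((u # us) @ v # vs) f x"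
      unfolding append_Cons
      by (rule iter_deriv_Cons_eqI[OF W Cons.prems _ has_derivative_scaleR_right[OF D]])
        (simp add: linear_scale[OF Cons.IH])
  qed
qed

section \<open>Symmetry of higher derivatives\<close>

text \<open>The mean value theorem in direction v turns the second difference into a difference of
  two values of the derivative along v; differentiability of that derivative at x then gives the
  limit.\<close>

lemma second_difference:
  fixes f :: "'a::euclidean_space \<Rightarrow> real"
  assumes f: "smooth_on W f" and x: "x \<in> W" and "\<eta> > 0"
  shows "\<exists>d>0. \<forall>s. 0 < s \<and> s < d \<longrightarrow>
    \<bar>f (x + s *\<^sub>R v + s *\<^sub>R w) - f (x + s *\<^sub>R v) - f (x + s *\<^sub>R w) + f x
      - s\<^sup>2 * iter_deriv [w, v] f x\<bar> \<le> \<eta> * s\<^sup>2"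
proof -
  define K where "K = norm v + norm w + 1"
  have K: "K > 0" by (simp add: K_def add_nonneg_pos)
  define L where "L h = iter_deriv [h, v] f x" for h
  have DL: "(iter_deriv [v] f has_derivative L) (at x)"
    using smooth_on_has_derivative[OF f x, of "[v]"] unfolding L_def[abs_def] .
  have linL: "linear L" using DL has_derivative_linear by blast
  \<comment> \<open>Two values of the derivative along v enter, each with error
    \<open>\<epsilon> * (s * K)\<close>, and the mean value theorem adds a factor s.\<close>
  define \<epsilon> where "\<epsilon> = \<eta> / (2 * K)"
  have "\<epsilon> > 0" using assms K by (simp add: \<epsilon>_def)
  then obtain t where t: "t > 0" "\<And>y. norm (y - x) < t \<Longrightarrow>
      norm (iter_deriv [v] f y - iter_deriv [v] f x - L (y - x)) \<le> \<epsilon> * norm (y - x)"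
    using DL unfolding has_derivative_at_alt by blast
  obtain \<rho> where \<rho>: "\<rho> > 0" "ball x \<rho> \<subseteq> W"
    using f x open_contains_ball unfolding smooth_on_def by blast
  define d where "d = min t \<rho> / K"
  have "d > 0" using t \<rho> K by (simp add: d_def)
  moreover have "\<bar>f (x + s *\<^sub>R v + s *\<^sub>R w) - f (x + s *\<^sub>R v) - f (x + s *\<^sub>R w) + f x
      - s\<^sup>2 * iter_deriv [w, v] f x\<bar> \<le> \<eta> * s\<^sup>2" if s: "0 < s" "s < d" for s
  proof -
    have sK: "s * K < t" "s * K < \<rho>" using s K by (auto simp: d_def field_simps)
    have small: "norm (\<theta> *\<^sub>R v + \<sigma> *\<^sub>R w) \<le> s * K" if "0 \<le> \<theta>" "\<theta> \<le> s" "0 \<le> \<sigma>" "\<sigma> \<le> s" for \<theta> \<sigma>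
    proof -
      have "norm (\<theta> *\<^sub>R v + \<sigma> *\<^sub>R w) \<le> \<theta> * norm v + \<sigma> * norm w"
        using norm_triangle_ineq[of "\<theta> *\<^sub>R v" "\<sigma> *\<^sub>R w"] that by simp
      also have "\<dots> \<le> s * norm v + s * norm w"
        using that by (intro add_mono mult_right_mono) auto
      also have "\<dots> \<le> s * K" using s by (simp add: K_def algebra_simps)
      finally show ?thesis .
    qed
    have inW: "x + (\<theta> *\<^sub>R v + \<sigma> *\<^sub>R w) \<in> W"
      if "0 \<le> \<theta>" "\<theta> \<le> s" "0 \<le> \<sigma>" "\<sigma> \<le> s" for \<theta> \<sigma>
    proof -
      have "norm (\<theta> *\<^sub>R v + \<sigma> *\<^sub>R w) < \<rho>" using small[OF that] sK by linarith
      then have "x + (\<theta> *\<^sub>R v + \<sigma> *\<^sub>R w) \<in> ball x \<rho>"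
        by (metis add_diff_cancel_left' dist_commute dist_norm mem_ball)
      then show ?thesis using \<rho> by blast
    qed
    have deriv: "((\<lambda>\<theta>. f (x + (\<theta> *\<^sub>R v + \<sigma> *\<^sub>R w))) has_real_derivative
        iter_deriv [v] f (x + (\<theta> *\<^sub>R v + \<sigma> *\<^sub>R w))) (at \<theta>)"
      if "0 \<le> \<theta>" "\<theta> \<le> s" "0 \<le> \<sigma>" "\<sigma> \<le> s" for \<theta> \<sigma>
    proof -
      have "((\<lambda>\<theta>. x + (\<theta> *\<^sub>R v + \<sigma> *\<^sub>R w)) has_derivative (\<lambda>h. h *\<^sub>R v)) (at \<theta>)"
        by (auto intro!: derivative_eq_intros)
      from has_derivative_compose[OF this smooth_on_has_derivative[OF f inW[OF that], of "[]"]]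
      have "((\<lambda>\<theta>. f (x + (\<theta> *\<^sub>R v + \<sigma> *\<^sub>R w))) has_derivative
        (\<lambda>h. iter_deriv [h *\<^sub>R v] f (x + (\<theta> *\<^sub>R v + \<sigma> *\<^sub>R w)))) (at \<theta>)"
        by simp
      moreover have "iter_deriv [h *\<^sub>R v] f y = iter_deriv [v] f y * h" if "y \<in> W" for h y
        using linear_scale[OF iter_deriv_linear_slot[OF f that, of "[]" "[]"]] by (simp add: mult.commute)
      ultimately show ?thesis using inW[OF that] by (simp add: has_field_derivative_def)
    qed
    define g where "g \<theta> = f (x + (\<theta> *\<^sub>R v + s *\<^sub>R w)) - f (x + (\<theta> *\<^sub>R v + 0 *\<^sub>R w))" for \<theta>
    define g' where "g' \<theta> = iter_deriv [v] f (x + (\<theta> *\<^sub>R v + s *\<^sub>R w))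
        - iter_deriv [v] f (x + (\<theta> *\<^sub>R v + 0 *\<^sub>R w))" for \<theta>
    have "(g has_real_derivative g' \<theta>) (at \<theta>)" if "0 \<le> \<theta>" "\<theta> \<le> s" for \<theta>
      unfolding g_def g'_def using s that by (intro DERIV_diff deriv) auto
    then have "\<exists>\<theta>>0. \<theta> < s \<and> g s - g 0 = (s - 0) * g' \<theta>"
      using s by (intro MVT2) auto
    then obtain \<theta> where \<theta>: "0 < \<theta>" "\<theta> < s" and g: "g s - g 0 = s *
        (iter_deriv [v] f (x + (\<theta> *\<^sub>R v + s *\<^sub>R w)) - iter_deriv [v] f (x + (\<theta> *\<^sub>R v + 0 *\<^sub>R w)))"
      by (auto simp only: g'_def diff_zero)
    have e: "\<bar>iter_deriv [v] f (x + (\<theta> *\<^sub>R v + \<sigma> *\<^sub>R w)) - iter_deriv [v] f x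
        - L (\<theta> *\<^sub>R v + \<sigma> *\<^sub>R w)\<bar> \<le> \<epsilon> * (s * K)" if "0 \<le> \<sigma>" "\<sigma> \<le> s" for \<sigma>
    proof -
      have n: "norm (\<theta> *\<^sub>R v + \<sigma> *\<^sub>R w) \<le> s * K" using small that \<theta> by simp
      then have "\<bar>iter_deriv [v] f (x + (\<theta> *\<^sub>R v + \<sigma> *\<^sub>R w)) - iter_deriv [v] f x
          - L (\<theta> *\<^sub>R v + \<sigma> *\<^sub>R w)\<bar> \<le> \<epsilon> * norm (\<theta> *\<^sub>R v + \<sigma> *\<^sub>R w)"
        using t(2)[of "x + (\<theta> *\<^sub>R v + \<sigma> *\<^sub>R w)"] sK by simp
      also have "\<dots> \<le> \<epsilon> * (s * K)" using n \<open>\<epsilon> > 0\<close> by simp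
      finally show ?thesis .
    qed
    have "\<bar>iter_deriv [v] f (x + (\<theta> *\<^sub>R v + s *\<^sub>R w)) - iter_deriv [v] f (x + (\<theta> *\<^sub>R v + 0 *\<^sub>R w))
        - s * L w\<bar> \<le> 2 * (\<epsilon> * (s * K))"
      using e[of s] e[of 0] s by (simp add: linear_add[OF linL] linear_scale[OF linL])
    also have "2 * (\<epsilon> * (s * K)) = \<eta> * s" using K by (simp add: \<epsilon>_def)
    finally have "\<bar>s * (iter_deriv [v] f (x + (\<theta> *\<^sub>R v + s *\<^sub>R w)) -
        iter_deriv [v] f (x + (\<theta> *\<^sub>R v + 0 *\<^sub>R w)) - s * L w)\<bar> \<le> s * (\<eta> * s)"
      using s by (simp add: abs_mult)
    then have "\<bar>g s - g 0 - s\<^sup>2 * L w\<bar> \<le> \<eta> * s\<^sup>2"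
      by (simp add: g right_diff_distrib power2_eq_square mult.assoc mult.left_commute)
    then show ?thesis by (simp add: g_def L_def algebra_simps)
  qed
  ultimately show ?thesis by blast
qed

text \<open>The second difference is symmetric in v and w, and divided by s^2 it tends to both mixed
  derivatives.\<close>

lemma iter_deriv_swap:
  fixes f :: "'a::euclidean_space \<Rightarrow> real"
  assumes f: "smooth_on W f" and x: "x \<in> W"
  shows "iter_deriv (v # w # us) f x = iter_deriv (w # v # us) f x"
proof -
  define F where "F = iter_deriv us f"
  have F: "smooth_on W F" using f by (simp add: F_def smooth_on_iter_deriv)
  have bound: "\<bar>iter_deriv [v, w] F x - iter_deriv [w, v] F x\<bar> \<le> e" if "e > 0" for e
  proof -
    have e2: "e / 2 > 0" using that by simp
    obtain d1 where d1: "d1 > 0" "\<And>s. 0 < s \<Longrightarrow> s < d1 \<Longrightarrow>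
      \<bar>F (x + s *\<^sub>R v + s *\<^sub>R w) - F (x + s *\<^sub>R v) - F (x + s *\<^sub>R w) + F x
        - s\<^sup>2 * iter_deriv [w, v] F x\<bar> \<le> e/2 * s\<^sup>2"
      using second_difference[OF F x e2, of v w] by auto
    obtain d2 where d2: "d2 > 0" "\<And>s. 0 < s \<Longrightarrow> s < d2 \<Longrightarrow>
      \<bar>F (x + s *\<^sub>R w + s *\<^sub>R v) - F (x + s *\<^sub>R w) - F (x + s *\<^sub>R v) + F x
        - s\<^sup>2 * iter_deriv [v, w] F x\<bar> \<le> e/2 * s\<^sup>2"
      using second_difference[OF F x e2, of w v] by auto
    define s where "s = min d1 d2 / 2"
    have s: "0 < s" "s < d1" "s < d2" using d1(1) d2(1) by (auto simp: s_def min_def)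
    have c: "x + s *\<^sub>R w + s *\<^sub>R v = x + s *\<^sub>R v + s *\<^sub>R w" by (simp add: add_ac)
    have "\<bar>s\<^sup>2 * iter_deriv [v, w] F x - s\<^sup>2 * iter_deriv [w, v] F x\<bar> \<le> e * s\<^sup>2"
      using d1(2)[OF s(1,2)] d2(2)[OF s(1,3)] unfolding c abs_le_iff by linarith
    moreover have "s\<^sup>2 * iter_deriv [v, w] F x - s\<^sup>2 * iter_deriv [w, v] F x
        = s\<^sup>2 * (iter_deriv [v, w] F x - iter_deriv [w, v] F x)"
      by (simp only: right_diff_distrib)
    ultimately have "s\<^sup>2 * \<bar>iter_deriv [v, w] F x - iter_deriv [w, v] F x\<bar> \<le> s\<^sup>2 * e"
      by (simp only: abs_mult abs_power2 mult.commute[of e])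
    moreover have "s\<^sup>2 > 0" using s by simp
    ultimately show ?thesis using mult_le_cancel_left_pos by blast
  qed
  have "iter_deriv [v, w] F x - iter_deriv [w, v] F x = 0"
  proof (rule ccontr)
    assume "iter_deriv [v, w] F x - iter_deriv [w, v] F x \<noteq> 0"
    then show False
      using bound[of "\<bar>iter_deriv [v, w] F x - iter_deriv [w, v] F x\<bar> / 2"] by simp
  qed
  then show ?thesis by (simp add: F_def flip: iter_deriv_append)
qed

lemma iter_deriv_cong_mset:
  fixes f :: "'a::euclidean_space \<Rightarrow> real"
  assumes f: "smooth_on W f" and "x \<in> W" "mset vs = mset ws"
  shows "iter_deriv vs f x = iter_deriv ws f x"
proof -
  have W: "open W" using f by (simp add: smooth_on_def)
  have cong: "iter_deriv (v # vs) f x = iter_deriv (v # ws) f x"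
    if "\<And>y. y \<in> W \<Longrightarrow> iter_deriv vs f y = iter_deriv ws f y" "x \<in> W" for v vs ws x
    using iter_deriv_Cons_eqI[OF W that(2,1) smooth_on_has_derivative[OF f that(2)]] .
  have move: "iter_deriv (us @ v # vs) f x = iter_deriv (v # us @ vs) f x" if "x \<in> W" for us v vs x
    using that
  proof (induction us arbitrary: x)
    case (Cons u us)
    have "iter_deriv (u # us @ v # vs) f x = iter_deriv (u # v # us @ vs) f x"
      using Cons by (intro cong) auto
    then show ?case using iter_deriv_swap[OF f Cons.prems] by simp
  qed simp
  show ?thesis using assms(2,3)
  proof (induction vs arbitrary: ws x)
    case (Cons v vs)
    obtain us us' where ws: "ws = us @ v # us'"
      using Cons.prems(2) by (metis list.set_intros(1) mset_eq_setD split_list)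
    have "iter_deriv (v # vs) f x = iter_deriv (v # us @ us') f x"
      using Cons.prems by (intro cong Cons.IH) (auto simp: ws)
    then show ?case using move[OF Cons.prems(1)] ws by simp
  qed simp
qed

subsection \<open>Multilinear forms and Taylor polynomials\<close>

definition multilinear :: "('a::euclidean_space list \<Rightarrow> real) \<Rightarrow> bool" where
  "multilinear B \<longleftrightarrow> (\<forall>us vs. linear (\<lambda>v. B (us @ v # vs)))"

lemma multilinear_Cons: "multilinear B \<Longrightarrow> multilinear (\<lambda>l. B (v # l))"
  unfolding multilinear_def by (simp flip: append_Cons)

lemma multilinear_linear_Cons: "multilinear B \<Longrightarrow> linear (\<lambda>v. B (v # l))"
  unfolding multilinear_def by (drule spec[of _ "[]"]) simp

lemma multilinear_add: "multilinear B \<Longrightarrow> B ((v + w) # l) = B (v # l) + B (w # l)"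
  and multilinear_scaleR: "multilinear B \<Longrightarrow> B ((c *\<^sub>R v) # l) = c * B (v # l)"
  using linear_add[OF multilinear_linear_Cons[of B l]] linear_scale[OF multilinear_linear_Cons[of B l]]
  by simp_all

lemma multilinear_expand:
  assumes "multilinear B"
  shows "B (v # l) = (\<Sum>b\<in>Basis. (v \<bullet> b) * B (b # l))"
proof -
  have "B (v # l) = B ((\<Sum>b\<in>Basis. (v \<bullet> b) *\<^sub>R b) # l)" by (simp add: euclidean_representation)
  also have "\<dots> = (\<Sum>b\<in>Basis. B (((v \<bullet> b) *\<^sub>R b) # l))"
    by (rule linear_sum[OF multilinear_linear_Cons[OF assms]])
  also have "\<dots> = (\<Sum>b\<in>Basis. (v \<bullet> b) * B (b # l))"
    by (simp add: multilinear_scaleR[OF assms])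
  finally show ?thesis .
qed

lemma multilinear_continuous_on:
  assumes "multilinear B" "\<And>g. g \<in> set gs \<Longrightarrow> continuous_on S g"
  shows "continuous_on S (\<lambda>v. B (map (\<lambda>g. g v) gs))"
  using assms
proof (induction gs arbitrary: B)
  case (Cons g gs)
  have "continuous_on S (\<lambda>v. \<Sum>b\<in>Basis. (g v \<bullet> b) * B (b # map (\<lambda>g. g v) gs))"
    using Cons.prems by (intro continuous_intros Cons.IH multilinear_Cons) auto
  moreover have "B (map (\<lambda>g. g v) (g # gs)) =
      (\<Sum>b\<in>Basis. (g v \<bullet> b) * B (b # map (\<lambda>g. g v) gs))" for v
    using multilinear_expand[OF Cons.prems(1), of "g v" "map (\<lambda>g. g v) gs"] by simp
  ultimately show ?case by (simp only:)
qed auto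

text \<open>A bound for each single list is enough, because expansion in the basis reduces length k
  to finitely many lists of basis vectors.\<close>

lemma multilinear_uniformly_bounded:
  fixes B :: "'b \<Rightarrow> 'a::euclidean_space list \<Rightarrow> real"
  assumes "\<And>x. x \<in> K \<Longrightarrow> multilinear (B x)" "\<And>l. \<exists>M. \<forall>x\<in>K. \<bar>B x l\<bar> \<le> M"
  shows "\<exists>C\<ge>0. \<forall>x\<in>K. \<forall>l. length l = k \<longrightarrow> \<bar>B x l\<bar> \<le> C * prod_list (map norm l)"
  using assms
proof (induction k arbitrary: B)
  case 0
  from 0(2)[of "[]"] obtain M where "\<forall>x\<in>K. \<bar>B x []\<bar> \<le> M" by blast
  then show ?case by (intro exI[of _ "max M 0"]) (auto simp: max_def intro: order_trans)
next
  case (Suc k)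
  have "\<exists>C\<ge>0. \<forall>x\<in>K. \<forall>l. length l = k \<longrightarrow> \<bar>B x (b # l)\<bar> \<le> C * prod_list (map norm l)" for b
    by (rule Suc.IH) (use Suc.prems in \<open>auto intro: multilinear_Cons\<close>)
  then obtain C where C: "\<And>b. C b \<ge> 0"
    "\<And>b x l. x \<in> K \<Longrightarrow> length l = k \<Longrightarrow> \<bar>B x (b # l)\<bar> \<le> C b * prod_list (map norm l)"
    by metis
  show ?case
  proof (intro exI[of _ "sum C Basis"] conjI ballI allI impI)
    show "sum C Basis \<ge> 0" using C(1) by (simp add: sum_nonneg)
    fix x and l :: "'a list" assume x: "x \<in> K" and "length l = Suc k"
    then obtain v l' where l: "l = v # l'" "length l' = k" by (auto simp: length_Suc_conv)
    have "prod_list (map norm k) \<ge> 0" for k :: "'a list" by (induction k) auto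
    note nn = this[of l']
    have "\<bar>B x l\<bar> \<le> (\<Sum>b\<in>Basis. \<bar>(v \<bullet> b) * B x (b # l')\<bar>)"
      unfolding l multilinear_expand[OF Suc.prems(1)[OF x], of v] by (rule sum_abs)
    also have "\<dots> \<le> (\<Sum>b\<in>Basis. norm v * (C b * prod_list (map norm l')))"
      unfolding abs_mult using C x l nn by (intro sum_mono mult_mono) (auto simp: Basis_le_norm)
    also have "\<dots> = sum C Basis * prod_list (map norm l)"
      by (simp add: l sum_distrib_left sum_distrib_right mult_ac)
    finally show "\<bar>B x l\<bar> \<le> sum C Basis * prod_list (map norm l)" .
  qed
qed

lemma iter_deriv_multilinear:
  fixes f :: "'a::euclidean_space \<Rightarrow> real"
  shows "smooth_on W f \<Longrightarrow> x \<in> W \<Longrightarrow> multilinear (\<lambda>l. iter_deriv l f x)"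
  unfolding multilinear_def by (simp add: iter_deriv_linear_slot)

lemma iter_deriv_bounded:
  fixes f :: "'a::euclidean_space \<Rightarrow> real"
  assumes f: "smooth_on W f" and W: "cball a d \<subseteq> W"
  shows "\<exists>C\<ge>0. \<forall>x\<in>cball a d. \<forall>l. length l = k \<longrightarrow> \<bar>iter_deriv l f x\<bar> \<le> C * prod_list (map norm l)"
proof (rule multilinear_uniformly_bounded)
  show "multilinear (\<lambda>l. iter_deriv l f x)" if "x \<in> cball a d" for x
    using iter_deriv_multilinear[OF f] W that by blast
  fix l
  have "compact (iter_deriv l f ` cball a d)"
    using smooth_on_continuous_on[OF f] W
    by (intro compact_continuous_image) (auto intro: continuous_on_subset)
  then have "bounded (iter_deriv l f ` cball a d)" by (rule compact_imp_bounded)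
  then show "\<exists>M. \<forall>x\<in>cball a d. \<bar>iter_deriv l f x\<bar> \<le> M" unfolding bounded_iff by auto
qed

text \<open>The one-variable Maclaurin formula on the segment from a to a + v; compactness of the
  ball makes the constant independent of v.\<close>

lemma smooth_on_Taylor:
  fixes f :: "'a::euclidean_space \<Rightarrow> real"
  assumes f: "smooth_on W f" and W: "cball a d \<subseteq> W"
  shows "\<exists>C\<ge>0. \<forall>v. norm v \<le> d \<longrightarrow>
    \<bar>f (a + v) - (\<Sum>j\<le>N. iter_deriv (replicate j v) f a / fact j)\<bar> \<le> C * norm v ^ Suc N"
proof -
  obtain C where C: "C \<ge> 0" "\<And>x l. x \<in> cball a d \<Longrightarrow> length l = Suc N \<Longrightarrow>
      \<bar>iter_deriv l f x\<bar> \<le> C * prod_list (map norm l)" using iter_deriv_bounded[OF assms, of "Suc N"] by blast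
  have "\<bar>f (a + v) - (\<Sum>j\<le>N. iter_deriv (replicate j v) f a / fact j)\<bar> \<le> C * norm v ^ Suc N"
    if v: "norm v \<le> d" for v
  proof -
    have inb: "a + t *\<^sub>R v \<in> cball a d" if "\<bar>t\<bar> \<le> 1" for t
    proof -
      have "\<bar>t\<bar> * norm v \<le> 1 * norm v" using that by (intro mult_right_mono) auto
      then show ?thesis using v by (simp add: dist_norm)
    qed
    define g where "g j t = iter_deriv (replicate j v) f (a + t *\<^sub>R v)" for j t
    have "DERIV (g j) t :> g (Suc j) t" if "\<bar>t\<bar> \<le> \<bar>1\<bar>" for j t
    proof -
      have x: "a + t *\<^sub>R v \<in> W" using inb that W by auto
      have "((\<lambda>t. a + t *\<^sub>R v) has_derivative (\<lambda>h. h *\<^sub>R v)) (at t)"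
        by (auto intro!: derivative_eq_intros)
      from has_derivative_compose[OF this smooth_on_has_derivative[OF f x]]
      have "(g j has_derivative (\<lambda>h. iter_deriv ((h *\<^sub>R v) # replicate j v) f (a + t *\<^sub>R v))) (at t)"
        unfolding g_def[abs_def] .
      moreover have "iter_deriv ((h *\<^sub>R v) # replicate j v) f (a + t *\<^sub>R v) = g (Suc j) t * h" for h
        using linear_scale[OF multilinear_linear_Cons[OF iter_deriv_multilinear[OF f x]], of h v "replicate j v"]
        by (simp add: g_def mult.commute del: iter_deriv.simps)
      ultimately show ?thesis by (simp only: has_field_derivative_def)
    qed
    then have "\<exists>t. \<bar>t\<bar> \<le> \<bar>1\<bar> \<and> g 0 1 = (\<Sum>m<Suc N. g m 0 / fact m * 1 ^ m) + g (Suc N) t / fact (Suc N) * 1 ^ Suc N"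
      by (intro Maclaurin_bi_le) auto
    then obtain t where t: "\<bar>t\<bar> \<le> 1"
      "g 0 1 = (\<Sum>m<Suc N. g m 0 / fact m) + g (Suc N) t / fact (Suc N)" by auto
    have "f (a + v) - (\<Sum>j\<le>N. iter_deriv (replicate j v) f a / fact j) = g (Suc N) t / fact (Suc N)"
      using t(2) by (simp add: g_def lessThan_Suc_atMost del: fact_Suc replicate_Suc)
    also have "\<bar>\<dots>\<bar> \<le> \<bar>g (Suc N) t\<bar>"
      using fact_ge_1[of "Suc N", where 'a = real]
      by (simp add: divide_le_eq mult_le_cancel_left1 del: fact_Suc)
    also have "\<dots> \<le> C * prod_list (map norm (replicate (Suc N) v))"
      unfolding g_def using C(2)[OF inb[OF t(1)], of "replicate (Suc N) v"] by simp
    also have "prod_list (map norm (replicate (Suc N) v)) = norm v ^ Suc N"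
      by (simp only: map_replicate prod_list_replicate)
    finally show ?thesis .
  qed
  then show ?thesis using C(1) by blast
qed

text \<open>\<open>polyval j B u w x y\<close> is the form \<open>B\<close> of degree \<open>j\<close> on the diagonal at \<open>x u + y w\<close>;
  for complex \<open>x\<close> and \<open>y\<close> it is the value of the complexified form.\<close>

primrec polyval :: "nat \<Rightarrow> ('a list \<Rightarrow> real) \<Rightarrow> 'a \<Rightarrow> 'a \<Rightarrow> 'b::real_algebra_1 \<Rightarrow> 'b \<Rightarrow> 'b" where
  "polyval 0 B u w x y = of_real (B [])"
| "polyval (Suc j) B u w x y =
    x * polyval j (\<lambda>l. B (u # l)) u w x y + y * polyval j (\<lambda>l. B (w # l)) u w x y"

text \<open>The coefficient of x^m y^(j - m) in \<open>polyval\<close>; the shift to m - 1 accounts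
  for the factor x that u contributes in the first slot.\<close>

primrec polycoeff :: "nat \<Rightarrow> ('a list \<Rightarrow> real) \<Rightarrow> 'a \<Rightarrow> 'a \<Rightarrow> nat \<Rightarrow> real" where
  "polycoeff 0 B u w m = (if m = 0 then B [] else 0)"
| "polycoeff (Suc j) B u w m =
    (if m = 0 then 0 else polycoeff j (\<lambda>l. B (u # l)) u w (m - 1)) + polycoeff j (\<lambda>l. B (w # l)) u w m"

lemma polycoeff_eq_0: "m > j \<Longrightarrow> polycoeff j B u w m = 0"
  by (induction j arbitrary: B m) auto

lemma polyval_eq_sum:
  fixes x y :: "'b::{real_algebra_1, comm_ring_1}"
  shows "polyval j B u w x y = (\<Sum>m\<le>j. of_real (polycoeff j B u w m) * x ^ m * y ^ (j - m))"
proof (induction j arbitrary: B)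
  case (Suc j)
  let ?c = "polycoeff j (\<lambda>l. B (u # l)) u w" and ?d = "polycoeff j (\<lambda>l. B (w # l)) u w"
  have "(\<Sum>m\<le>Suc j. of_real (polycoeff (Suc j) B u w m) * x ^ m * y ^ (Suc j - m)) =
      (\<Sum>m\<le>Suc j. of_real (if m = 0 then 0 else ?c (m - 1)) * x ^ m * y ^ (Suc j - m)) +
      (\<Sum>m\<le>Suc j. of_real (?d m) * x ^ m * y ^ (Suc j - m))"
    by (simp add: sum.distrib algebra_simps)
  also have "(\<Sum>m\<le>Suc j. of_real (if m = 0 then 0 else ?c (m - 1)) * x ^ m * y ^ (Suc j - m)) =
      x * (\<Sum>m\<le>j. of_real (?c m) * x ^ m * y ^ (j - m))"
    by (subst sum.atMost_Suc_shift) (simp add: sum_distrib_left mult_ac)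
  also have "(\<Sum>m\<le>Suc j. of_real (?d m) * x ^ m * y ^ (Suc j - m)) =
      y * (\<Sum>m\<le>j. of_real (?d m) * x ^ m * y ^ (j - m))"
    by (simp add: polycoeff_eq_0 sum_distrib_left Suc_diff_le mult_ac)
  finally show ?case by (simp add: Suc.IH)
qed auto

lemma polyval_real:
  assumes "multilinear B"
  shows "polyval j B u w x y = B (replicate j (x *\<^sub>R u + y *\<^sub>R w))"
  using assms
proof (induction j arbitrary: B)
  case (Suc j)
  show ?case
    using Suc.IH multilinear_Cons[OF Suc.prems]
    by (simp add: multilinear_add[OF Suc.prems] multilinear_scaleR[OF Suc.prems])
qed auto

lemma polycoeff_mult: "polycoeff j (\<lambda>l. c * B l) u w m = c * polycoeff j B u w m"
  by (induction j arbitrary: B m) (auto simp: algebra_simps)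

lemma polycoeff_scale:
  assumes "multilinear B"
  shows "polycoeff j B (t *\<^sub>R u) (t *\<^sub>R w) m = t ^ j * polycoeff j B u w m"
  using assms
proof (induction j arbitrary: B m)
  case (Suc j)
  have "(\<lambda>l. B ((t *\<^sub>R v) # l)) = (\<lambda>l. t * B (v # l))" for v
    by (simp add: multilinear_scaleR[OF Suc.prems])
  then show ?case
    using Suc.IH multilinear_Cons[OF Suc.prems] by (simp add: polycoeff_mult algebra_simps)
qed auto

lemma polycoeff_continuous_on:
  assumes "multilinear B" "continuous_on S g" "continuous_on S h"
  shows "continuous_on S (\<lambda>v. polycoeff j B (g v) (h v) m)"
proof -
  \<comment> \<open>Slots filled earlier hold arguments that vary with v themselves, so the
    induction carries the list \<open>gs\<close> of functions placed there.\<close>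
  have "continuous_on S (\<lambda>v. polycoeff j (\<lambda>l. B (map (\<lambda>g. g v) gs @ l)) (g v) (h v) m)"
    if "set gs \<subseteq> {g, h}" for gs
    using that
  proof (induction j arbitrary: gs m)
    case 0
    then have "continuous_on S (\<lambda>v. B (map (\<lambda>g. g v) gs))"
      using assms by (intro multilinear_continuous_on) auto
    then show ?case by (cases "m = 0") simp_all
  next
    case (Suc j)
    have "continuous_on S (\<lambda>v. polycoeff j (\<lambda>l. B (map (\<lambda>g. g v) gs @ k v # l)) (g v) (h v) m)"
      if "k \<in> {g, h}" for m k
      using Suc.IH[of "gs @ [k]" m] Suc.prems that by auto
    then show ?case by (cases m) (auto intro!: continuous_intros)
  qed
  from this[of "[]"] show ?thesis by simp
qed

text \<open>All arrangements of m letters u in j slots give the same value, and Pascal's rule counts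
  them.\<close>

lemma polycoeff_symmetric:
  assumes "\<And>l l'. mset l = mset l' \<Longrightarrow> B l = B l'" "m \<le> j"
  shows "polycoeff j B u w m = real (j choose m) * B (replicate m u @ replicate (j - m) w)"
  using assms
proof (induction j arbitrary: B m)
  case 0
  then have "m = 0" by simp
  then show ?case by simp
next
  case (Suc j)
  have 1: "polycoeff j (\<lambda>l. B (v # l)) u w k =
      real (j choose k) * B (v # replicate k u @ replicate (j - k) w)" if "k \<le> j" for k v
    by (rule Suc.IH) (use that in \<open>auto intro!: Suc.prems(1)\<close>)
  have w: "real (j choose m) * B (w # replicate m u @ replicate (j - m) w) =
      real (j choose m) * B (replicate m u @ replicate (Suc j - m) w)" if "m \<le> j" for m
    using that by (auto simp: Suc_diff_le intro!: Suc.prems(1))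
  show ?case
  proof (cases m)
    case 0
    then show ?thesis using 1[of 0 w] by simp
  next
    case (Suc k)
    have k: "k \<le> j" using Suc Suc.prems by simp
    show ?thesis
    proof (cases "k = j")
      case True
      then show ?thesis using 1[OF k] by (simp add: Suc polycoeff_eq_0)
    next
      case False
      then have "m \<le> j" using Suc k by simp
      let ?X = "B (replicate m u @ replicate (Suc j - m) w)"
      have "polycoeff (Suc j) B u w m =
          polycoeff j (\<lambda>l. B (u # l)) u w k + polycoeff j (\<lambda>l. B (w # l)) u w m"
        by (simp add: Suc)
      also have "polycoeff j (\<lambda>l. B (u # l)) u w k = real (j choose k) * ?X"
        using 1[OF k, of u] by (simp only: Suc replicate_Suc append_Cons diff_Suc_Suc)
      also have "polycoeff j (\<lambda>l. B (w # l)) u w m = real (j choose m) * ?X"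
        using 1[OF \<open>m \<le> j\<close>, of w] w[OF \<open>m \<le> j\<close>] by (simp only:)
      also have "real (j choose k) * ?X + real (j choose m) * ?X = real (Suc j choose m) * ?X"
        unfolding Suc binomial_Suc_Suc of_nat_add by (rule distrib_right[symmetric])
      finally show ?thesis .
    qed
  qed
qed

lemma mset_two_letters:
  assumes "set l \<subseteq> {u, w}"
  shows "\<exists>m\<le>length l. mset l = mset (replicate m u @ replicate (length l - m) w)"
  using assms
proof (induction l)
  case (Cons v l)
  then obtain m where m: "m \<le> length l" "mset l = mset (replicate m u @ replicate (length l - m) w)"
    by auto
  show ?case
  proof (cases "v = u")
    case True
    then show ?thesis using m by (intro exI[of _ "Suc m"]) auto
  next
    case False
    then show ?thesis using m Cons.prems by (intro exI[of _ m]) (auto simp: Suc_diff_le)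
  qed
qed auto

lemma multilinear_zero_on_span:
  assumes "multilinear B" "\<And>l. set l \<subseteq> {u, w} \<Longrightarrow> length l = j \<Longrightarrow> B l = 0"
    and "length cs = j"
  shows "B (map (\<lambda>c. fst c *\<^sub>R u + snd c *\<^sub>R w) cs) = 0"
  using assms
proof (induction cs arbitrary: B j)
  case (Cons c cs)
  have "B (v # map (\<lambda>c. fst c *\<^sub>R u + snd c *\<^sub>R w) cs) = 0" if "v \<in> {u, w}" for v
    by (rule Cons.IH[where j = "length cs"])
      (use Cons.prems that in \<open>auto intro: multilinear_Cons\<close>)
  then show ?case
    by (simp add: multilinear_add[OF Cons.prems(1)] multilinear_scaleR[OF Cons.prems(1)])
qed auto

text \<open>Links arbitrary mixed derivatives in the real plane of u and w to Taylor coefficients: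
  if all coefficients of one degree vanish, symmetry makes the form vanish on lists over u and w,
  and multilinearity then on their span.\<close>

lemma polycoeff_nonzero:
  assumes "multilinear B" "\<And>l l'. mset l = mset l' \<Longrightarrow> B l = B l'"
    and "B (map (\<lambda>c. fst c *\<^sub>R u + snd c *\<^sub>R w) cs) \<noteq> 0"
  shows "\<exists>m\<le>length cs. polycoeff (length cs) B u w m \<noteq> 0"
proof (rule ccontr)
  assume *: "\<not> (\<exists>m\<le>length cs. polycoeff (length cs) B u w m \<noteq> 0)"
  have "B l = 0" if l: "set l \<subseteq> {u, w}" "length l = length cs" for l
  proof -
    obtain m where m: "m \<le> length l" "mset l = mset (replicate m u @ replicate (length l - m) w)"
      using mset_two_letters[OF l(1)] by blast
    have "real (length l choose m) * B (replicate m u @ replicate (length l - m) w) = 0"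
      using polycoeff_symmetric[of B m "length l" u w] assms(2) m(1) * l(2) by metis
    then show ?thesis using assms(2)[OF m(2)] m(1) by simp
  qed
  then show False using multilinear_zero_on_span[OF assms(1) _ refl] assms(3) by blast
qed

subsection \<open>Finite type along complex lines\<close>

text \<open>The factorial makes the value at \<open>replicate j v\<close> the Taylor term of degree
  j.\<close>

definition taylor_form :: "('a::euclidean_space \<Rightarrow> real) \<Rightarrow> 'a \<Rightarrow> 'a list \<Rightarrow> real" where
  "taylor_form f a l = iter_deriv l f a / fact (length l)"

lemma taylor_form_multilinear:
  assumes "smooth_on W f" "a \<in> W"
  shows "multilinear (taylor_form f a)"
  unfolding multilinear_def
proof (intro allI)
  fix us vs
  have "linear (\<lambda>v. iter_deriv (us @ v # vs) f a)"
    by (rule iter_deriv_linear_slot[OF assms])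
  then show "linear (\<lambda>v. taylor_form f a (us @ v # vs))"
    unfolding taylor_form_def by (auto simp: linear_iff add_divide_distrib)
qed

lemma taylor_form_cong_mset:
  assumes "smooth_on W f" "a \<in> W" "mset l = mset l'"
  shows "taylor_form f a l = taylor_form f a l'"
  unfolding taylor_form_def iter_deriv_cong_mset[OF assms] mset_eq_length[OF assms(3)] ..

lemma complex_line_holomorphic_disc:
  assumes "v \<noteq> 0"
  shows "(\<lambda>\<zeta>. a + \<zeta> *s v) \<in> holomorphic_discs a"
proof -
  have "\<not> (\<lambda>\<zeta>. a + \<zeta> *s v) constant_on UNIV"
  proof
    assume "(\<lambda>\<zeta>. a + \<zeta> *s v) constant_on UNIV"
    then obtain y where y: "\<And>\<zeta>. a + \<zeta> *s v = y" by (auto simp: constant_on_def)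
    show False using y[of 1] y[of 0] assms by simp
  qed
  moreover have "(\<lambda>\<zeta>. (a + \<zeta> *s v) $ i) holomorphic_on UNIV" for i
    by (simp add: holomorphic_intros)
  ultimately show ?thesis
    unfolding holomorphic_discs_def by (intro CollectI exI[of _ UNIV]) (simp add: connected_UNIV)
qed

text \<open>With 1 in the denominator, the quotient in \<open>contact_type\<close> is the order of
  contact with the line itself.\<close>

lemma vanishing_order_complex_line:
  fixes v :: "complex ^ 'n"
  assumes "v \<noteq> 0"
  shows "vanishing_order (\<lambda>\<zeta>. a + \<zeta> *s v - a) 0 = 1"
proof -
  have D: "((\<lambda>\<zeta>. \<zeta> *s v) has_derivative (\<lambda>h. h *s v)) (at 0)"
    by (rule bounded_linear.has_derivative[OF bounded_linear_vector_scalar_mult_left has_derivative_ident])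
  have "iter_deriv [1] (\<lambda>\<zeta>. \<zeta> *s v) 0 = v"
    using frechet_derivative_at[OF D, symmetric] by simp
  then have "(INF vs\<in>{vs. iter_deriv vs (\<lambda>\<zeta>. \<zeta> *s v) 0 \<noteq> 0}. enat (length vs)) \<le> enat (length [1::complex])"
    using assms by (intro INF_lower) auto
  moreover have "1 \<le> (INF vs\<in>{vs. iter_deriv vs (\<lambda>\<zeta>. \<zeta> *s v) 0 \<noteq> 0}. enat (length vs))"
  proof (intro INF_greatest)
    fix vs :: "complex list" assume "vs \<in> {vs. iter_deriv vs (\<lambda>\<zeta>. \<zeta> *s v) 0 \<noteq> 0}"
    then show "1 \<le> enat (length vs)" by (cases vs) (auto simp: one_enat_def)
  qed
  ultimately show ?thesis by (simp add: vanishing_order_def one_enat_def)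
qed

lemma iter_deriv_complex_line:
  fixes r :: "complex ^ 'n \<Rightarrow> real"
  assumes r: "smooth_on W r" and "a + \<zeta> *s v \<in> W"
  shows "iter_deriv cs (r \<circ> (\<lambda>\<zeta>. a + \<zeta> *s v)) \<zeta> = iter_deriv (map (\<lambda>c. c *s v) cs) r (a + \<zeta> *s v)"
  using assms(2)
proof (induction cs arbitrary: \<zeta>)
  case (Cons c cs)
  define S where "S = (\<lambda>\<zeta>. a + \<zeta> *s v) -` W"
  have "open W" using r by (simp add: smooth_on_def)
  moreover have "continuous_on UNIV (\<lambda>\<zeta>. a + \<zeta> *s v)" by (intro continuous_intros)
  ultimately have S: "open S" unfolding S_def by (simp add: open_vimage)
  have "\<zeta> \<in> S" using Cons.prems by (simp add: S_def)
  have "((\<lambda>\<zeta>. a + \<zeta> *s v) has_derivative (\<lambda>h. 0 + h *s v)) (at \<zeta>)"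
    by (intro has_derivative_add has_derivative_const
        bounded_linear.has_derivative[OF bounded_linear_vector_scalar_mult_left has_derivative_ident])
  note D = has_derivative_compose[OF this smooth_on_has_derivative[OF r Cons.prems, of "map (\<lambda>c. c *s v) cs"]]
  have "iter_deriv (c # cs) (r \<circ> (\<lambda>\<zeta>. a + \<zeta> *s v)) \<zeta> =
      iter_deriv ((0 + c *s v) # map (\<lambda>c. c *s v) cs) r (a + \<zeta> *s v)"
    by (rule iter_deriv_Cons_eqI[OF S \<open>\<zeta> \<in> S\<close> _ D]) (simp add: S_def Cons.IH)
  then show ?case by (simp only: add_0 list.map)
qed auto

text \<open>A finite supremum bounds the order of r on all complex lines through a by one N. A
  nonzero derivative on such a line has directions \<open>c *s v\<close>, real combinations of v and
  \<open>\<i> *s v\<close>, so some Taylor coefficient of the same degree is nonzero.\<close>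

lemma contact_type_finite_imp_line_type:
  fixes r :: "complex ^ 'n \<Rightarrow> real"
  assumes r: "smooth_on W r" "a \<in> W" and ct: "contact_type r a < \<infinity>"
  shows "\<exists>N. \<forall>v. v \<noteq> 0 \<longrightarrow> (\<exists>j\<le>N. \<exists>m\<le>j. polycoeff j (taylor_form r a) v (\<i> *s v) m \<noteq> 0)"
proof -
  obtain N where N: "contact_type r a < ereal (real N)"
    using ct less_PInf_Ex_of_nat by auto
  have "\<exists>j\<le>N. \<exists>m\<le>j. polycoeff j (taylor_form r a) v (\<i> *s v) m \<noteq> 0" if v: "v \<noteq> 0" for v
  proof -
    define \<phi> where "\<phi> = (\<lambda>\<zeta>. a + \<zeta> *s v)"
    have "ereal_of_enat (vanishing_order (r \<circ> \<phi>) 0) / ereal_of_enat (vanishing_order (\<lambda>z. \<phi> z - a) 0)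
        \<le> contact_type r a"
      unfolding contact_type_def \<phi>_def by (intro SUP_upper complex_line_holomorphic_disc v)
    then have "ereal_of_enat (vanishing_order (r \<circ> \<phi>) 0) \<le> contact_type r a"
      using vanishing_order_complex_line[OF v, of a] unfolding \<phi>_def
      by (simp add: one_enat_def divide_ereal_def flip: one_ereal_def)
    then have "ereal_of_enat (vanishing_order (r \<circ> \<phi>) 0) < ereal_of_enat (enat N)"
      using N by simp
    then have "vanishing_order (r \<circ> \<phi>) 0 < enat N" by (simp only: ereal_of_enat_less_iff)
    then obtain cs where cs: "iter_deriv cs (r \<circ> \<phi>) 0 \<noteq> 0" "length cs < N"
      unfolding vanishing_order_def INF_less_iff by auto
    have "iter_deriv (map (\<lambda>c. c *s v) cs) r a \<noteq> 0"
      using iter_deriv_complex_line[OF r(1), of a 0 v cs] cs(1) r(2) by (simp add: \<phi>_def)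
    then have nz: "taylor_form r a (map (\<lambda>c. c *s v) cs) \<noteq> 0" by (simp add: taylor_form_def)
    have "map (\<lambda>c. c *s v) cs =
        map (\<lambda>c. fst c *\<^sub>R v + snd c *\<^sub>R (\<i> *s v)) (map (\<lambda>c. (Re c, Im c)) cs)"
      unfolding map_map o_def fst_conv snd_conv by (rule map_cong[OF refl vector_scalar_mult_Re_Im])
    with nz have nz': "taylor_form r a
        (map (\<lambda>c. fst c *\<^sub>R v + snd c *\<^sub>R (\<i> *s v)) (map (\<lambda>c. (Re c, Im c)) cs)) \<noteq> 0"
      by (rule back_subst[where P = "\<lambda>l. taylor_form r a l \<noteq> 0"])
    have "\<exists>m\<le>length (map (\<lambda>c. (Re c, Im c)) cs).
        polycoeff (length (map (\<lambda>c. (Re c, Im c)) cs)) (taylor_form r a) v (\<i> *s v) m \<noteq> 0"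
      by (rule polycoeff_nonzero[OF taylor_form_multilinear[OF r] taylor_form_cong_mset[OF r] nz'])
    then show ?thesis using cs(2) by (intro exI[of _ "length cs"]) auto
  qed
  then show ?thesis by blast
qed

subsection \<open>Limits of rescaled defining functions\<close>

text \<open>In the usual notation 2 \<partial>r at p, the complex-linear form with real part
  dr.\<close>

definition complex_differential ::
    "(complex ^ 'n \<Rightarrow> real) \<Rightarrow> complex ^ 'n \<Rightarrow> complex ^ 'n \<Rightarrow> complex" where
  "complex_differential r p = complex_linear_part (\<lambda>v. iter_deriv [v] r p)"

text \<open>\<open>support\<close> is lineal convexity near a, stated through r. The vector n is a
  transversal direction of unit speed that takes the place of a gradient.\<close>

locale smooth_lineally_convex =
  fixes r :: "complex ^ 'n \<Rightarrow> real" and a n :: "complex ^ 'n" and W :: "(complex ^ 'n) set" and \<delta> :: real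
  assumes smooth: "smooth_on W r" and \<delta>: "\<delta> > 0" "cball a \<delta> \<subseteq> W"
    and zero: "r a = 0"
    and normal: "complex_differential r a n = 1"
    and support: "\<And>p q. p \<in> ball a \<delta> \<Longrightarrow> q \<in> ball a \<delta> \<Longrightarrow> r p = 0 \<Longrightarrow>
      complex_differential r p (q - p) = 0 \<Longrightarrow> r q \<ge> 0"
begin

abbreviation "\<Lambda> \<equiv> complex_differential r"

lemma ball_subset_W: "ball a \<delta> \<subseteq> W"
  using \<delta>(2) ball_subset_cball by blast

lemma a_in_W: "a \<in> W"
  using \<delta> by auto

lemma linear_first_deriv: "p \<in> W \<Longrightarrow> linear (\<lambda>v. iter_deriv [v] r p)"
  using iter_deriv_linear_slot[OF smooth, of p "[]" "[]"] by simp

lemma \<Lambda>_add: "p \<in> W \<Longrightarrow> \<Lambda> p (v + w) = \<Lambda> p v + \<Lambda> p w"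
  and \<Lambda>_scale: "p \<in> W \<Longrightarrow> \<Lambda> p (c *s v) = c * \<Lambda> p v"
  and \<Lambda>_diff: "p \<in> W \<Longrightarrow> \<Lambda> p (v - w) = \<Lambda> p v - \<Lambda> p w"
  unfolding complex_differential_def
  using complex_linear_part_add complex_linear_part_scale complex_linear_part_diff linear_first_deriv by blast+

lemma \<Lambda>_continuous_on: "continuous_on W (\<lambda>p. \<Lambda> p v)"
  unfolding complex_differential_def complex_linear_part_def Complex_eq
  by (intro continuous_intros smooth_on_continuous_on[OF smooth])

lemma \<Lambda>_bounded: "\<exists>C. \<forall>p\<in>ball a \<delta>. \<forall>v. cmod (\<Lambda> p v) \<le> C * norm v"
proof -
  obtain C where C: "C \<ge> 0" "\<And>p l. p \<in> cball a \<delta> \<Longrightarrow> length l = 1 \<Longrightarrow> \<bar>iter_deriv l r p\<bar> \<le> C * prod_list (map norm l)"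
    using iter_deriv_bounded[OF smooth \<delta>(2), of 1] by blast
  have C1: "\<bar>iter_deriv [v] r p\<bar> \<le> C * norm v" if "p \<in> ball a \<delta>" for p v
    using C(2)[of p "[v]"] that by simp
  have "cmod (\<Lambda> p v) \<le> 2 * C * norm v" if "p \<in> ball a \<delta>" for p v
    using cmod_le[of "\<Lambda> p v"] C1[OF that, of v] C1[OF that, of "\<i> *s v"]
    by (simp add: complex_differential_def complex_linear_part_def norm_vector_scalar_mult
        del: iter_deriv.simps)
  then show ?thesis by blast
qed

text \<open>Near a the derivatives of r along n and \<open>\<i> *s n\<close> are close to 1 and 0;
  the mean value theorem on the segment does the rest. This is how motion along n is traded for
  values of r throughout.\<close>

lemma normal_increment:
  assumes "\<eta> > 0"
  obtains d where "0 < d" "d \<le> \<delta>"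
    "\<And>x c. x \<in> ball a d \<Longrightarrow> x + c *s n \<in> ball a d \<Longrightarrow> \<bar>r (x + c *s n) - r x - Re c\<bar> \<le> \<eta> * cmod c"
proof -
  have L: "iter_deriv [n] r a = 1" "iter_deriv [\<i> *s n] r a = 0"
    using normal by (auto simp: complex_differential_def complex_linear_part_def complex_eq_iff
        simp del: iter_deriv.simps)
  have "\<exists>d>0. \<forall>p\<in>W. dist p a < d \<longrightarrow> dist (iter_deriv [v] r p) (iter_deriv [v] r a) < \<eta> / 2" for v
    using smooth_on_continuous_on[OF smooth, of "[v]"] a_in_W assms half_gt_zero
    unfolding continuous_on_iff by blast
  then obtain d where d: "\<And>v. d v > 0"
    "\<And>v p. p \<in> W \<Longrightarrow> dist p a < d v \<Longrightarrow> dist (iter_deriv [v] r p) (iter_deriv [v] r a) < \<eta> / 2"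
    by metis
  define d' where "d' = min \<delta> (min (d n) (d (\<i> *s n)))"
  show thesis
  proof
    show "0 < d'" "d' \<le> \<delta>" using d \<delta> by (auto simp: d'_def)
    fix x c assume x: "x \<in> ball a d'" "x + c *s n \<in> ball a d'"
    have seg: "x + t *\<^sub>R (c *s n) \<in> ball a d'" if "0 \<le> t" "t \<le> 1" for t
    proof -
      have "(1 - t) *\<^sub>R x + t *\<^sub>R (x + c *s n) \<in> ball a d'"
        using convex_ball x that by (intro convexD) auto
      then show ?thesis by (simp add: algebra_simps)
    qed
    have W: "y \<in> W" if "y \<in> ball a d'" for y using that ball_subset_W by (auto simp: d'_def)
    define g where "g t = r (x + t *\<^sub>R (c *s n))" for t
    define g' where "g' t = iter_deriv [c *s n] r (x + t *\<^sub>R (c *s n))" for t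
    have "(g has_real_derivative g' t) (at t)" if "0 \<le> t" "t \<le> 1" for t
    proof -
      note y = W[OF seg[OF that]]
      have "((\<lambda>t. x + t *\<^sub>R (c *s n)) has_derivative (\<lambda>h. h *\<^sub>R (c *s n))) (at t)"
        by (auto intro!: derivative_eq_intros)
      from has_derivative_compose[OF this smooth_on_has_derivative[OF smooth y, of "[]"]]
      have "(g has_derivative (\<lambda>h. iter_deriv [h *\<^sub>R (c *s n)] r (x + t *\<^sub>R (c *s n)))) (at t)"
        unfolding g_def[abs_def] iter_deriv.simps(1) .
      moreover have "iter_deriv [h *\<^sub>R (c *s n)] r (x + t *\<^sub>R (c *s n)) = g' t * h" for h
        using linear_scale[OF linear_first_deriv[OF y], of h "c *s n"] by (simp add: g'_def mult.commute del: iter_deriv.simps)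
      ultimately show ?thesis by (simp only: has_field_derivative_def)
    qed
    then have "\<exists>t>0. t < 1 \<and> g 1 - g 0 = (1 - 0) * g' t" by (intro MVT2) auto
    then obtain t where t: "0 < t" "t < 1" "g 1 - g 0 = g' t" by auto
    define y where "y = x + t *\<^sub>R (c *s n)"
    have y: "y \<in> ball a d'" "y \<in> W" using seg W t by (auto simp: y_def)
    have dy: "dist y a < d'" using y(1) by (simp add: dist_commute)
    have 1: "\<bar>iter_deriv [n] r y - 1\<bar> \<le> \<eta> / 2"
      using d(2)[OF y(2), of n] dy L(1) by (simp add: d'_def dist_real_def del: iter_deriv.simps)
    have 2: "\<bar>iter_deriv [\<i> *s n] r y\<bar> \<le> \<eta> / 2"
      using d(2)[OF y(2), of "\<i> *s n"] dy L(2) by (simp add: d'_def dist_real_def del: iter_deriv.simps)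
    have "g' t = Re c * iter_deriv [n] r y + Im c * iter_deriv [\<i> *s n] r y"
      unfolding g'_def y_def[symmetric] by (rule linear_vector_scalar_mult[OF linear_first_deriv[OF y(2)]])
    then have "g 1 - g 0 - Re c = Re c * (iter_deriv [n] r y - 1) + Im c * iter_deriv [\<i> *s n] r y"
      unfolding t(3) by (simp only: right_diff_distrib)
    also have "\<bar>\<dots>\<bar> \<le> \<bar>Re c * (iter_deriv [n] r y - 1)\<bar> + \<bar>Im c * iter_deriv [\<i> *s n] r y\<bar>"
      by (rule abs_triangle_ineq)
    also have "\<dots> \<le> cmod c * (\<eta> / 2) + cmod c * (\<eta> / 2)"
      unfolding abs_mult using 1 2 by (intro add_mono mult_mono abs_Re_le_cmod abs_Im_le_cmod) auto
    also have "\<dots> = \<eta> * cmod c" by simp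
    finally show "\<bar>r (x + c *s n) - r x - Re c\<bar> \<le> \<eta> * cmod c"
      by (simp add: g_def)
  qed
qed

lemma tangent_nonneg:
  assumes "\<Lambda> a v = 0" "norm v < \<delta>"
  shows "r (a + v) \<ge> 0"
proof (rule support[of a])
  show "a + v \<in> ball a \<delta>" using assms(2) by (metis add_diff_cancel_left' dist_commute dist_norm mem_ball)
qed (use assms zero \<delta> in auto)

lemma isCont_r: "isCont r a"
  using has_derivative_continuous[OF smooth_on_has_derivative[OF smooth a_in_W, of "[]"]] by simp

text \<open>The tangent plane at the boundary point above \<open>a + \<zeta>\<^sub>0 v\<close> supports \<open>r\<close>; all we need to know
  about its slope \<open>G\<close> is that it is bounded after rescaling.\<close>

lemma limit_has_affine_support:
  fixes v :: "nat \<Rightarrow> complex ^ 'n" and N :: "nat \<Rightarrow> real" and p :: "complex \<Rightarrow> real"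
  assumes tang: "\<And>l. \<Lambda> a (v l) = 0" and v0: "v \<longlonglongrightarrow> 0" and N: "\<And>l. N l > 0"
    and p: "\<And>\<zeta>. (\<lambda>l. r (a + \<zeta> *s v l) / N l) \<longlonglongrightarrow> p \<zeta>"
    and bdd: "\<And>R. \<exists>C. \<forall>\<^sub>F l in sequentially. \<forall>\<zeta>. cmod \<zeta> \<le> R \<longrightarrow> r (a + \<zeta> *s v l) / N l \<le> C"
  shows "\<exists>g. \<forall>\<zeta>. p \<zeta>0 + Re (g * (\<zeta> - \<zeta>0)) \<le> p \<zeta>"
proof -
  define u where "u l = r (a + \<zeta>0 *s v l)" for l
  have lim_v: "(\<lambda>l. a + \<zeta> *s v l) \<longlonglongrightarrow> a" for \<zeta>
    using tendsto_add[OF tendsto_const[of a] tendsto_vector_scalar_mult[OF tendsto_const[of \<zeta>] v0]] by simp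
  have u0: "u \<longlonglongrightarrow> 0"
    unfolding u_def using isCont_tendsto_compose[OF isCont_r lim_v] zero by simp
  have u_nonneg: "\<forall>\<^sub>F l in sequentially. u l \<ge> 0"
  proof -
    have "\<forall>\<^sub>F l in sequentially. dist (a + \<zeta>0 *s v l) a < \<delta>"
      using lim_v \<delta>(1) by (rule tendstoD)
    then show ?thesis
    proof eventually_elim
      case (elim l)
      then show ?case
        unfolding u_def by (intro tangent_nonneg)
          (use tang \<Lambda>_scale[OF a_in_W] in \<open>auto simp: dist_norm\<close>)
    qed
  qed
  have small: "\<forall>\<^sub>F l in sequentially. a + \<zeta>0 *s v l \<in> ball a d \<and>
      a + \<zeta>0 *s v l + of_real (- 2 * u l) *s n \<in> ball a d" if "d > 0" for d
  proof -
    have "(\<lambda>l. a + \<zeta>0 *s v l + of_real (- 2 * u l) *s n) \<longlonglongrightarrow> a + of_real (-2 * 0) *s n"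
      by (intro tendsto_intros lim_v u0)
    then show ?thesis
      using tendstoD[OF lim_v that, of \<zeta>0] tendstoD[of _ a, OF _ that]
      by (simp add: eventually_conj_iff dist_commute)
  qed
  \<comment> \<open>With relative error 1/2, descending by 2 u along n from height u >= 0 reaches r
    <= 0, so a zero of r lies in between.\<close>
  obtain d1 where d1: "0 < d1" "d1 \<le> \<delta>"
    "\<And>x c. x \<in> ball a d1 \<Longrightarrow> x + c *s n \<in> ball a d1 \<Longrightarrow> \<bar>r (x + c *s n) - r x - Re c\<bar> \<le> 1/2 * cmod c"
    using normal_increment[of "1/2"] by auto
  have "\<forall>\<^sub>F l in sequentially. \<exists>s. - 2 * u l \<le> s \<and> s \<le> 0 \<and> r (a + \<zeta>0 *s v l + of_real s *s n) = 0"
    using small[OF d1(1)] u_nonneg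
  proof eventually_elim
    case (elim l)
    define x where "x = a + \<zeta>0 *s v l"
    have x: "x \<in> ball a d1" "x + of_real (- 2 * u l) *s n \<in> ball a d1" using elim by (auto simp: x_def)
    have inball: "x + of_real s *s n \<in> ball a d1" if "-2 * u l \<le> s" "s \<le> 0" for s
    proof (cases "u l = 0")
      case True
      then show ?thesis using that x by simp
    next
      case False
      define t where "t = s / (- 2 * u l)"
      have t: "0 \<le> t" "t \<le> 1" "s = t * (- 2 * u l)" using that elim False by (auto simp: t_def field_simps)
      have "(1 - t) *\<^sub>R x + t *\<^sub>R (x + of_real (- 2 * u l) *s n) \<in> ball a d1"
        using x t by (intro convexD[OF convex_ball]) auto
      also have "(1 - t) *\<^sub>R x + t *\<^sub>R (x + of_real (- 2 * u l) *s n) = x + of_real s *s n"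
        by (simp add: t(3) scaleR_eq_vector_scalar_mult[of t "_ *s _"] vector_smult_assoc algebra_simps)
      finally show ?thesis .
    qed
    have "r (x + of_real (- 2 * u l) *s n) \<le> 0"
      using d1(3)[OF x] elim by (simp add: u_def x_def abs_le_iff norm_mult)
    moreover have "r (x + of_real 0 *s n) \<ge> 0" using elim by (simp add: u_def x_def)
    moreover have "continuous_on {-2 * u l..0} (\<lambda>s. r (x + of_real s *s n))"
    proof (rule continuous_on_compose2[OF smooth_on_continuous_on[OF smooth, of "[]", unfolded iter_deriv.simps(1)]])
      show "(\<lambda>s. x + of_real s *s n) ` {- 2 * u l..0} \<subseteq> W"
        using inball d1(2) ball_subset_W by fastforce
    qed (intro continuous_intros)
    ultimately show ?case
      using IVT'[of "\<lambda>s. r (x + of_real s *s n)" "-2 * u l" 0 0] elim by (auto simp: x_def)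
  qed
  then obtain s where s: "\<forall>\<^sub>F l in sequentially. - 2 * u l \<le> s l \<and> s l \<le> 0 \<and>
      r (a + \<zeta>0 *s v l + of_real (s l) *s n) = 0"
    unfolding eventually_sequentially by metis
  have s_abs: "\<forall>\<^sub>F l in sequentially. \<bar>s l\<bar> \<le> 2 * u l"
    using s by eventually_elim auto
  have s0: "s \<longlonglongrightarrow> 0"
    by (rule Lim_null_comparison[OF _ tendsto_mult_right_zero[OF u0, of 2]])
      (use s_abs in simp)
  define b where "b l = a + \<zeta>0 *s v l + of_real (s l) *s n" for l
  have b: "b \<longlonglongrightarrow> a"
  proof -
    have "b \<longlonglongrightarrow> a + of_real 0 *s n"
      unfolding b_def by (intro tendsto_intros lim_v s0)
    then show ?thesis by simp
  qed
  have b_ball: "\<forall>\<^sub>F l in sequentially. b l \<in> ball a d" if "d > 0" for d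
    using tendstoD[OF b that] by (simp add: dist_commute)
  have u_N: "(\<lambda>l. u l / N l) \<longlonglongrightarrow> p \<zeta>0" unfolding u_def by (rule p)
  \<comment> \<open>The displacement to the zero set is - u up to an arbitrarily small relative
    error, and u / N has a limit.\<close>
  have s_N: "(\<lambda>l. s l / N l) \<longlonglongrightarrow> - p \<zeta>0"
  proof -
    have "(\<lambda>l. (s l + u l) / N l) \<longlonglongrightarrow> 0"
    proof (rule tendstoI)
      fix e :: real assume e: "e > 0"
      define P where "P = \<bar>p \<zeta>0\<bar> + 1"
      have P: "P > 0" "p \<zeta>0 < P" by (auto simp: P_def)
      define \<eta> where "\<eta> = e / (2 * P)"
      have \<eta>: "\<eta> > 0" using e P by (simp add: \<eta>_def)
      obtain d where d: "0 < d" "d \<le> \<delta>"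
        "\<And>x c. x \<in> ball a d \<Longrightarrow> x + c *s n \<in> ball a d \<Longrightarrow> \<bar>r (x + c *s n) - r x - Re c\<bar> \<le> \<eta> * cmod c"
        using normal_increment[OF \<eta>] by blast
      have "\<forall>\<^sub>F l in sequentially. u l / N l < P"
        using u_N P(2) by (rule order_tendstoD)
      then show "\<forall>\<^sub>F l in sequentially. dist ((s l + u l) / N l) 0 < e"
        using small[OF d(1)] b_ball[OF d(1)] s s_abs
      proof eventually_elim
        case (elim l)
        have "\<bar>0 - u l - s l\<bar> \<le> \<eta> * \<bar>s l\<bar>"
          using d(3)[of "a + \<zeta>0 *s v l" "of_real (s l)"] elim by (simp add: b_def u_def)
        also have "\<dots> \<le> \<eta> * (2 * u l)" using elim \<eta> by (intro mult_left_mono) auto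
        finally have "\<bar>s l + u l\<bar> \<le> \<eta> * (2 * u l)" by simp
        then have "\<bar>s l + u l\<bar> / N l \<le> \<eta> * (2 * u l) / N l"
          using N[of l] by (intro divide_right_mono) auto
        also have "\<dots> = 2 * \<eta> * (u l / N l)" by simp
        also have "\<dots> < 2 * \<eta> * P"
          using elim \<eta> by (intro mult_strict_left_mono) auto
        also have "\<dots> = e" using P by (simp add: \<eta>_def)
        finally show ?case using N[of l] by simp
      qed
    qed
    from tendsto_diff[OF this u_N] show ?thesis by (simp add: add_divide_distrib)
  qed
  \<comment> \<open>Tilts v into the complex tangent plane at \<open>b l\<close>: the differential
    there annihilates \<open>v l + \<gamma> l *s n\<close>.\<close>
  define \<gamma> where "\<gamma> l = - \<Lambda> (b l) (v l) / \<Lambda> (b l) n" for l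
  have n1: "(\<lambda>l. \<Lambda> (b l) n) \<longlonglongrightarrow> 1"
  proof -
    have "isCont (\<lambda>p. \<Lambda> p n) a"
      using \<Lambda>_continuous_on smooth a_in_W continuous_on_eq_continuous_at
      unfolding smooth_on_def by blast
    from isCont_tendsto_compose[OF this b] show ?thesis by (simp add: normal)
  qed
  have "(\<lambda>l. \<Lambda> (b l) (v l)) \<longlonglongrightarrow> 0"
  proof -
    obtain C where C: "\<forall>p\<in>ball a \<delta>. \<forall>v. cmod (\<Lambda> p v) \<le> C * norm v" using \<Lambda>_bounded by blast
    show ?thesis
    proof (rule Lim_null_comparison[OF _ tendsto_mult_right_zero[OF tendsto_norm_zero[OF v0], of C]])
      show "\<forall>\<^sub>F l in sequentially. cmod (\<Lambda> (b l) (v l)) \<le> C * norm (v l)"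
        using b_ball[OF \<delta>(1)] by eventually_elim (use C in auto)
    qed
  qed
  then have \<gamma>0: "\<gamma> \<longlonglongrightarrow> 0"
    unfolding \<gamma>_def using tendsto_divide[OF tendsto_minus n1] by fastforce
  \<comment> \<open>The point \<open>b l + (\<zeta> - \<zeta>0) *s (v l + \<gamma> l *s n)\<close>
    of that plane has r >= 0, and it differs from \<open>a + \<zeta> *s v l\<close> by the multiple
    \<open>s l + (\<zeta> - \<zeta>0) * \<gamma> l\<close> of n.\<close>
  have main: "\<forall>\<^sub>F l in sequentially. \<forall>\<zeta>. cmod \<zeta> \<le> R \<longrightarrow>
      0 \<le> r (a + \<zeta> *s v l) + s l + Re ((\<zeta> - \<zeta>0) * \<gamma> l) + \<eta> * (\<bar>s l\<bar> + cmod (\<zeta> - \<zeta>0) * cmod (\<gamma> l))"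
    if \<eta>: "\<eta> > 0" for \<eta> R
  proof -
    obtain d where d: "0 < d" "d \<le> \<delta>"
      "\<And>x c. x \<in> ball a d \<Longrightarrow> x + c *s n \<in> ball a d \<Longrightarrow> \<bar>r (x + c *s n) - r x - Re c\<bar> \<le> \<eta> * cmod c"
      using normal_increment[OF \<eta>] by blast
    define H where "H l = R * norm (v l) + (\<bar>s l\<bar> + (R + cmod \<zeta>0) * cmod (\<gamma> l)) * norm n" for l
    have "H \<longlonglongrightarrow> R * norm (0 :: complex ^ 'n) + (\<bar>0\<bar> + (R + cmod \<zeta>0) * cmod 0) * norm n"
      unfolding H_def by (intro tendsto_intros v0 s0 \<gamma>0)
    then have "\<forall>\<^sub>F l in sequentially. H l < d"
      by (rule order_tendstoD) (use d in simp)
    moreover have "\<forall>\<^sub>F l in sequentially. \<Lambda> (b l) n \<noteq> 0"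
      using n1 by (rule tendsto_imp_eventually_ne) simp
    ultimately show ?thesis using b_ball[OF \<delta>(1)] s
    proof eventually_elim
      case (elim l)
      show ?case
      proof (intro allI impI)
        fix \<zeta> assume \<zeta>: "cmod \<zeta> \<le> R"
        define c where "c = of_real (s l) + (\<zeta> - \<zeta>0) * \<gamma> l"
        define x where "x = a + \<zeta> *s v l"
        have c: "cmod c \<le> \<bar>s l\<bar> + cmod (\<zeta> - \<zeta>0) * cmod (\<gamma> l)"
          unfolding c_def using norm_triangle_ineq[of "of_real (s l)" "(\<zeta> - \<zeta>0) * \<gamma> l"]
          by (simp add: norm_mult)
        have "cmod (\<zeta> - \<zeta>0) \<le> R + cmod \<zeta>0" using norm_triangle_ineq4[of \<zeta> \<zeta>0] \<zeta> by linarith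
        then have c': "cmod c \<le> \<bar>s l\<bar> + (R + cmod \<zeta>0) * cmod (\<gamma> l)"
          using mult_right_mono[of "cmod (\<zeta> - \<zeta>0)" "R + cmod \<zeta>0" "cmod (\<gamma> l)"] c by simp
        have nv: "norm (\<zeta> *s v l) \<le> R * norm (v l)"
          unfolding norm_vector_scalar_mult using \<zeta> by (intro mult_right_mono) auto
        have nn: "norm (c *s n) \<le> (\<bar>s l\<bar> + (R + cmod \<zeta>0) * cmod (\<gamma> l)) * norm n"
          unfolding norm_vector_scalar_mult using c' by (intro mult_right_mono) auto
        have "norm (\<zeta> *s v l) < d"
          using nv nn elim(1) norm_ge_zero[of "c *s n"] unfolding H_def by linarith
        then have x: "x \<in> ball a d" unfolding x_def
          by (metis add_diff_cancel_left' dist_commute dist_norm mem_ball)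
        have "norm (\<zeta> *s v l + c *s n) < d"
          using norm_triangle_ineq[of "\<zeta> *s v l" "c *s n"] nv nn elim(1) unfolding H_def by linarith
        then have q: "x + c *s n \<in> ball a d" unfolding x_def add.assoc
          by (metis add_diff_cancel_left' dist_commute dist_norm mem_ball)
        have bW: "b l \<in> W" using elim(3) ball_subset_W by blast
        have "x + c *s n - b l = (\<zeta> - \<zeta>0) *s (v l + \<gamma> l *s n)"
          by (simp add: x_def c_def b_def vec_eq_iff algebra_simps)
        then have "\<Lambda> (b l) (x + c *s n - b l) = (\<zeta> - \<zeta>0) * (\<Lambda> (b l) (v l) + \<gamma> l * \<Lambda> (b l) n)"
          by (simp only: \<Lambda>_add[OF bW] \<Lambda>_scale[OF bW])
        also have "\<dots> = 0" using elim(2) by (simp add: \<gamma>_def)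
        finally have "r (x + c *s n) \<ge> 0"
          using elim q d(2) by (intro support[of "b l"]) (auto simp: b_def)
        then have "0 \<le> r x + Re c + \<eta> * cmod c" using d(3)[OF x q] by linarith
        also have "\<dots> \<le> r x + Re c + \<eta> * (\<bar>s l\<bar> + cmod (\<zeta> - \<zeta>0) * cmod (\<gamma> l))"
          using c \<eta> by simp
        finally show "0 \<le> r (a + \<zeta> *s v l) + s l + Re ((\<zeta> - \<zeta>0) * \<gamma> l) +
            \<eta> * (\<bar>s l\<bar> + cmod (\<zeta> - \<zeta>0) * cmod (\<gamma> l))"
          by (simp add: x_def c_def)
      qed
    qed
  qed
  define S where "S l = s l / N l" for l
  define G where "G l = \<gamma> l / of_real (N l)" for l
  have S: "S \<longlonglongrightarrow> - p \<zeta>0" unfolding S_def by (rule s_N)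
  have scaled: "\<forall>\<^sub>F l in sequentially. \<forall>\<zeta>. cmod \<zeta> \<le> R \<longrightarrow>
      0 \<le> r (a + \<zeta> *s v l) / N l + S l + Re ((\<zeta> - \<zeta>0) * G l) + \<eta> * (\<bar>S l\<bar> + cmod (\<zeta> - \<zeta>0) * cmod (G l))"
    if "\<eta> > 0" for \<eta> R
    using main[OF that, of R]
  proof eventually_elim
    case (elim l)
    show ?case
    proof (intro allI impI)
      fix \<zeta> assume "cmod \<zeta> \<le> R"
      then have "0 \<le> (r (a + \<zeta> *s v l) + s l + Re ((\<zeta> - \<zeta>0) * \<gamma> l)
          + \<eta> * (\<bar>s l\<bar> + cmod (\<zeta> - \<zeta>0) * cmod (\<gamma> l))) / N l"
        using elim N[of l] by (intro divide_nonneg_pos) auto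
      also have "\<dots> = r (a + \<zeta> *s v l) / N l + S l + Re ((\<zeta> - \<zeta>0) * G l)
          + \<eta> * (\<bar>S l\<bar> + cmod (\<zeta> - \<zeta>0) * cmod (G l))"
        using N[of l] by (simp add: S_def G_def add_divide_distrib norm_divide distrib_left)
      finally show "0 \<le> r (a + \<zeta> *s v l) / N l + S l + Re ((\<zeta> - \<zeta>0) * G l)
          + \<eta> * (\<bar>S l\<bar> + cmod (\<zeta> - \<zeta>0) * cmod (G l))" .
    qed
  qed
  have "\<exists>M. \<forall>\<^sub>F l in sequentially. cmod (G l) \<le> M"
  proof -
    obtain C where C: "\<forall>\<^sub>F l in sequentially. \<forall>\<zeta>. cmod \<zeta> \<le> cmod \<zeta>0 + 1 \<longrightarrow> r (a + \<zeta> *s v l) / N l \<le> C"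
      using bdd by blast
    have "\<forall>\<^sub>F l in sequentially. \<bar>S l\<bar> < \<bar>p \<zeta>0\<bar> + 1"
      using tendsto_rabs[OF S] by (rule order_tendstoD) auto
    then have "\<forall>\<^sub>F l in sequentially. cmod (G l) \<le> 2 * (\<bar>C\<bar> + 2 * (\<bar>p \<zeta>0\<bar> + 1))"
      using C scaled[of "1/2" "cmod \<zeta>0 + 1", simplified]
    proof eventually_elim
      case (elim l)
      show ?case
      proof (cases "G l = 0")
        case True
        then show ?thesis by simp
      next
        case False
        \<comment> \<open>The unit step along which the affine term decreases fastest, by |G|. The
          error term with factor 1/2 gives back only half of this, so the upper bound C for the
          rescaled r bounds |G|.\<close>
        define w where "w = - cnj (G l) / of_real (cmod (G l))"
        have w: "cmod w = 1" using False by (simp add: w_def norm_divide)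
        have "w * G l = of_real (- cmod (G l))"
        proof -
          have "G l * cnj (G l) = of_real (cmod (G l) * cmod (G l))"
            using complex_norm_square[of "G l"] by (simp add: power2_eq_square)
          then show ?thesis using False by (simp add: w_def mult.commute)
        qed
        then have wG: "Re (w * G l) = - cmod (G l)" by simp
        have "cmod (\<zeta>0 + w) \<le> cmod \<zeta>0 + 1" using norm_triangle_ineq[of \<zeta>0 w] w by simp
        then have "0 \<le> r (a + (\<zeta>0 + w) *s v l) / N l + S l + Re ((\<zeta>0 + w - \<zeta>0) * G l)
              + 1/2 * (\<bar>S l\<bar> + cmod (\<zeta>0 + w - \<zeta>0) * cmod (G l))"
            "r (a + (\<zeta>0 + w) *s v l) / N l \<le> C"
          using elim by auto
        then have "0 \<le> C + S l - cmod (G l) + 1/2 * (\<bar>S l\<bar> + cmod (G l))"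
          using w wG by simp
        then show ?thesis
          using elim(1) abs_ge_self[of C] abs_ge_self[of "S l"] abs_ge_zero[of "p \<zeta>0"]
          unfolding distrib_left by linarith
      qed
    qed
    then show ?thesis by blast
  qed
  then obtain M l0 where M: "\<And>l. l \<ge> l0 \<Longrightarrow> cmod (G l) \<le> M"
    unfolding eventually_sequentially by blast
  have "\<forall>k. G (k + l0) \<in> cball 0 M" using M by simp
  then obtain G0 \<rho> where \<rho>: "strict_mono (\<rho> :: nat \<Rightarrow> nat)" "((\<lambda>k. G (k + l0)) \<circ> \<rho>) \<longlonglongrightarrow> G0"
    using compact_cball[of 0 M] unfolding compact_def by metis
  define h where "h k = \<rho> k + l0" for k
  have h: "filterlim h sequentially sequentially"
    unfolding h_def using filterlim_subseq[OF \<rho>(1)]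
    by (intro filterlim_add_const_nat_at_top[THEN filterlim_compose]) auto
  have Gh: "(\<lambda>k. G (h k)) \<longlonglongrightarrow> G0" using \<rho>(2) by (simp add: h_def o_def)
  \<comment> \<open>The slope is minus a limit of G along a subsequence. The parameter \<eta> is
    arbitrary, so the error term disappears after this limit.\<close>
  have "p \<zeta>0 + Re (- G0 * (\<zeta> - \<zeta>0)) \<le> p \<zeta>" for \<zeta>
  proof -
    define K where "K = \<bar>p \<zeta>0\<bar> + cmod (\<zeta> - \<zeta>0) * cmod G0"
    have K: "K \<ge> 0" by (simp add: K_def)
    have lim: "0 \<le> p \<zeta> - p \<zeta>0 + Re ((\<zeta> - \<zeta>0) * G0) + \<eta> * K" if \<eta>: "\<eta> > 0" for \<eta>
    proof (rule tendsto_lowerbound)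
      have "(\<lambda>k. r (a + \<zeta> *s v (h k)) / N (h k) + S (h k) + Re ((\<zeta> - \<zeta>0) * G (h k))
          + \<eta> * (\<bar>S (h k)\<bar> + cmod (\<zeta> - \<zeta>0) * cmod (G (h k)))) \<longlonglongrightarrow>
          p \<zeta> + (- p \<zeta>0) + Re ((\<zeta> - \<zeta>0) * G0) + \<eta> * (\<bar>- p \<zeta>0\<bar> + cmod (\<zeta> - \<zeta>0) * cmod G0)"
        by (intro tendsto_intros filterlim_compose[OF p h] filterlim_compose[OF S h] Gh)
      then show "(\<lambda>k. r (a + \<zeta> *s v (h k)) / N (h k) + S (h k) + Re ((\<zeta> - \<zeta>0) * G (h k))
          + \<eta> * (\<bar>S (h k)\<bar> + cmod (\<zeta> - \<zeta>0) * cmod (G (h k)))) \<longlonglongrightarrow>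
          p \<zeta> - p \<zeta>0 + Re ((\<zeta> - \<zeta>0) * G0) + \<eta> * K" by (simp add: K_def)
      have "\<forall>\<^sub>F l in sequentially. 0 \<le> r (a + \<zeta> *s v l) / N l + S l + Re ((\<zeta> - \<zeta>0) * G l)
          + \<eta> * (\<bar>S l\<bar> + cmod (\<zeta> - \<zeta>0) * cmod (G l))"
        using scaled[OF \<eta>, of "cmod \<zeta>"] by eventually_elim auto
      then show "\<forall>\<^sub>F k in sequentially. 0 \<le> r (a + \<zeta> *s v (h k)) / N (h k) + S (h k)
          + Re ((\<zeta> - \<zeta>0) * G (h k)) + \<eta> * (\<bar>S (h k)\<bar> + cmod (\<zeta> - \<zeta>0) * cmod (G (h k)))"
        by (rule eventually_compose_filterlim[OF _ h])
    qed simp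
    have "0 \<le> p \<zeta> - p \<zeta>0 + Re ((\<zeta> - \<zeta>0) * G0)"
    proof (rule field_le_epsilon)
      fix e :: real assume e: "e > 0"
      define \<eta> where "\<eta> = e / (K + 1)"
      have \<eta>: "\<eta> > 0" using e K by (simp add: \<eta>_def)
      have "\<eta> * K \<le> \<eta> * (K + 1)" using \<eta> by simp
      also have "\<dots> = e" using K by (simp add: \<eta>_def)
      finally show "0 \<le> p \<zeta> - p \<zeta>0 + Re ((\<zeta> - \<zeta>0) * G0) + e" using lim[OF \<eta>] by linarith
    qed
    then show ?thesis by (simp add: mult.commute)
  qed
  then show ?thesis by blast
qed

end

subsection \<open>Convex polynomials in the plane\<close>

lemma finite_family_convergent_subsequence:
  fixes f :: "nat \<Rightarrow> 'i \<Rightarrow> real"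
  assumes "finite I" "\<And>l i. i \<in> I \<Longrightarrow> \<bar>f l i\<bar> \<le> M"
  shows "\<exists>\<sigma> e. strict_mono (\<sigma> :: nat \<Rightarrow> nat) \<and> (\<forall>i\<in>I. (\<lambda>l. f (\<sigma> l) i) \<longlonglongrightarrow> e i)"
  using assms
proof (induction I rule: finite_induct)
  case empty
  then show ?case by (intro exI[of _ id]) (auto simp: strict_mono_def)
next
  case (insert i I)
  then obtain \<sigma> e where \<sigma>: "strict_mono (\<sigma> :: nat \<Rightarrow> nat)" "\<forall>i\<in>I. (\<lambda>l. f (\<sigma> l) i) \<longlonglongrightarrow> e i"
    by auto
  have "bounded (range (\<lambda>l. f (\<sigma> l) i))"
    unfolding bounded_iff using insert.prems by (intro exI[of _ M]) auto
  then obtain c \<tau> where \<tau>: "strict_mono (\<tau> :: nat \<Rightarrow> nat)" "((\<lambda>l. f (\<sigma> l) i) \<circ> \<tau>) \<longlonglongrightarrow> c"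
    using bounded_imp_convergent_subsequence by blast
  have "(\<lambda>l. f ((\<sigma> \<circ> \<tau>) l) k) \<longlonglongrightarrow> (e(i := c)) k" if "k \<in> insert i I" for k
  proof (cases "k = i")
    case True
    then show ?thesis using \<tau>(2) by (simp add: o_def)
  next
    case False
    then have "(\<lambda>l. f (\<sigma> l) k) \<longlonglongrightarrow> e k" using \<sigma>(2) that by simp
    then show ?thesis using False LIMSEQ_subseq_LIMSEQ[OF _ \<tau>(1)] by (fastforce simp: o_def)
  qed
  then show ?case using strict_mono_o[OF \<sigma>(1) \<tau>(1)] by blast
qed

text \<open>A convex polynomial \<open>p \<ge> 0\<close> on the plane that vanishes at \<open>0\<close> and \<open>1\<close> depends on the
  imaginary part only, \<open>p = f \<circ> Im\<close>; the sum below is the even part of \<open>f\<close> at \<open>1\<close>.\<close>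

lemma convex_polynomial_even_part_pos:
  fixes e :: "nat \<Rightarrow> nat \<Rightarrow> real" and K :: nat
  assumes p_def: "p = (\<lambda>\<zeta>. \<Sum>j\<le>K. \<Sum>m\<le>K. e j m * Re \<zeta> ^ m * Im \<zeta> ^ (j - m))"
    and e0: "\<And>j m. m > j \<Longrightarrow> e j m = 0"
    and support: "\<And>\<zeta>0. \<exists>g. \<forall>\<zeta>. p \<zeta>0 + Re (g * (\<zeta> - \<zeta>0)) \<le> p \<zeta>"
    and nonneg: "\<And>\<zeta>. p \<zeta> \<ge> 0" and "p 0 = 0" "p 1 = 0"
    and nonzero: "\<exists>j\<le>K. \<exists>m\<le>K. e j m \<noteq> 0"
  shows "Re (\<Sum>j | j \<le> K \<and> even j. \<Sum>m\<le>K. of_real (e j m) * \<i> ^ m) > 0"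
proof -
  \<comment> \<open>Convexity on the segment from 0 to z: the affine support at t z, evaluated at 0
    and z with weights 1 - t and t.\<close>
  have seg: "p (of_real t * z) = 0" if "p z = 0" "0 \<le> t" "t \<le> 1" for t z
  proof -
    obtain g where g: "\<And>\<zeta>. p (of_real t * z) + Re (g * (\<zeta> - of_real t * z)) \<le> p \<zeta>"
      using support by blast
    have "p (of_real t * z) - t * Re (g * z) \<le> 0"
      using g[of 0] \<open>p 0 = 0\<close> by (simp add: algebra_simps)
    then have 1: "(1 - t) * (p (of_real t * z) - t * Re (g * z)) \<le> 0"
      using that by (simp add: mult_nonneg_nonpos)
    have "p (of_real t * z) + (1 - t) * Re (g * z) \<le> 0"
      using g[of z] \<open>p z = 0\<close> by (simp add: algebra_simps)
    then have 2: "t * (p (of_real t * z) + (1 - t) * Re (g * z)) \<le> 0"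
      using that by (simp add: mult_nonneg_nonpos)
    have "(1 - t) * (p (of_real t * z) - t * Re (g * z)) + t * (p (of_real t * z) + (1 - t) * Re (g * z))
        = p (of_real t * z)" by (simp only: ring_distribs mult.assoc mult.left_commute)
    then show ?thesis using 1 2 nonneg[of "of_real t * z"] by linarith
  qed
  have roots: "\<forall>i\<le>K. c i = 0" if "\<And>t. 0 \<le> t \<Longrightarrow> t \<le> 1 \<Longrightarrow> (\<Sum>i\<le>K. c i * t ^ i) = 0" for c :: "nat \<Rightarrow> real"
  proof -
    have "{0..1} \<subseteq> {t. (\<Sum>i\<le>K. c i * t ^ i) = 0}" using that by auto
    then have "infinite {t. (\<Sum>i\<le>K. c i * t ^ i) = 0}"
      by (rule infinite_super) (simp add: infinite_Icc)
    then show ?thesis unfolding polyfun_finite_roots by blast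
  qed
  have p_real: "p (of_real x) = (\<Sum>j\<le>K. e j j * x ^ j)" for x
  proof -
    \<comment> \<open>Truncated subtraction gives \<open>0 ^ (j - m)\<close> = 1 for all m >= j;
      \<open>e0\<close> removes m > j, which leaves m = j.\<close>
    have "(\<Sum>m\<le>K. e j m * x ^ m * 0 ^ (j - m)) = e j j * x ^ j" if "j \<le> K" for j
    proof -
      have "(\<Sum>m\<le>K. e j m * x ^ m * 0 ^ (j - m)) = (\<Sum>m\<le>K. if m = j then e j j * x ^ j else 0)"
        by (intro sum.cong) (auto simp: e0 power_0_left)
      then show ?thesis using that by simp
    qed
    then show ?thesis by (simp add: p_def)
  qed
  have "\<forall>j\<le>K. e j j = 0"
    using seg[OF \<open>p 1 = 0\<close>] p_real by (intro roots) simp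
  then have p_R: "p (of_real x) = 0" for x by (simp add: p_real)
  \<comment> \<open>An affine support stays below p = 0 on the real axis, so it cannot have a slope
    in the real direction.\<close>
  have le: "p (Complex x' y) \<le> p (Complex x y)" for x x' y
  proof -
    obtain g where g: "\<And>\<zeta>. p (Complex x' y) + Re (g * (\<zeta> - Complex x' y)) \<le> p \<zeta>"
      using support by blast
    define A where "A = p (Complex x' y) - Re (g * Complex x' y)"
    have A: "A + t * Re g \<le> 0" for t
      using g[of "of_real t"] by (simp add: p_R A_def algebra_simps)
    have "Re g = 0"
    proof (rule ccontr)
      assume "Re g \<noteq> 0"
      then show False using A[of "(1 - A) / Re g"] by simp
    qed
    then show ?thesis using g[of "Complex x y"] by simp
  qed
  have indep: "p (Complex x y) = p (Complex 0 y)" for x y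
    using le[of x y 0] le[of 0 y x] by simp
  have swap: "p (Complex x y) = (\<Sum>m\<le>K. (\<Sum>j\<le>K. e j m * y ^ (j - m)) * x ^ m)" for x y
    unfolding p_def by (subst sum.swap) (simp add: sum_distrib_right sum_distrib_left mult_ac)
  \<comment> \<open>Independence of x removes every positive power of x for each y; the factor y^m
    turns the exponents j - m into j, giving a polynomial in y with coefficients
    \<open>e j m\<close>.\<close>
  have em0: "e j m = 0" if "m \<ge> 1" "j \<le> K" "m \<le> K" for j m
  proof -
    have "(\<Sum>j\<le>K. e j m * y ^ j) = 0" for y
    proof -
      have "\<forall>x. (\<Sum>m\<le>K. (\<Sum>j\<le>K. e j m * y ^ (j - m)) * x ^ m) = p (Complex 0 y)"
        using indep[of _ y] swap[of _ y] by simp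
      then have "(\<Sum>j\<le>K. e j m * y ^ (j - m)) = 0"
        using that unfolding polyfun_eq_const by auto
      then have "y ^ m * (\<Sum>j\<le>K. e j m * y ^ (j - m)) = 0" by simp
      moreover have "y ^ m * (e j m * y ^ (j - m)) = e j m * y ^ j" for j
      proof (cases "m \<le> j")
        case True
        then show ?thesis by (simp flip: power_add)
      qed (simp add: e0)
      ultimately show ?thesis by (simp add: sum_distrib_left)
    qed
    then show ?thesis using roots[of "\<lambda>j. e j m"] that by simp
  qed
  have only0: "(\<Sum>m\<le>K. F m) = F 0" if "\<And>m. 1 \<le> m \<Longrightarrow> m \<le> K \<Longrightarrow> F m = 0"
    for F :: "nat \<Rightarrow> complex"
    using that by (subst sum.mono_neutral_right[of "{..K}" "{0}"]) (auto simp: Suc_le_eq)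
  have onlyR: "(\<Sum>m\<le>K. F m) = F 0" if "\<And>m. 1 \<le> m \<Longrightarrow> m \<le> K \<Longrightarrow> F m = 0"
    for F :: "nat \<Rightarrow> real"
    using that by (subst sum.mono_neutral_right[of "{..K}" "{0}"]) (auto simp: Suc_le_eq)
  have p_Im: "p \<zeta> = (\<Sum>j\<le>K. e j 0 * Im \<zeta> ^ j)" for \<zeta>
    unfolding p_def by (intro sum.cong refl, subst onlyR) (simp_all add: em0)
  have "Re (\<Sum>j | j \<le> K \<and> even j. \<Sum>m\<le>K. of_real (e j m) * \<i> ^ m) =
      Re (\<Sum>j | j \<le> K \<and> even j. of_real (e j 0))"
    by (intro arg_cong[where f = Re] sum.cong refl, subst only0) (simp_all add: em0)
  also have "\<dots> = (\<Sum>j | j \<le> K \<and> even j. e j 0)" by simp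
  also have "\<dots> = (\<Sum>j\<le>K. if even j then e j 0 else 0)"
    by (simp add: sum.If_cases) (intro sum.cong; auto)
  also have "\<dots> = (\<Sum>j\<le>K. (e j 0 * 1 ^ j + e j 0 * (- 1) ^ j) / 2)"
    by (intro sum.cong) auto
  also have "\<dots> = (p \<i> + p (- \<i>)) / 2"
    by (simp add: p_Im sum.distrib flip: sum_divide_distrib)
  finally have eq: "Re (\<Sum>j | j \<le> K \<and> even j. \<Sum>m\<le>K. of_real (e j m) * \<i> ^ m) = (p \<i> + p (- \<i>)) / 2" .
  show ?thesis
  proof (rule ccontr)
    assume "\<not> ?thesis"
    then have "(p \<i> + p (- \<i>)) / 2 \<le> 0" by (simp only: eq not_less)
    \<comment> \<open>Both values are nonnegative, so p vanishes at \<i> and, by \<open>seg\<close>,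
      on the whole segment from 0 to \<i>, which kills the remaining coefficients.\<close>
    then have "p \<i> \<le> 0" using nonneg[of "- \<i>"] by simp
    then have "p \<i> = 0" using nonneg[of \<i>] by (rule order_antisym)
    then have "\<forall>j\<le>K. e j 0 = 0"
      using seg[of \<i>] by (intro roots) (simp add: p_Im)
    then show False using em0 nonzero by (metis One_nat_def Suc_leI gr0I)
  qed
qed

section \<open>Rescaling along complex lines and the compactness argument\<close>

locale finite_line_type = smooth_lineally_convex r a n W \<delta>
  for r :: "complex ^ 'n \<Rightarrow> real" and a n W \<delta> +
  fixes K :: nat
  assumes line_type: "\<And>v. v \<noteq> 0 \<Longrightarrow>
    \<exists>j\<le>K. \<exists>m\<le>j. polycoeff j (taylor_form r a) v (\<i> *s v) m \<noteq> 0"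
begin

definition taylor_coeff :: "nat \<Rightarrow> nat \<Rightarrow> complex ^ 'n \<Rightarrow> real" where
  "taylor_coeff j m v = polycoeff j (taylor_form r a) v (\<i> *s v) m"

text \<open>Coefficients of all degrees are added, so this is not homogeneous in v. Dividing by it
  gives coefficient tuples of absolute sum 1, whose limits exist along subsequences and are not
  zero.\<close>

definition taylor_size :: "complex ^ 'n \<Rightarrow> real" where
  "taylor_size v = (\<Sum>j\<le>K. \<Sum>m\<le>K. \<bar>taylor_coeff j m v\<bar>)"

definition Q :: "complex ^ 'n \<Rightarrow> complex" where
  "Q v = (\<Sum>j | j \<le> K \<and> even j. polyval j (taylor_form r a) v (\<i> *s v) \<i> 1)"

lemma taylor_multilinear: "multilinear (taylor_form r a)"
  using taylor_form_multilinear[OF smooth a_in_W] .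

lemma taylor_coeff_eq_0: "m > j \<Longrightarrow> taylor_coeff j m v = 0"
  by (simp add: taylor_coeff_def polycoeff_eq_0)

lemma taylor_coeff_scale: "taylor_coeff j m (t *\<^sub>R v) = t ^ j * taylor_coeff j m v"
proof -
  have "\<i> *s (t *\<^sub>R v) = t *\<^sub>R (\<i> *s v)"
    by (simp add: scaleR_eq_vector_scalar_mult vector_smult_assoc mult.commute)
  then show ?thesis unfolding taylor_coeff_def using polycoeff_scale[OF taylor_multilinear] by metis
qed

lemma polyval_eq_taylor_coeff:
  fixes x y :: "'b::{real_algebra_1, comm_ring_1}"
  assumes "j \<le> K"
  shows "polyval j (taylor_form r a) v (\<i> *s v) x y = (\<Sum>m\<le>K. of_real (taylor_coeff j m v) * x ^ m * y ^ (j - m))"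
  unfolding polyval_eq_sum taylor_coeff_def[symmetric]
  by (rule sum.mono_neutral_left) (use assms in \<open>auto simp: taylor_coeff_eq_0\<close>)

lemma Q_eq_taylor_coeff: "Q v = (\<Sum>j | j \<le> K \<and> even j. \<Sum>m\<le>K. of_real (taylor_coeff j m v) * \<i> ^ m)"
  unfolding Q_def by (intro sum.cong refl) (simp add: polyval_eq_taylor_coeff)

lemma taylor_coeff_le_size:
  assumes "j \<le> K" "m \<le> K"
  shows "\<bar>taylor_coeff j m v\<bar> \<le> taylor_size v"
proof -
  have "\<bar>taylor_coeff j m v\<bar> \<le> (\<Sum>m\<le>K. \<bar>taylor_coeff j m v\<bar>)"
    using assms by (intro member_le_sum) auto
  also have "\<dots> \<le> taylor_size v"
    unfolding taylor_size_def
    by (rule member_le_sum[where f = "\<lambda>j. \<Sum>m\<le>K. \<bar>taylor_coeff j m v\<bar>"])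
      (use assms in \<open>auto intro: sum_nonneg\<close>)
  finally show ?thesis .
qed

lemma taylor_size_pos: "v \<noteq> 0 \<Longrightarrow> taylor_size v > 0"
proof -
  assume "v \<noteq> 0"
  then obtain j m where jm: "j \<le> K" "m \<le> K" "taylor_coeff j m v \<noteq> 0"
    using line_type unfolding taylor_coeff_def by (meson order_trans)
  then show ?thesis using taylor_coeff_le_size[OF jm(1,2), of v] by simp
qed

text \<open>By \<open>line_type\<close> and compactness the size is bounded below on the unit
  sphere; a coefficient of degree j scales by |v|^j, which is at least |v|^K. This makes a Taylor
  remainder of order K + 1 negligible.\<close>

lemma taylor_size_lower_bound: "\<exists>c>0. \<forall>v. v \<noteq> 0 \<longrightarrow> norm v \<le> 1 \<longrightarrow> c * norm v ^ K \<le> taylor_size v"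
proof -
  have "continuous_on UNIV (\<lambda>v :: complex ^ 'n. \<i> *s v)" by (intro continuous_intros)
  then have "continuous_on UNIV taylor_size"
    unfolding taylor_size_def taylor_coeff_def
    by (intro continuous_intros polycoeff_continuous_on taylor_multilinear)
  then have "continuous_on (sphere 0 1) taylor_size" by (rule continuous_on_subset) simp
  moreover have "sphere (0 :: complex ^ 'n) 1 \<noteq> {}" by simp
  ultimately obtain e0 where e0: "norm e0 = 1" "\<And>e. norm e = 1 \<Longrightarrow> taylor_size e0 \<le> taylor_size e"
    using continuous_attains_inf[OF compact_sphere, of 0 1 taylor_size] by auto
  have "taylor_size e0 * norm v ^ K \<le> taylor_size v" if v: "v \<noteq> 0" "norm v \<le> 1" for v
  proof -
    define e where "e = v /\<^sub>R norm v"
    have e: "norm e = 1" "v = norm v *\<^sub>R e" using v by (auto simp: e_def)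
    have "norm v ^ K * taylor_size e0 \<le> norm v ^ K * taylor_size e"
      using e0(2)[OF e(1)] by (intro mult_left_mono) auto
    also have "\<dots> = (\<Sum>j\<le>K. \<Sum>m\<le>K. norm v ^ K * \<bar>taylor_coeff j m e\<bar>)"
      by (simp add: taylor_size_def sum_distrib_left)
    also have "\<dots> \<le> (\<Sum>j\<le>K. \<Sum>m\<le>K. norm v ^ j * \<bar>taylor_coeff j m e\<bar>)"
      using v by (intro sum_mono mult_right_mono power_decreasing) auto
    also have "\<dots> = taylor_size (norm v *\<^sub>R e)"
      by (simp add: taylor_size_def taylor_coeff_scale abs_mult)
    finally show ?thesis using e(2) by (simp add: mult.commute)
  qed
  then show ?thesis using taylor_size_pos[of e0] e0(1) by force
qed

lemma taylor_line:
  "\<exists>C\<ge>0. \<forall>v \<zeta>. cmod \<zeta> * norm v \<le> \<delta> \<longrightarrow>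
    \<bar>r (a + \<zeta> *s v) - (\<Sum>j\<le>K. \<Sum>m\<le>K. taylor_coeff j m v * Re \<zeta> ^ m * Im \<zeta> ^ (j - m))\<bar>
      \<le> C * (cmod \<zeta> * norm v) ^ Suc K"
proof -
  obtain C where C: "C \<ge> 0" "\<And>v. norm v \<le> \<delta> \<Longrightarrow>
      \<bar>r (a + v) - (\<Sum>j\<le>K. iter_deriv (replicate j v) r a / fact j)\<bar> \<le> C * norm v ^ Suc K"
    using smooth_on_Taylor[OF smooth \<delta>(2), of K] by blast
  have "(\<Sum>j\<le>K. iter_deriv (replicate j (\<zeta> *s v)) r a / fact j) =
      (\<Sum>j\<le>K. \<Sum>m\<le>K. taylor_coeff j m v * Re \<zeta> ^ m * Im \<zeta> ^ (j - m))" for v \<zeta>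
  proof (intro sum.cong refl)
    fix j assume "j \<in> {..K}"
    then have j: "j \<le> K" by simp
    have "iter_deriv (replicate j (\<zeta> *s v)) r a / fact j = taylor_form r a (replicate j (\<zeta> *s v))"
      by (simp add: taylor_form_def)
    also have "\<dots> = taylor_form r a (replicate j (Re \<zeta> *\<^sub>R v + Im \<zeta> *\<^sub>R (\<i> *s v)))"
      by (simp only: vector_scalar_mult_Re_Im[of \<zeta> v])
    also have "\<dots> = polyval j (taylor_form r a) v (\<i> *s v) (Re \<zeta>) (Im \<zeta>)"
      by (rule polyval_real[OF taylor_multilinear, symmetric])
    also have "\<dots> = (\<Sum>m\<le>K. taylor_coeff j m v * Re \<zeta> ^ m * Im \<zeta> ^ (j - m))"
      unfolding polyval_eq_taylor_coeff[OF j] by simp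
    finally show "iter_deriv (replicate j (\<zeta> *s v)) r a / fact j =
        (\<Sum>m\<le>K. taylor_coeff j m v * Re \<zeta> ^ m * Im \<zeta> ^ (j - m))" .
  qed
  then show ?thesis
    using C(2)[of "_ *s _"] C(1) unfolding norm_vector_scalar_mult by (intro exI[of _ C]) simp
qed

text \<open>The remainder is O(|v|^(K + 1)) and the divisor at least c |v|^K, so the quotient
  follows the rescaled Taylor polynomial uniformly on discs. The sign comes from
  \<open>tangent_nonneg\<close>.\<close>

lemma rescaled_limit:
  fixes v :: "nat \<Rightarrow> complex ^ 'n"
  assumes tang: "\<And>l. \<Lambda> a (v l) = 0" and nz: "\<And>l. v l \<noteq> 0" and v0: "v \<longlonglongrightarrow> 0"
    and e: "\<And>j m. j \<le> K \<Longrightarrow> m \<le> K \<Longrightarrow> (\<lambda>l. taylor_coeff j m (v l) / taylor_size (v l)) \<longlonglongrightarrow> e j m"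
  defines "p \<equiv> \<lambda>\<zeta>. \<Sum>j\<le>K. \<Sum>m\<le>K. e j m * Re \<zeta> ^ m * Im \<zeta> ^ (j - m)"
  shows "(\<lambda>l. r (a + \<zeta> *s v l) / taylor_size (v l)) \<longlonglongrightarrow> p \<zeta>"
    and "\<exists>C. \<forall>\<^sub>F l in sequentially. \<forall>\<zeta>. cmod \<zeta> \<le> R \<longrightarrow> r (a + \<zeta> *s v l) / taylor_size (v l) \<le> C"
    and "p \<zeta> \<ge> 0"
proof -
  define N where "N l = taylor_size (v l)" for l
  have N: "N l > 0" for l unfolding N_def by (rule taylor_size_pos[OF nz])
  define P where "P l \<zeta> = (\<Sum>j\<le>K. \<Sum>m\<le>K. taylor_coeff j m (v l) / N l * Re \<zeta> ^ m * Im \<zeta> ^ (j - m))" for l \<zeta>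
  obtain C where C: "C \<ge> 0" "\<And>v \<zeta>. cmod \<zeta> * norm v \<le> \<delta> \<Longrightarrow>
    \<bar>r (a + \<zeta> *s v) - (\<Sum>j\<le>K. \<Sum>m\<le>K. taylor_coeff j m v * Re \<zeta> ^ m * Im \<zeta> ^ (j - m))\<bar>
      \<le> C * (cmod \<zeta> * norm v) ^ Suc K" using taylor_line by blast
  obtain c where c: "c > 0" "\<And>v. v \<noteq> 0 \<Longrightarrow> norm v \<le> 1 \<Longrightarrow> c * norm v ^ K \<le> taylor_size v"
    using taylor_size_lower_bound by blast
  have nv: "(\<lambda>l. norm (v l)) \<longlonglongrightarrow> 0" using v0 by (rule tendsto_norm_zero)
  have err: "\<forall>\<^sub>F l in sequentially. \<forall>\<zeta>. cmod \<zeta> \<le> R \<longrightarrow>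
      \<bar>r (a + \<zeta> *s v l) / N l - P l \<zeta>\<bar> \<le> C / c * R ^ Suc K * norm (v l)" if R: "R \<ge> 0" for R
  proof -
    have "(\<lambda>l. R * norm (v l)) \<longlonglongrightarrow> 0" using nv by (rule tendsto_mult_right_zero)
    then have "\<forall>\<^sub>F l in sequentially. R * norm (v l) < \<delta>" using \<delta>(1) by (rule order_tendstoD)
    moreover have "\<forall>\<^sub>F l in sequentially. norm (v l) < 1" using nv by (rule order_tendstoD) simp
    ultimately show ?thesis
    proof eventually_elim
      case (elim l)
      show ?case
      proof (intro allI impI)
        fix \<zeta> assume \<zeta>: "cmod \<zeta> \<le> R"
        have le: "cmod \<zeta> * norm (v l) \<le> R * norm (v l)" using \<zeta> by (intro mult_right_mono) auto
        have NN: "c * norm (v l) ^ K \<le> N l" unfolding N_def using c(2)[OF nz] elim by simp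
        have pos: "c * norm (v l) ^ K > 0" using c(1) nz by simp
        have P: "P l \<zeta> = (\<Sum>j\<le>K. \<Sum>m\<le>K. taylor_coeff j m (v l) * Re \<zeta> ^ m * Im \<zeta> ^ (j - m)) / N l"
          by (simp add: P_def sum_divide_distrib)
        have "\<bar>r (a + \<zeta> *s v l) / N l - P l \<zeta>\<bar> =
            \<bar>r (a + \<zeta> *s v l) - (\<Sum>j\<le>K. \<Sum>m\<le>K. taylor_coeff j m (v l) * Re \<zeta> ^ m * Im \<zeta> ^ (j - m))\<bar> / N l"
          unfolding P diff_divide_distrib[symmetric] abs_divide using N[of l] by simp
        also have "\<dots> \<le> (C * (R * norm (v l)) ^ Suc K) / (c * norm (v l) ^ K)"
        proof (rule frac_le)
          have "\<bar>r (a + \<zeta> *s v l) - (\<Sum>j\<le>K. \<Sum>m\<le>K. taylor_coeff j m (v l) * Re \<zeta> ^ m * Im \<zeta> ^ (j - m))\<bar>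
              \<le> C * (cmod \<zeta> * norm (v l)) ^ Suc K"
            using C(2)[of \<zeta> "v l"] le elim by simp
          also have "\<dots> \<le> C * (R * norm (v l)) ^ Suc K"
            using C(1) le by (intro mult_left_mono power_mono) auto
          finally show "\<bar>r (a + \<zeta> *s v l) - (\<Sum>j\<le>K. \<Sum>m\<le>K. taylor_coeff j m (v l) * Re \<zeta> ^ m * Im \<zeta> ^ (j - m))\<bar>
              \<le> C * (R * norm (v l)) ^ Suc K" .
          show "0 \<le> C * (R * norm (v l)) ^ Suc K" using C(1) R by simp
        qed (use pos NN in auto)
        also have "\<dots> = C / c * R ^ Suc K * norm (v l)"
          using nz[of l] c(1) by (simp add: power_mult_distrib field_simps)
        finally show "\<bar>r (a + \<zeta> *s v l) / N l - P l \<zeta>\<bar> \<le> C / c * R ^ Suc K * norm (v l)" .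
      qed
    qed
  qed
  have P_lim: "(\<lambda>l. P l \<zeta>) \<longlonglongrightarrow> p \<zeta>" for \<zeta>
    unfolding P_def p_def N_def using e by (intro tendsto_intros) auto
  have lim: "(\<lambda>l. r (a + \<zeta> *s v l) / N l) \<longlonglongrightarrow> p \<zeta>" for \<zeta>
  proof -
    have "(\<lambda>l. r (a + \<zeta> *s v l) / N l - P l \<zeta>) \<longlonglongrightarrow> 0"
    proof (rule Lim_null_comparison[OF _ tendsto_mult_right_zero[OF nv, of "C / c * cmod \<zeta> ^ Suc K"]])
      show "\<forall>\<^sub>F l in sequentially. norm (r (a + \<zeta> *s v l) / N l - P l \<zeta>) \<le> C / c * cmod \<zeta> ^ Suc K * norm (v l)"
        using err[of "cmod \<zeta>"] by (auto elim!: eventually_mono)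
    qed
    from tendsto_add[OF this P_lim[of \<zeta>]] show ?thesis by simp
  qed
  then show "(\<lambda>l. r (a + \<zeta> *s v l) / taylor_size (v l)) \<longlonglongrightarrow> p \<zeta>" by (simp only: N_def)
  show "p \<zeta> \<ge> 0"
  proof (rule tendsto_lowerbound[OF lim])
    have "(\<lambda>l. cmod \<zeta> * norm (v l)) \<longlonglongrightarrow> 0" using nv by (rule tendsto_mult_right_zero)
    then have "\<forall>\<^sub>F l in sequentially. cmod \<zeta> * norm (v l) < \<delta>" using \<delta>(1) by (rule order_tendstoD)
    then show "\<forall>\<^sub>F l in sequentially. 0 \<le> r (a + \<zeta> *s v l) / N l"
    proof eventually_elim
      case (elim l)
      have "r (a + \<zeta> *s v l) \<ge> 0"
        using tang[of l] elim by (intro tangent_nonneg) (auto simp: \<Lambda>_scale[OF a_in_W] norm_vector_scalar_mult)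
      then show ?case using N[of l] by simp
    qed
  qed simp
  show "\<exists>C. \<forall>\<^sub>F l in sequentially. \<forall>\<zeta>. cmod \<zeta> \<le> R \<longrightarrow> r (a + \<zeta> *s v l) / taylor_size (v l) \<le> C"
  proof (cases "R \<ge> 0")
    case False
    have "\<not> cmod \<zeta> \<le> R" for \<zeta> using False norm_ge_zero[of \<zeta>] by linarith
    then show ?thesis by simp
  next
    case True
    have P_le: "P l \<zeta> \<le> (\<Sum>j\<le>K. \<Sum>m\<le>K. R ^ m * R ^ (j - m))" if "cmod \<zeta> \<le> R" for l \<zeta>
      unfolding P_def
    proof (intro sum_mono)
      fix j m assume jm: "j \<in> {..K}" "m \<in> {..K}"
      have "\<bar>taylor_coeff j m (v l)\<bar> \<le> N l"
        unfolding N_def using jm by (intro taylor_coeff_le_size) auto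
      then have 1: "\<bar>taylor_coeff j m (v l) / N l\<bar> \<le> 1" using N[of l] by simp
      have 2: "\<bar>Re \<zeta>\<bar> \<le> R" "\<bar>Im \<zeta>\<bar> \<le> R"
        using that abs_Re_le_cmod[of \<zeta>] abs_Im_le_cmod[of \<zeta>] by auto
      have "\<bar>taylor_coeff j m (v l) / N l * Re \<zeta> ^ m * Im \<zeta> ^ (j - m)\<bar> \<le> 1 * R ^ m * R ^ (j - m)"
        unfolding abs_mult power_abs using 1 2 by (intro mult_mono power_mono) auto
      then show "taylor_coeff j m (v l) / N l * Re \<zeta> ^ m * Im \<zeta> ^ (j - m) \<le> R ^ m * R ^ (j - m)"
        unfolding mult_1_left by (rule order_trans[OF abs_ge_self])
    qed
    have "\<forall>\<^sub>F l in sequentially. norm (v l) < 1" using nv by (rule order_tendstoD) simp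
    then have "\<forall>\<^sub>F l in sequentially. \<forall>\<zeta>. cmod \<zeta> \<le> R \<longrightarrow> r (a + \<zeta> *s v l) / N l \<le>
        (\<Sum>j\<le>K. \<Sum>m\<le>K. R ^ m * R ^ (j - m)) + C / c * R ^ Suc K"
      using err[OF True]
    proof eventually_elim
      case (elim l)
      show ?case
      proof (intro allI impI)
        fix \<zeta> assume \<zeta>: "cmod \<zeta> \<le> R"
        have "C / c * R ^ Suc K * norm (v l) \<le> C / c * R ^ Suc K * 1"
          using elim C(1) c(1) True by (intro mult_left_mono) auto
        then show "r (a + \<zeta> *s v l) / N l \<le> (\<Sum>j\<le>K. \<Sum>m\<le>K. R ^ m * R ^ (j - m)) + C / c * R ^ Suc K"
          using elim(2) \<zeta> P_le[OF \<zeta>, of l] by (fastforce simp: abs_le_iff)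
      qed
    qed
    then show ?thesis unfolding N_def by blast
  qed
qed

text \<open>By contradiction: a sequence of counterexamples, rescaled along its own complex lines,
  converges to a convex polynomial of the kind treated in \<open>convex_polynomial_even_part_pos\<close>.\<close>

lemma tangential_positivity:
  "\<exists>\<epsilon>>0. \<exists>d>0. \<forall>v. \<Lambda> a v = 0 \<longrightarrow> v \<noteq> 0 \<longrightarrow> norm v < d \<longrightarrow>
    \<epsilon>\<^sup>2 * cmod (Q v) < r (a + v) + \<epsilon> * Re (Q v)"
proof (rule ccontr)
  assume neg: "\<not> ?thesis"
  \<comment> \<open>One null sequence serves both as bending factor and as radius.\<close>
  define \<epsilon> where "\<epsilon> l = inverse (real (Suc l))" for l
  have \<epsilon>: "\<epsilon> l > 0" for l by (simp add: \<epsilon>_def)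
  have \<epsilon>0: "\<epsilon> \<longlonglongrightarrow> 0" unfolding \<epsilon>_def by (rule LIMSEQ_inverse_real_of_nat)
  have "\<exists>v. \<Lambda> a v = 0 \<and> v \<noteq> 0 \<and> norm v < \<epsilon> l \<and>
      r (a + v) + \<epsilon> l * Re (Q v) \<le> (\<epsilon> l)\<^sup>2 * cmod (Q v)" for l
    using neg \<epsilon>[of l] by (meson not_less)
  then obtain w where w: "\<And>l. \<Lambda> a (w l) = 0" "\<And>l. w l \<noteq> 0" "\<And>l. norm (w l) < \<epsilon> l"
      "\<And>l. r (a + w l) + \<epsilon> l * Re (Q (w l)) \<le> (\<epsilon> l)\<^sup>2 * cmod (Q (w l))"
    by metis
  have w0: "w \<longlonglongrightarrow> 0"
    by (rule Lim_null_comparison[OF always_eventually \<epsilon>0]) (use less_imp_le[OF w(3)] in blast)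
  have bound: "\<bar>taylor_coeff j m v / taylor_size v\<bar> \<le> 1" if "j \<le> K" "m \<le> K" "v \<noteq> 0" for j m v
    using taylor_coeff_le_size[OF that(1,2), of v] taylor_size_pos[OF that(3)] by simp
  have "\<exists>\<sigma> e. strict_mono (\<sigma> :: nat \<Rightarrow> nat) \<and> (\<forall>i\<in>{..K}\<times>{..K}.
      (\<lambda>l. taylor_coeff (fst i) (snd i) (w (\<sigma> l)) / taylor_size (w (\<sigma> l))) \<longlonglongrightarrow> e i)"
    by (rule finite_family_convergent_subsequence[where M = 1]) (use bound w(2) in auto)
  then obtain \<sigma> e' where \<sigma>: "strict_mono (\<sigma> :: nat \<Rightarrow> nat)" and
    e': "\<And>i. i \<in> {..K}\<times>{..K} \<Longrightarrow>
      (\<lambda>l. taylor_coeff (fst i) (snd i) (w (\<sigma> l)) / taylor_size (w (\<sigma> l))) \<longlonglongrightarrow> e' i" by blast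
  define v where "v l = w (\<sigma> l)" for l
  define e where "e j m = (if j \<le> K \<and> m \<le> j then e' (j, m) else 0)" for j m
  have v: "\<And>l. \<Lambda> a (v l) = 0" "\<And>l. v l \<noteq> 0" "v \<longlonglongrightarrow> 0"
    using w(1,2) LIMSEQ_subseq_LIMSEQ[OF w0 \<sigma>] by (auto simp: v_def[abs_def] o_def)
  have e: "(\<lambda>l. taylor_coeff j m (v l) / taylor_size (v l)) \<longlonglongrightarrow> e j m" if "j \<le> K" "m \<le> K" for j m
    using e'[of "(j, m)"] that by (cases "m \<le> j") (auto simp: e_def v_def taylor_coeff_eq_0)
  define N where "N l = taylor_size (v l)" for l
  have N: "N l > 0" for l unfolding N_def by (rule taylor_size_pos[OF v(2)])
  define p where "p = (\<lambda>\<zeta>. \<Sum>j\<le>K. \<Sum>m\<le>K. e j m * Re \<zeta> ^ m * Im \<zeta> ^ (j - m))"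
  have lim1: "(\<lambda>l. r (a + \<zeta> *s v l) / taylor_size (v l)) \<longlonglongrightarrow> p \<zeta>" for \<zeta>
    unfolding p_def by (rule rescaled_limit(1)[OF v]) (rule e)
  have lim2: "\<exists>C. \<forall>\<^sub>F l in sequentially. \<forall>\<zeta>. cmod \<zeta> \<le> R \<longrightarrow> r (a + \<zeta> *s v l) / taylor_size (v l) \<le> C" for R
    by (rule rescaled_limit(2)[OF v]) (rule e)
  have p_pos: "p \<zeta> \<ge> 0" for \<zeta>
    unfolding p_def by (rule rescaled_limit(3)[OF v]) (rule e)
  define q where "q = (\<Sum>j | j \<le> K \<and> even j. \<Sum>m\<le>K. of_real (e j m) * \<i> ^ m)"
  have q: "(\<lambda>l. Q (v l) / of_real (N l)) \<longlonglongrightarrow> q"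
  proof -
    have "(\<lambda>l. \<Sum>j | j \<le> K \<and> even j. \<Sum>m\<le>K. of_real (taylor_coeff j m (v l) / N l) * \<i> ^ m) \<longlonglongrightarrow> q"
      unfolding q_def N_def by (intro tendsto_intros e) auto
    then show ?thesis by (simp add: Q_eq_taylor_coeff sum_divide_distrib)
  qed
  have \<epsilon>\<sigma>: "(\<lambda>l. \<epsilon> (\<sigma> l)) \<longlonglongrightarrow> 0" using LIMSEQ_subseq_LIMSEQ[OF \<epsilon>0 \<sigma>] by (simp add: o_def)
  have scaled: "r (a + v l) / N l + \<epsilon> (\<sigma> l) * Re (Q (v l) / of_real (N l))
      \<le> (\<epsilon> (\<sigma> l))\<^sup>2 * cmod (Q (v l) / of_real (N l))" for l
  proof -
    have "(r (a + v l) + \<epsilon> (\<sigma> l) * Re (Q (v l))) / N l \<le> ((\<epsilon> (\<sigma> l))\<^sup>2 * cmod (Q (v l))) / N l"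
      using w(4)[of "\<sigma> l"] N[of l] by (intro divide_right_mono) (auto simp: v_def)
    then show ?thesis using N[of l] by (simp add: add_divide_distrib norm_divide)
  qed
  have r_nonneg: "\<forall>\<^sub>F l in sequentially. r (a + v l) \<ge> 0"
  proof -
    have "\<forall>\<^sub>F l in sequentially. norm (v l) < \<delta>"
      using tendsto_norm_zero[OF v(3)] \<delta>(1) by (rule order_tendstoD)
    then show ?thesis by eventually_elim (use v(1) tangent_nonneg in blast)
  qed
  \<comment> \<open>The parameter 1 belongs to the counterexample \<open>v l\<close> itself; both
    terms with a factor \<epsilon> drop out in the limit.\<close>
  have "p 1 \<le> 0"
  proof (rule LIMSEQ_le)
    show "(\<lambda>l. r (a + 1 *s v l) / taylor_size (v l)) \<longlonglongrightarrow> p 1" by (rule lim1)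
    have "(\<lambda>l. (\<epsilon> (\<sigma> l))\<^sup>2 * cmod (Q (v l) / of_real (N l)) - \<epsilon> (\<sigma> l) * Re (Q (v l) / of_real (N l)))
      \<longlonglongrightarrow> 0\<^sup>2 * cmod q - 0 * Re q"
      by (intro tendsto_intros \<epsilon>\<sigma> q)
    then show "(\<lambda>l. (\<epsilon> (\<sigma> l))\<^sup>2 * cmod (Q (v l) / of_real (N l)) - \<epsilon> (\<sigma> l) * Re (Q (v l) / of_real (N l)))
      \<longlonglongrightarrow> 0" by simp
    show "\<exists>N0. \<forall>l\<ge>N0. r (a + 1 *s v l) / taylor_size (v l) \<le>
        (\<epsilon> (\<sigma> l))\<^sup>2 * cmod (Q (v l) / of_real (N l)) - \<epsilon> (\<sigma> l) * Re (Q (v l) / of_real (N l))"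
    proof (intro exI allI impI)
      fix l
      show "r (a + 1 *s v l) / taylor_size (v l) \<le>
        (\<epsilon> (\<sigma> l))\<^sup>2 * cmod (Q (v l) / of_real (N l)) - \<epsilon> (\<sigma> l) * Re (Q (v l) / of_real (N l))"
        using scaled[of l] unfolding N_def vector_smult_lid by linarith
    qed
  qed
  then have p1: "p 1 = 0" using p_pos[of 1] by simp
  \<comment> \<open>As r >= 0 on the tangent plane, one factor \<epsilon> cancels; the square in the
    claim leaves \<epsilon> |Q|, which after rescaling tends to 0.\<close>
  have "Re q \<le> 0"
  proof (rule tendsto_le[OF _ _ tendsto_Re[OF q]])
    have "(\<lambda>l. \<epsilon> (\<sigma> l) * cmod (Q (v l) / of_real (N l))) \<longlonglongrightarrow> 0 * cmod q"
      by (intro tendsto_intros \<epsilon>\<sigma> q)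
    then show "(\<lambda>l. \<epsilon> (\<sigma> l) * cmod (Q (v l) / of_real (N l))) \<longlonglongrightarrow> 0" by simp
    show "\<forall>\<^sub>F l in sequentially. Re (Q (v l) / of_real (N l)) \<le> \<epsilon> (\<sigma> l) * cmod (Q (v l) / of_real (N l))"
      using r_nonneg
    proof eventually_elim
      case (elim l)
      have "r (a + v l) / N l \<ge> 0" using elim N[of l] by simp
      then have "\<epsilon> (\<sigma> l) * Re (Q (v l) / of_real (N l)) \<le>
          \<epsilon> (\<sigma> l) * (\<epsilon> (\<sigma> l) * cmod (Q (v l) / of_real (N l)))"
        using scaled[of l] unfolding power2_eq_square mult.assoc by linarith
      then show ?case using \<epsilon>[of "\<sigma> l"] mult_le_cancel_left_pos by blast
    qed
  qed simp
  moreover have "Re q > 0"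
    unfolding q_def
  proof (rule convex_polynomial_even_part_pos[OF p_def])
    show "\<exists>g. \<forall>\<zeta>. p \<zeta>0 + Re (g * (\<zeta> - \<zeta>0)) \<le> p \<zeta>" for \<zeta>0
      by (rule limit_has_affine_support[where N = N, OF v(1,3) N])
        (use lim1 lim2 in \<open>simp_all add: N_def\<close>)
    have "(\<lambda>l. r (a + 0 *s v l) / taylor_size (v l)) \<longlonglongrightarrow> p 0" by (rule lim1)
    then show "p 0 = 0" by (simp add: zero LIMSEQ_const_iff)
    \<comment> \<open>The absolute sum 1 of the normalised coefficients passes to the limit.\<close>
    show "\<exists>j\<le>K. \<exists>m\<le>K. e j m \<noteq> 0"
    proof (rule ccontr)
      assume *: "\<not> ?thesis"
      have "(\<lambda>l. \<Sum>j\<le>K. \<Sum>m\<le>K. \<bar>taylor_coeff j m (v l) / taylor_size (v l)\<bar>) \<longlonglongrightarrow> (\<Sum>j\<le>K. \<Sum>m\<le>K. \<bar>e j m\<bar>)"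
        by (intro tendsto_intros e) auto
      moreover have "(\<Sum>j\<le>K. \<Sum>m\<le>K. \<bar>e j m\<bar>) = 0" using * by (intro sum.neutral) auto
      moreover have "(\<Sum>j\<le>K. \<Sum>m\<le>K. \<bar>taylor_coeff j m (v l) / taylor_size (v l)\<bar>) = 1" for l
      proof -
        have "(\<Sum>j\<le>K. \<Sum>m\<le>K. \<bar>taylor_coeff j m (v l) / taylor_size (v l)\<bar>) = taylor_size (v l) / taylor_size (v l)"
          using N[of l] by (subst (2) taylor_size_def) (simp add: sum_divide_distrib N_def)
        then show ?thesis using N[of l] by (simp add: N_def)
      qed
      ultimately show False by (simp add: LIMSEQ_const_iff)
    qed
  qed (use p_pos p1 in \<open>auto simp: e_def\<close>)
  ultimately show False by simp
qed

end

subsection \<open>The holomorphic support function\<close>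

definition complex_differentiable :: "(complex ^ 'n \<Rightarrow> complex) \<Rightarrow> complex ^ 'n \<Rightarrow> bool" where
  "complex_differentiable f x \<longleftrightarrow>
    (\<exists>f'. (f has_derivative f') (at x) \<and> (\<forall>c v. f' (c *s v) = c * f' v))"

lemma complex_differentiable_const: "complex_differentiable (\<lambda>_. c) x"
  unfolding complex_differentiable_def by (intro exI[of _ "\<lambda>_. 0"]) auto

lemma complex_differentiable_linear:
  assumes "\<And>v w. f (v + w) = f v + f w" "\<And>c v. f (c *s v) = c * f v"
  shows "complex_differentiable f x"
proof -
  have "linear f"
    by (rule linearI) (simp_all add: assms scaleR_eq_vector_scalar_mult scaleR_conv_of_real)
  then have "(f has_derivative f) (at x)"
    by (intro bounded_linear_imp_has_derivative) (simp add: linear_conv_bounded_linear)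
  then show ?thesis unfolding complex_differentiable_def using assms(2) by blast
qed

lemma complex_differentiable_add:
  assumes "complex_differentiable f x" "complex_differentiable g x"
  shows "complex_differentiable (\<lambda>z. f z + g z) x"
proof -
  obtain f' g' where "(f has_derivative f') (at x)" "\<And>c v. f' (c *s v) = c * f' v"
      "(g has_derivative g') (at x)" "\<And>c v. g' (c *s v) = c * g' v"
    using assms unfolding complex_differentiable_def by blast
  then show ?thesis unfolding complex_differentiable_def
    by (intro exI[of _ "\<lambda>h. f' h + g' h"] conjI has_derivative_add) (auto simp: algebra_simps)
qed

lemma complex_differentiable_mult:
  assumes "complex_differentiable f x" "complex_differentiable g x"
  shows "complex_differentiable (\<lambda>z. f z * g z) x"
proof -
  obtain f' g' where "(f has_derivative f') (at x)" "\<And>c v. f' (c *s v) = c * f' v"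
      "(g has_derivative g') (at x)" "\<And>c v. g' (c *s v) = c * g' v"
    using assms unfolding complex_differentiable_def by blast
  then show ?thesis unfolding complex_differentiable_def
    by (intro exI[of _ "\<lambda>h. f x * g' h + f' h * g x"] conjI has_derivative_mult) (auto simp: algebra_simps)
qed

lemma complex_differentiable_sum:
  "finite I \<Longrightarrow> (\<And>i. i \<in> I \<Longrightarrow> complex_differentiable (f i) x) \<Longrightarrow>
    complex_differentiable (\<lambda>z. \<Sum>i\<in>I. f i z) x"
  by (induction I rule: finite_induct)
    (auto intro: complex_differentiable_const complex_differentiable_add)

lemma complex_differentiable_compose_affine:
  assumes "complex_differentiable f (g (x - a))" "linear g" "\<And>c v. g (c *s v) = c *s g v"
  shows "complex_differentiable (\<lambda>z. f (g (z - a))) x"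
proof -
  obtain f' where f': "(f has_derivative f') (at (g (x - a)))" "\<And>c v. f' (c *s v) = c * f' v"
    using assms(1) unfolding complex_differentiable_def by blast
  have "bounded_linear g" using assms(2) by (simp add: linear_conv_bounded_linear)
  moreover have "((\<lambda>z. z - a) has_derivative (\<lambda>h. h)) (at x)"
    by (auto intro!: derivative_eq_intros)
  ultimately have "((\<lambda>z. g (z - a)) has_derivative g) (at x)"
    by (rule bounded_linear.has_derivative)
  from has_derivative_compose[OF this f'(1)] show ?thesis
    unfolding complex_differentiable_def using f'(2) assms(3) by (intro exI[of _ "\<lambda>h. f' (g h)"]) simp
qed

lemma complex_differentiable_chain:
  assumes "complex_differentiable f x" "(g has_field_derivative g') (at (f x))"
  shows "complex_differentiable (\<lambda>z. g (f z)) x"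
proof -
  obtain f' where f': "(f has_derivative f') (at x)" "\<And>c v. f' (c *s v) = c * f' v"
    using assms(1) unfolding complex_differentiable_def by blast
  from has_derivative_compose[OF f'(1) assms(2)[unfolded has_field_derivative_def]]
  show ?thesis
    unfolding complex_differentiable_def using f'(2) by (intro exI[of _ "\<lambda>h. g' * f' h"]) (simp add: mult_ac)
qed

section \<open>Holomorphy of the complexified forms\<close>

lemma polyval_lincomb:
  "polyval j (\<lambda>l. c * B l + d * B' l) u w x y =
    of_real c * polyval j B u w x y + of_real d * (polyval j B' u w x y :: complex)"
  by (induction j arbitrary: B B') (auto simp: algebra_simps)

lemma polyval_zero: "polyval j (\<lambda>l. 0) u w x y = (0 :: complex)"
  by (induction j) auto

lemma polyval_sum:
  assumes "finite I"
  shows "polyval j (\<lambda>l. \<Sum>i\<in>I. F i l) u w x y = (\<Sum>i\<in>I. polyval j (F i) u w x y :: complex)"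
  using assms
proof (induction I rule: finite_induct)
  case (insert i I)
  then show ?case using polyval_lincomb[of j 1 "F i" 1 "\<lambda>l. \<Sum>i\<in>I. F i l"] by simp
qed (simp add: polyval_zero)

text \<open>Evaluation at \<open>(\<i>, 1)\<close> turns the derivative along \<open>v\<close> into \<open>\<i> \<partial>\<^sub>v + \<partial>\<^bsub>\<i>v\<^esub>\<close>, which is
  complex linear in \<open>v\<close>.\<close>

lemma polyval_complex_differentiable:
  fixes B :: "(complex ^ 'n) list \<Rightarrow> real"
  assumes "multilinear B"
  shows "complex_differentiable (\<lambda>v. polyval j B v (\<i> *s v) \<i> 1) x"
  using assms
proof (induction j arbitrary: B)
  case 0
  then show ?case by (simp add: complex_differentiable_const)
next
  case (Suc j)
  define e :: "'n \<Rightarrow> complex ^ 'n" where "e k = axis k 1" for k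
  \<comment> \<open>With the first slot frozen at h, real linearity in h expands both terms of the
    recursion over \<open>e k\<close> and \<open>\<i> *s e k\<close>; the induction hypothesis
    covers the resulting forms of degree j.\<close>
  define R where "R h v = polyval j (\<lambda>l. B (h # l)) v (\<i> *s v) \<i> 1" for h v
  have lin: "linear (\<lambda>h. B (h # l))" for l using multilinear_linear_Cons[OF Suc.prems] .
  have 1: "R v u = (\<Sum>k\<in>UNIV. of_real (Re (v $ k)) * R (e k) u + of_real (Im (v $ k)) * R (\<i> *s e k) u)"
    for u v
  proof -
    have "B (v # l) = (\<Sum>k\<in>UNIV. Re (v $ k) * B (e k # l) + Im (v $ k) * B ((\<i> *s e k) # l))" for l
    proof -
      have "B (v # l) = B ((\<Sum>k\<in>UNIV. v $ k *s e k) # l)" by (simp add: e_def basis_expansion)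
      also have "\<dots> = (\<Sum>k\<in>UNIV. B ((v $ k *s e k) # l))" by (rule linear_sum[OF lin])
      also have "\<dots> = (\<Sum>k\<in>UNIV. Re (v $ k) * B (e k # l) + Im (v $ k) * B ((\<i> *s e k) # l))"
        by (rule sum.cong[OF refl linear_vector_scalar_mult[OF lin]])
      finally show ?thesis .
    qed
    then show ?thesis
      by (simp only: R_def polyval_sum[OF finite_class.finite_UNIV] polyval_lincomb)
  qed
  have neg: "R (\<i> *s (\<i> *s e k)) u = - R (e k) u" for k u
  proof -
    have "B ((\<i> *s (\<i> *s e k)) # l) = (-1) * B (e k # l) + 0 * B []" for l
      using linear_neg[OF lin, of "e k" l] by (simp add: vector_smult_assoc vector_sneg_minus1[symmetric])
    then show ?thesis by (simp only: R_def polyval_lincomb) simp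
  qed
  have 2: "R (\<i> *s v) u = (\<Sum>k\<in>UNIV. of_real (Re (v $ k)) * R (\<i> *s e k) u - of_real (Im (v $ k)) * R (e k) u)"
    for u v
  proof -
    have "B ((\<i> *s v) # l) = (\<Sum>k\<in>UNIV. Re (v $ k) * B ((\<i> *s e k) # l) + Im (v $ k) * B ((\<i> *s (\<i> *s e k)) # l))" for l
    proof -
      have "B ((\<i> *s v) # l) = B ((\<i> *s (\<Sum>k\<in>UNIV. v $ k *s e k)) # l)" by (simp add: e_def basis_expansion)
      also have "\<i> *s (\<Sum>k\<in>UNIV. v $ k *s e k) = (\<Sum>k\<in>UNIV. v $ k *s (\<i> *s e k))"
        by (simp add: vec_eq_iff sum_distrib_left mult_ac)
      also have "B ((\<Sum>k\<in>UNIV. v $ k *s (\<i> *s e k)) # l) = (\<Sum>k\<in>UNIV. B ((v $ k *s (\<i> *s e k)) # l))"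
        by (rule linear_sum[OF lin])
      also have "\<dots> = (\<Sum>k\<in>UNIV. Re (v $ k) * B ((\<i> *s e k) # l) + Im (v $ k) * B ((\<i> *s (\<i> *s e k)) # l))"
        by (rule sum.cong[OF refl linear_vector_scalar_mult[OF lin]])
      finally show ?thesis .
    qed
    then have "R (\<i> *s v) u =
        (\<Sum>k\<in>UNIV. of_real (Re (v $ k)) * R (\<i> *s e k) u + of_real (Im (v $ k)) * R (\<i> *s (\<i> *s e k)) u)"
      by (simp only: R_def polyval_sum[OF finite_class.finite_UNIV] polyval_lincomb)
    then show ?thesis by (simp only: neg mult_minus_right add_uminus_conv_diff)
  qed
  \<comment> \<open>X and Y are the real and imaginary parts of \<open>v $ k\<close>; the weights
    \<i> and 1 are what lets them enter through X + \<i> Y only.\<close>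
  have alg: "\<i> * (X * A + Y * C) + (X * C - Y * A) = (X + \<i> * Y) * (\<i> * A + C)" for X Y A C
    by (simp add: algebra_simps)
  have "polyval (Suc j) B v (\<i> *s v) \<i> 1 = (\<Sum>k\<in>UNIV. v $ k * (\<i> * R (e k) v + R (\<i> *s e k) v))" for v
  proof -
    have "polyval (Suc j) B v (\<i> *s v) \<i> 1 = \<i> * R v v + R (\<i> *s v) v" by (simp add: R_def)
    also have "\<dots> = (\<Sum>k\<in>UNIV. (of_real (Re (v $ k)) + \<i> * of_real (Im (v $ k))) * (\<i> * R (e k) v + R (\<i> *s e k) v))"
      unfolding 1[of v v] 2[of v v] sum_distrib_left sum.distrib[symmetric] by (intro sum.cong refl alg)
    finally show ?thesis by (simp only: complex_eq[symmetric])
  qed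
  moreover have "complex_differentiable (\<lambda>v. \<Sum>k\<in>UNIV. v $ k * (\<i> * R (e k) v + R (\<i> *s e k) v)) x"
    unfolding R_def
    by (intro complex_differentiable_sum complex_differentiable_mult complex_differentiable_add
        complex_differentiable_const Suc.IH multilinear_Cons[OF Suc.prems]
        complex_differentiable_linear) (auto simp: algebra_simps)
  ultimately show ?case by (simp only:)
qed

context smooth_lineally_convex
begin

text \<open>The complex-linear projection onto the complex tangent space along n.\<close>

definition tang_proj :: "complex ^ 'n \<Rightarrow> complex ^ 'n" where
  "tang_proj x = x - \<Lambda> a x *s n"

lemma \<Lambda>_n: "\<Lambda> a n = 1"
  by (rule normal)

lemma \<Lambda>_tang_proj: "\<Lambda> a (tang_proj x) = 0"
  unfolding tang_proj_def \<Lambda>_diff[OF a_in_W] \<Lambda>_scale[OF a_in_W] \<Lambda>_n by simp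

lemma tang_proj_scale: "tang_proj (c *s x) = c *s tang_proj x"
  by (simp add: tang_proj_def \<Lambda>_scale[OF a_in_W] vector_ssub_ldistrib vector_smult_assoc)

lemma tang_proj_linear: "linear tang_proj"
proof (rule linearI)
  show "tang_proj (x + y) = tang_proj x + tang_proj y" for x y
    by (simp add: tang_proj_def \<Lambda>_add[OF a_in_W] vector_sadd_rdistrib)
  show "tang_proj (t *\<^sub>R x) = t *\<^sub>R tang_proj x" for t x
    by (simp only: scaleR_eq_vector_scalar_mult tang_proj_scale)
qed

lemma \<Lambda>_linear: "linear (\<Lambda> a)"
  by (rule linearI)
    (simp_all add: \<Lambda>_add[OF a_in_W] scaleR_eq_vector_scalar_mult \<Lambda>_scale[OF a_in_W] scaleR_conv_of_real)

lemma tang_proj_n: "tang_proj (c *s n) = 0"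
  by (simp add: tang_proj_def \<Lambda>_scale[OF a_in_W] \<Lambda>_n)

end

context finite_line_type
begin

lemma Q_complex_differentiable: "complex_differentiable Q x"
proof -
  have "finite {j. j \<le> K \<and> even j}" by simp
  then show ?thesis
    unfolding Q_def
    by (intro complex_differentiable_sum polyval_complex_differentiable taylor_multilinear)
qed

lemma Q_0: "Q 0 = 0"
proof -
  have "taylor_coeff j m 0 = 0" for j m
  proof (cases j)
    case 0
    then show ?thesis by (simp add: taylor_coeff_def taylor_form_def zero)
  next
    case (Suc i)
    then show ?thesis using taylor_coeff_scale[of j m 0 0] by simp
  qed
  then show ?thesis by (simp add: Q_eq_taylor_coeff)
qed

text \<open>The complex hypersurface \<open>w = 0\<close> touches \<open>{r \<le> 0}\<close> at \<open>a\<close> only, from outside.\<close>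

lemma holomorphic_support_function:
  "\<exists>w d. d > 0 \<and> w a = 0 \<and> (\<forall>x. complex_differentiable w x) \<and>
    (\<forall>z\<in>ball a d. z \<noteq> a \<longrightarrow> r z \<le> 0 \<longrightarrow> w z \<notin> \<real>\<^sub>\<le>\<^sub>0)"
proof -
  obtain \<epsilon> d1 where \<epsilon>: "\<epsilon> > 0" and d1: "d1 > 0" "\<And>v. \<Lambda> a v = 0 \<Longrightarrow> v \<noteq> 0 \<Longrightarrow> norm v < d1 \<Longrightarrow>
      \<epsilon>\<^sup>2 * cmod (Q v) < r (a + v) + \<epsilon> * Re (Q v)"
    using tangential_positivity by blast
  \<comment> \<open>At most \<epsilon>, so that the error from the Q term is covered by
    \<open>\<epsilon>\<^sup>2 * cmod (Q v)\<close> in \<open>tangential_positivity\<close>; below 1,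
    so that the error cannot use up the gain s.\<close>
  define \<eta> where "\<eta> = min \<epsilon> (1/2)"
  have \<eta>: "\<eta> > 0" "\<eta> \<le> \<epsilon>" "\<eta> < 1" using \<epsilon> by (auto simp: \<eta>_def)
  obtain d2 where d2: "0 < d2" "d2 \<le> \<delta>"
    "\<And>x c. x \<in> ball a d2 \<Longrightarrow> x + c *s n \<in> ball a d2 \<Longrightarrow> \<bar>r (x + c *s n) - r x - Re c\<bar> \<le> \<eta> * cmod c"
    using normal_increment[OF \<eta>(1)] by blast
  obtain M where M: "M > 0" "\<And>x. norm (tang_proj x) \<le> M * norm x"
    using linear_bounded_pos[OF tang_proj_linear] by blast
  define d where "d = min d2 (min d1 d2 / M)"
  define w where "w z = of_real \<epsilon> * Q (tang_proj (z - a)) + (- 1) * \<Lambda> a (z - a)" for z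
  have "d > 0" using d1 d2 M by (simp add: d_def)
  moreover have "w a = 0"
    by (simp add: w_def linear_0[OF tang_proj_linear] linear_0[OF \<Lambda>_linear] Q_0)
  moreover have "complex_differentiable w x" for x
  proof -
    have l: "complex_differentiable (\<lambda>z. \<Lambda> a (z - a)) x"
      by (rule complex_differentiable_compose_affine[where g = "\<lambda>x. x"])
        (auto intro!: complex_differentiable_linear simp: \<Lambda>_add[OF a_in_W] \<Lambda>_scale[OF a_in_W] linear_ident)
    have q: "complex_differentiable (\<lambda>z. Q (tang_proj (z - a))) x"
      by (rule complex_differentiable_compose_affine[OF Q_complex_differentiable tang_proj_linear tang_proj_scale])
    show ?thesis
      unfolding w_def
      by (rule complex_differentiable_add[OF complex_differentiable_mult[OF complex_differentiable_const q]
            complex_differentiable_mult[OF complex_differentiable_const l]])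
  qed
  moreover have "w z \<notin> \<real>\<^sub>\<le>\<^sub>0" if z: "z \<in> ball a d" "z \<noteq> a" "r z \<le> 0" for z
  proof
    assume "w z \<in> \<real>\<^sub>\<le>\<^sub>0"
    define s where "s = - Re (w z)"
    have s: "s \<ge> 0" "w z = - of_real s"
      using \<open>w z \<in> \<real>\<^sub>\<le>\<^sub>0\<close> by (auto simp: s_def complex_nonpos_Reals_iff complex_eq_iff)
    define v where "v = tang_proj (z - a)"
    \<comment> \<open>The equation w z = - s says that z is the point of the hypersurface over v,
      raised by s along n, the direction in which r grows.\<close>
    define c where "c = of_real s + of_real \<epsilon> * Q v"
    have c: "c = \<Lambda> a (z - a)" using s(2) by (simp add: w_def v_def c_def algebra_simps)
    have z_eq: "z = a + v + c *s n" by (simp add: v_def tang_proj_def c)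
    have nz: "norm (z - a) < d" using z(1) by (simp add: dist_norm norm_minus_commute)
    have "norm v \<le> M * norm (z - a)" unfolding v_def by (rule M(2))
    also have "\<dots> < M * (min d1 d2 / M)" using nz M(1) by (intro mult_strict_left_mono) (auto simp: d_def)
    finally have v: "norm v < d1" "norm v < d2" using M(1) by auto
    have "a + v \<in> ball a d2" using v(2) by (metis add_diff_cancel_left' dist_commute dist_norm mem_ball)
    moreover have "a + v + c *s n \<in> ball a d2" using z(1) unfolding z_eq[symmetric] by (auto simp: d_def)
    ultimately have "\<bar>r z - r (a + v) - Re c\<bar> \<le> \<eta> * cmod c"
      using d2(3) z_eq by metis
    then have 1: "r z \<ge> r (a + v) + Re c - \<eta> * cmod c" by linarith
    have "cmod c \<le> s + \<epsilon> * cmod (Q v)"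
      using norm_triangle_ineq[of "of_real s" "of_real \<epsilon> * Q v"] s(1) \<epsilon> by (simp add: c_def norm_mult)
    then have "\<eta> * cmod c \<le> \<eta> * s + \<eta> * (\<epsilon> * cmod (Q v))"
      using mult_left_mono[of "cmod c" "s + \<epsilon> * cmod (Q v)" \<eta>] \<eta> by (simp add: distrib_left)
    also have "\<eta> * (\<epsilon> * cmod (Q v)) \<le> \<epsilon> * (\<epsilon> * cmod (Q v))"
      using \<eta> \<epsilon> by (intro mult_right_mono) auto
    finally have 2: "\<eta> * cmod c \<le> \<eta> * s + \<epsilon>\<^sup>2 * cmod (Q v)" by (simp add: power2_eq_square)
    have 3: "Re c = s + \<epsilon> * Re (Q v)" by (simp add: c_def)
    have tv: "\<Lambda> a v = 0" unfolding v_def by (rule \<Lambda>_tang_proj)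
    have "r z > 0"
    proof (cases "v = 0")
      case True
      then have "s > 0" using z_eq z(2) s(1) by (cases "s = 0") (auto simp: c_def Q_0)
      then have "\<eta> * s < s" using \<eta> by simp
      then show ?thesis using 1 2 3 True by (simp add: Q_0 zero)
    next
      case False
      have "\<eta> * s \<le> s" using \<eta> s(1) by (simp add: mult_left_le_one_le)
      then show ?thesis using 1 2 3 d1(2)[OF tv False v(1)] by linarith
    qed
    then show False using z(3) by simp
  qed
  ultimately show ?thesis by blast
qed

end

subsection \<open>The peak function\<close>

context smooth_lineally_convex
begin

text \<open>Moving along \<open>- n\<close> decreases \<open>r\<close>, and the bottom of a flat box lies in \<open>{r < 0}\<close>.\<close>

lemma connected_sublevel_box:
  assumes "\<rho> > 0"
  shows "\<exists>U. open U \<and> a \<in> U \<and> U \<subseteq> ball a \<rho> \<and> connected {x \<in> U. r x < 0} \<and> {x \<in> U. r x < 0} \<noteq> {}"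
proof -
  obtain d0 where d0: "0 < d0" "d0 \<le> \<delta>"
    "\<And>x c. x \<in> ball a d0 \<Longrightarrow> x + c *s n \<in> ball a d0 \<Longrightarrow> \<bar>r (x + c *s n) - r x - Re c\<bar> \<le> 1/2 * cmod c"
    using normal_increment[of "1/2"] by auto
  define d where "d = min \<rho> d0"
  have d: "d > 0" using assms d0 by (simp add: d_def)
  define M where "M = 1 + norm n"
  have M: "M \<ge> 1" by (simp add: M_def)
  \<comment> \<open>Points of the box are at distance at most t2 + 2 t2 |n| from a, so the box fits
    into the ball of radius d.\<close>
  define t2 where "t2 = d / (4 * M)"
  have t2: "t2 > 0" using d M by (simp add: t2_def)
  have "\<exists>\<kappa>>0. \<forall>x. dist x a < \<kappa> \<longrightarrow> dist (r x) (r a) < t2 / 4"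
    using isCont_r t2 unfolding continuous_at_eps_delta by (auto dest!: spec[of _ "t2 / 4"])
  then obtain \<kappa> where \<kappa>: "\<kappa> > 0" "\<And>x. dist x a < \<kappa> \<Longrightarrow> \<bar>r x\<bar> < t2 / 4"
    by (auto simp: zero dist_real_def)
  \<comment> \<open>The box is thin in all directions except the real direction of n: on its slice
    at height 0 the value of r stays below t2 / 4.\<close>
  define t1 where "t1 = min t2 (\<kappa> / (2 * M))"
  have t1: "t1 > 0" "t1 \<le> t2" using t2 \<kappa> M by (auto simp: t1_def)
  define U where "U = {z. norm (tang_proj (z - a)) < t1 \<and> \<bar>Re (\<Lambda> a (z - a))\<bar> < t2 \<and> \<bar>Im (\<Lambda> a (z - a))\<bar> < t1}"
  have decomp: "z - a = tang_proj (z - a) + \<Lambda> a (z - a) *s n" for z by (simp add: tang_proj_def)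
  have cont: "continuous_on UNIV tang_proj" "continuous_on UNIV (\<Lambda> a)"
    using tang_proj_linear \<Lambda>_linear linear_continuous_on linear_conv_bounded_linear by blast+
  have "open U"
    unfolding U_def
    by (intro open_Collect_conj open_Collect_less continuous_intros
        continuous_on_compose2[OF cont(1)] continuous_on_compose2[OF cont(2)]) auto
  moreover have "a \<in> U"
    using t1 t2 by (simp add: U_def linear_0[OF tang_proj_linear] linear_0[OF \<Lambda>_linear])
  moreover have U_ball: "U \<subseteq> ball a d"
  proof
    fix z assume z: "z \<in> U"
    have "norm (z - a) \<le> norm (tang_proj (z - a)) + cmod (\<Lambda> a (z - a)) * norm n"
      using norm_triangle_ineq[of "tang_proj (z - a)" "\<Lambda> a (z - a) *s n"] decomp[of z]
      by (simp add: norm_vector_scalar_mult)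
    also have "\<dots> \<le> t2 + 2 * t2 * norm n"
      using z t1 cmod_le[of "\<Lambda> a (z - a)"] by (intro add_mono mult_right_mono) (auto simp: U_def)
    also have "\<dots> < 4 * M * t2"
    proof -
      have "4 * M * t2 = 4 * t2 + 4 * (t2 * norm n)" "2 * t2 * norm n = 2 * (t2 * norm n)"
        by (simp_all add: M_def algebra_simps)
      moreover have "t2 * norm n \<ge> 0" using t2 by simp
      ultimately show ?thesis using t2 by linarith
    qed
    also have "\<dots> = d" using M by (simp add: t2_def)
    finally show "z \<in> ball a d" by (simp add: dist_norm norm_minus_commute)
  qed
  moreover have shift: "\<Lambda> a (z + c *s n - a) = \<Lambda> a (z - a) + c"
    "tang_proj (z + c *s n - a) = tang_proj (z - a)" for z c
  proof -
    have e: "z + c *s n - a = (z - a) + c *s n" by simp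
    show "\<Lambda> a (z + c *s n - a) = \<Lambda> a (z - a) + c"
      unfolding e \<Lambda>_add[OF a_in_W] \<Lambda>_scale[OF a_in_W] \<Lambda>_n by simp
    show "tang_proj (z + c *s n - a) = tang_proj (z - a)"
      unfolding e linear_add[OF tang_proj_linear] tang_proj_n by simp
  qed
  define S where "S = {x \<in> U. r x < 0}"
  \<comment> \<open>Below depth t2 / 2 the descent from height 0 has lowered r by more than t2 / 4,
    which exceeds its value there. Being convex, B connects all the vertical paths.\<close>
  define B where "B = {z \<in> U. Re (\<Lambda> a (z - a)) < - t2 / 2}"
  have "convex B"
    unfolding convex_alt
  proof (intro ballI allI impI)
    fix x y and u :: real assume xy: "x \<in> B" "y \<in> B" and u: "0 \<le> u \<and> u \<le> 1"
    define z where "z = (1 - u) *\<^sub>R x + u *\<^sub>R y"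
    have za: "z - a = (1 - u) *\<^sub>R (x - a) + u *\<^sub>R (y - a)" by (simp add: z_def algebra_simps)
    have 1: "tang_proj (z - a) = (1 - u) *\<^sub>R tang_proj (x - a) + u *\<^sub>R tang_proj (y - a)"
      "\<Lambda> a (z - a) = (1 - u) *\<^sub>R \<Lambda> a (x - a) + u *\<^sub>R \<Lambda> a (y - a)"
      unfolding za by (simp_all only: linear_add[OF tang_proj_linear] linear_scale[OF tang_proj_linear]
          linear_add[OF \<Lambda>_linear] linear_scale[OF \<Lambda>_linear])
    have "tang_proj (z - a) \<in> ball 0 t1"
      unfolding 1 by (rule convexD[OF convex_ball]) (use xy u in \<open>auto simp: B_def U_def\<close>)
    moreover have "Re (\<Lambda> a (z - a)) \<in> {-t2<..<- t2 / 2}"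
    proof -
      have "(1 - u) *\<^sub>R Re (\<Lambda> a (x - a)) + u *\<^sub>R Re (\<Lambda> a (y - a)) \<in> {-t2<..<- t2 / 2}"
        by (rule convexD[OF convex_real_interval(8)]) (use xy u in \<open>auto simp: B_def U_def\<close>)
      then show ?thesis unfolding 1 by simp
    qed
    moreover have "Im (\<Lambda> a (z - a)) \<in> {-t1<..<t1}"
    proof -
      have "(1 - u) *\<^sub>R Im (\<Lambda> a (x - a)) + u *\<^sub>R Im (\<Lambda> a (y - a)) \<in> {-t1<..<t1}"
        by (rule convexD[OF convex_real_interval(8)]) (use xy u in \<open>auto simp: B_def U_def\<close>)
      then show ?thesis unfolding 1 by simp
    qed
    ultimately show "(1 - u) *\<^sub>R x + u *\<^sub>R y \<in> B"
      using t2 unfolding B_def U_def z_def[symmetric] by auto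
  qed
  have ball0: "z \<in> ball a d0" if "z \<in> U" for z using U_ball that by (auto simp: d_def)
  have "B \<subseteq> S"
  proof
    fix z assume z: "z \<in> B"
    define x where "x = Re (\<Lambda> a (z - a))"
    define y where "y = z + of_real (- x) *s n"
    have zU: "z \<in> U" and x: "x < - t2 / 2" using z by (auto simp: B_def x_def)
    have \<Lambda>y: "\<Lambda> a (y - a) = \<i> * of_real (Im (\<Lambda> a (z - a)))"
      unfolding y_def shift x_def by (simp add: complex_eq_iff)
    have ty: "tang_proj (y - a) = tang_proj (z - a)" unfolding y_def by (rule shift)
    have yU: "y \<in> U" using zU t2 by (simp add: U_def \<Lambda>y ty)
    have "norm (y - a) \<le> norm (tang_proj (y - a)) + cmod (\<Lambda> a (y - a)) * norm n"
      using norm_triangle_ineq[of "tang_proj (y - a)" "\<Lambda> a (y - a) *s n"] decomp[of y]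
      by (simp add: norm_vector_scalar_mult)
    also have "\<dots> \<le> t1 + t1 * norm n"
      using zU unfolding \<Lambda>y ty by (intro add_mono mult_right_mono) (auto simp: U_def norm_mult)
    also have "\<dots> = t1 * M" by (simp add: M_def algebra_simps)
    also have "\<dots> \<le> \<kappa> / (2 * M) * M" using M by (intro mult_right_mono) (auto simp: t1_def)
    also have "\<dots> < \<kappa>" using M \<kappa>(1) by simp
    finally have ry: "r y < t2 / 4" using \<kappa>(2)[of y] by (simp add: dist_norm)
    have zy: "z = y + of_real x *s n" by (simp add: y_def vec_eq_iff)
    have "\<bar>r z - r y - x\<bar> \<le> 1/2 * \<bar>x\<bar>"
      using d0(3)[of y "of_real x"] ball0[OF yU] ball0[OF zU] unfolding zy[symmetric] by simp
    then have "r z < 0" using ry x t2 by linarith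
    then show "z \<in> S" using zU by (simp add: S_def)
  qed
  define b0 where "b0 = a + of_real (- 3 / 4 * t2) *s n"
  have b0: "b0 \<in> B"
  proof -
    have "\<Lambda> a (b0 - a) = 0 + of_real (- 3 / 4 * t2)" "tang_proj (b0 - a) = 0"
      unfolding b0_def shift by (simp_all add: linear_0[OF tang_proj_linear] linear_0[OF \<Lambda>_linear])
    then show ?thesis using t1 t2 by (simp add: B_def U_def)
  qed
  have reach: "connected_component S z b0" if z: "z \<in> S" for z
  proof (cases "z \<in> B")
    case True
    show ?thesis
      unfolding connected_component_def using True b0 \<open>B \<subseteq> S\<close> \<open>convex B\<close> convex_connected by blast
  next
    case False
    define x where "x = Re (\<Lambda> a (z - a))"
    have zU: "z \<in> U" "r z < 0" using z by (auto simp: S_def)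
    have x: "x \<ge> - t2 / 2" "x < t2" using False zU by (auto simp: B_def U_def x_def)
    \<comment> \<open>The descent ends at depth 3/4 t2, in the middle of the bottom layer; along it
      r decreases at a rate of at least 1/2.\<close>
    define \<tau> where "\<tau> = x + 3 / 4 * t2"
    have \<tau>: "\<tau> > 0" "x - \<tau> = - 3 / 4 * t2" using x t2 by (auto simp: \<tau>_def)
    define y where "y s = z + of_real (- s) *s n" for s
    have yU: "y s \<in> U" if "0 \<le> s" "s \<le> \<tau>" for s
    proof -
      have "\<Lambda> a (y s - a) = \<Lambda> a (z - a) + of_real (- s)" "tang_proj (y s - a) = tang_proj (z - a)"
        unfolding y_def by (rule shift)+
      moreover have "\<bar>x - s\<bar> < t2" using that \<tau>(2) x t2 by (simp add: abs_less_iff)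
      ultimately show ?thesis using zU by (simp add: U_def x_def)
    qed
    have yS: "y s \<in> S" if "0 \<le> s" "s \<le> \<tau>" for s
    proof -
      have "\<bar>r (y s) - r z + s\<bar> \<le> 1/2 * s"
        using d0(3)[of z "of_real (- s)"] ball0[OF zU(1)] ball0[OF yU[OF that]] that by (simp add: y_def)
      then have "r (y s) < 0" using zU(2) that by linarith
      then show ?thesis using yU[OF that] by (simp add: S_def)
    qed
    have "y \<tau> \<in> B"
    proof -
      have "\<Lambda> a (y \<tau> - a) = \<Lambda> a (z - a) + of_real (- \<tau>)" unfolding y_def by (rule shift)
      then have "Re (\<Lambda> a (y \<tau> - a)) = - 3 / 4 * t2" using \<tau>(2) by (simp add: x_def)
      then show ?thesis using yU[of \<tau>] \<tau>(1) t2 by (simp add: B_def)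
    qed
    have "continuous_on {0..\<tau>} y" unfolding y_def by (intro continuous_intros)
    then have "connected (y ` {0..\<tau>})" by (rule connected_continuous_image) simp
    moreover have "z \<in> y ` {0..\<tau>}" using \<tau>(1) by (intro image_eqI[of _ _ 0]) (auto simp: y_def)
    moreover have "y \<tau> \<in> y ` {0..\<tau>}" using \<tau>(1) by simp
    ultimately have "connected (y ` {0..\<tau>} \<union> B)"
      using \<open>y \<tau> \<in> B\<close> convex_connected[OF \<open>convex B\<close>] by (intro connected_Un) blast+
    moreover have "y ` {0..\<tau>} \<union> B \<subseteq> S" using yS \<open>B \<subseteq> S\<close> by auto
    ultimately show ?thesis
      unfolding connected_component_def using \<open>z \<in> y ` {0..\<tau>}\<close> b0 by blast
  qed
  have "connected S"
    unfolding connected_iff_connected_component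
    by (intro ballI connected_component_trans[OF reach connected_component_sym[OF reach]])
  moreover have "S \<noteq> {}" using b0 \<open>B \<subseteq> S\<close> by auto
  ultimately show ?thesis
    unfolding S_def d_def by (intro exI[of _ U]) auto
qed

end

section \<open>The square root and the peak domain\<close>

text \<open>The point 0 ends the branch cut, so continuity there comes from |csqrt z| = sqrt
  |z|.\<close>

lemma continuous_at_csqrt_0: "isCont csqrt 0"
proof -
  have "((\<lambda>z. sqrt (cmod z)) \<longlongrightarrow> sqrt (cmod 0)) (at 0)" by (intro tendsto_intros)
  then have "((\<lambda>z. cmod (csqrt z)) \<longlongrightarrow> 0) (at 0)" by simp
  then show ?thesis unfolding isCont_def csqrt_0 by (rule tendsto_norm_zero_cancel)
qed

lemma Re_csqrt_eq_0_iff: "Re (csqrt z) = 0 \<longleftrightarrow> z \<in> \<real>\<^sub>\<le>\<^sub>0"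
proof -
  have "Re (csqrt z) = 0 \<longleftrightarrow> cmod z = - Re z" by (auto simp: add_eq_0_iff)
  also have "\<dots> \<longleftrightarrow> Re z \<le> 0 \<and> Im z = 0"
  proof
    assume *: "cmod z = - Re z"
    then have "(Re z)\<^sup>2 + (Im z)\<^sup>2 = (Re z)\<^sup>2" using cmod_power2[of z] by simp
    then show "Re z \<le> 0 \<and> Im z = 0" using * norm_ge_zero[of z] by simp
  qed (simp add: cmod_def)
  finally show ?thesis by (simp only: complex_nonpos_Reals_iff)
qed

text \<open>Across the cut \<open>csqrt\<close> changes sign, but its values there are purely
  imaginary, so the real part has no jump.\<close>

lemma continuous_on_Re_csqrt: "continuous_on UNIV (\<lambda>z. Re (csqrt z))"
  unfolding csqrt.sel by (intro continuous_intros) auto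

lemma complex_differentiable_imp_isCont: "complex_differentiable f x \<Longrightarrow> isCont f x"
  unfolding complex_differentiable_def using has_derivative_continuous by blast

text \<open>\<open>exp (- csqrt w)\<close> peaks at \<open>a\<close>; the distance to the graph of \<open>Re \<circ> csqrt \<circ> w\<close> over \<open>S\<close>
  serves to shrink the set where it is less than \<open>1\<close> in modulus, so that the boundary of the
  shrunk set touches \<open>{w \<in> \<real>\<^sub>\<le>\<^sub>0}\<close> in \<open>a\<close> only.\<close>

lemma peak_domain_of_support_function:
  fixes w :: "complex ^ 'n \<Rightarrow> complex"
  assumes S: "closed S" "a \<in> S" "connected (S - {a})" "S - {a} \<noteq> {}" "a \<in> closure (S - {a})"
    and w: "\<And>x. complex_differentiable w x" "w a = 0" "\<And>z. z \<in> S - {a} \<Longrightarrow> w z \<notin> \<real>\<^sub>\<le>\<^sub>0"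
  shows "\<exists>G f. is_domain G \<and> S - {a} \<subseteq> G \<and> a \<in> frontier G \<and> f \<in> algebra_A G \<and> f a = 1 \<and>
    (\<forall>x\<in>closure G - {a}. cmod (f x) < 1)"
proof -
  define g where "g z = Re (csqrt (w z))" for z
  have contw: "continuous_on A w" for A
    using w(1) complex_differentiable_imp_isCont continuous_at_imp_continuous_on by blast
  have contg: "continuous_on UNIV g"
    unfolding g_def by (rule continuous_on_compose2[OF continuous_on_Re_csqrt contw]) auto
  have g_nonneg: "g z \<ge> 0" for z unfolding g_def by (rule Re_csqrt)
  have g_0: "g z = 0 \<longleftrightarrow> w z \<in> \<real>\<^sub>\<le>\<^sub>0" for z unfolding g_def by (rule Re_csqrt_eq_0_iff)
  define \<Gamma> where "\<Gamma> = (\<lambda>k. (k, g k)) ` S"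
  have \<Gamma>: "closed \<Gamma>" "\<Gamma> \<noteq> {}"
  proof -
    have "\<Gamma> = {x. fst x \<in> S} \<inter> {x. snd x = g (fst x)}" by (auto simp: \<Gamma>_def)
    moreover have "closed {x :: (complex ^ 'n) \<times> real. fst x \<in> S}"
      using closed_vimage_fst[OF S(1)] by (simp add: vimage_def)
    moreover have "closed {x :: (complex ^ 'n) \<times> real. snd x = g (fst x)}"
      by (intro closed_Collect_eq continuous_intros continuous_on_compose2[OF contg]) auto
    ultimately show "closed \<Gamma>" by (simp add: closed_Int)
    show "\<Gamma> \<noteq> {}" using S(2) by (auto simp: \<Gamma>_def)
  qed
  \<comment> \<open>Continuous on the whole space, at most g on S, and positive off a. The distance
    to S itself would vanish on S.\<close>
  define \<phi> where "\<phi> z = infdist (z, 0) \<Gamma>" for z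
  have cont\<phi>: "continuous_on UNIV \<phi>"
    unfolding \<phi>_def by (intro continuous_on_infdist continuous_intros)
  have \<phi>_pos: "\<phi> z > 0" if "z \<noteq> a" for z
  proof -
    have "(z, 0) \<notin> \<Gamma>"
      using that g_0 w(3) by (auto simp: \<Gamma>_def)
    then show ?thesis unfolding \<phi>_def using infdist_pos_not_in_closed[OF \<Gamma>] by blast
  qed
  have \<phi>_le: "\<phi> z \<le> g z" if "z \<in> S" for z
  proof -
    have "\<phi> z \<le> dist (z, 0) (z, g z)"
      unfolding \<phi>_def by (rule infdist_le) (use that in \<open>auto simp: \<Gamma>_def\<close>)
    also have "\<dots> = g z" using g_nonneg by (simp add: dist_Pair_Pair)
    finally show ?thesis .
  qed
  \<comment> \<open>The factor 1/2 leaves room on both sides: the inequality is strict on S - {a},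
    and in the closure g is still at least \<phi> / 2, which is positive off a.\<close>
  define G0 where "G0 = {z. 1/2 * \<phi> z < g z}"
  have "open G0"
    unfolding G0_def by (intro open_Collect_less continuous_intros cont\<phi> contg)
  have SG0: "S - {a} \<subseteq> G0"
  proof
    fix z assume z: "z \<in> S - {a}"
    then show "z \<in> G0" using \<phi>_pos[of z] \<phi>_le[of z] by (simp add: G0_def)
  qed
  have clG0: "w z \<notin> \<real>\<^sub>\<le>\<^sub>0" if "z \<in> closure G0" "z \<noteq> a" for z
  proof -
    have "closed {z. 1/2 * \<phi> z \<le> g z}"
      by (intro closed_Collect_le continuous_intros cont\<phi> contg)
    then have "closure G0 \<subseteq> {z. 1/2 * \<phi> z \<le> g z}"
      by (intro closure_minimal) (auto simp: G0_def)
    then have "g z \<noteq> 0" using that \<phi>_pos[of z] by auto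
    then show ?thesis using g_0 by simp
  qed
  obtain x0 where x0: "x0 \<in> S - {a}" using S(4) by blast
  \<comment> \<open>\<open>G0\<close> may be disconnected; the connected set S - {a} lies in one
    component.\<close>
  define G where "G = connected_component_set G0 x0"
  have G: "open G" "connected G" "x0 \<in> G" "G \<subseteq> G0"
    using \<open>open G0\<close> x0 SG0 connected_component_subset
    by (auto simp: G_def open_connected_component connected_component_refl)
  have SG: "S - {a} \<subseteq> G"
    unfolding G_def by (rule connected_component_maximal[OF x0 S(3) SG0])
  have "a \<notin> G0"
    using g_0[of a] w(2) infdist_nonneg[of "(a, 0)" \<Gamma>] by (simp add: G0_def \<phi>_def not_less)
  then have "a \<in> frontier G"
    using closure_mono[OF SG] S(5) G by (auto simp: frontier_def interior_open)
  have clG: "w z \<notin> \<real>\<^sub>\<le>\<^sub>0" if "z \<in> closure G" "z \<noteq> a" for z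
    using clG0 that closure_mono[OF G(4)] by blast
  define f where "f z = exp (- csqrt (w z))" for z
  have "holomorphic_vec_on f G"
    unfolding holomorphic_vec_on_def complex_differentiable_def[symmetric]
  proof
    fix x assume x: "x \<in> G"
    then have "x \<noteq> a" using \<open>a \<notin> G0\<close> G(4) by blast
    then have "w x \<notin> \<real>\<^sub>\<le>\<^sub>0" using clG x closure_subset by blast
    then have "((\<lambda>u. exp (- csqrt u)) has_field_derivative exp (- csqrt (w x)) * (- (1 / (2 * csqrt (w x))))) (at (w x))"
      by (auto intro!: derivative_eq_intros)
    from complex_differentiable_chain[OF w(1) this]
    show "complex_differentiable f x" unfolding f_def[abs_def] .
  qed
  moreover have "continuous_on (closure G) f"
  proof (intro continuous_at_imp_continuous_on ballI)
    fix z assume z: "z \<in> closure G"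
    have "isCont csqrt (w z)"
      using clG[OF z] w(2) continuous_at_csqrt continuous_at_csqrt_0 by (cases "z = a") auto
    then have "isCont (\<lambda>z. csqrt (w z)) z"
      using isCont_o2[OF complex_differentiable_imp_isCont[OF w(1)]] by blast
    then show "isCont f z" unfolding f_def by (intro continuous_intros)
  qed
  ultimately have "f \<in> algebra_A G" by (simp add: algebra_A_def)
  moreover have "f a = 1" by (simp add: f_def w(2))
  moreover have "cmod (f x) < 1" if "x \<in> closure G - {a}" for x
  proof -
    have "g x > 0" using clG[of x] that g_0[of x] g_nonneg[of x] by (simp add: less_le)
    then show ?thesis by (simp add: f_def g_def del: csqrt.sel)
  qed
  moreover have "is_domain G" using G by (auto simp: is_domain_def)
  ultimately show ?thesis using SG \<open>a \<in> frontier G\<close> by blast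
qed

section \<open>Localisation at the boundary point\<close>

text \<open>A negative value would put a into the open set D, which contains none of its boundary
  points; a positive one would keep a neighbourhood of a outside D.\<close>

lemma smooth_defining_function_zero:
  fixes r :: "'a::real_normed_vector \<Rightarrow> real"
  assumes "open D" "a \<in> frontier D" "a \<in> W" "smooth_on W r" "D \<inter> W = {x \<in> W. r x < 0}"
  shows "r a = 0"
proof (rule ccontr)
  assume "r a \<noteq> 0"
  have "a \<notin> D" using assms(1,2) by (simp add: frontier_def interior_open)
  then have "a \<notin> {x \<in> W. r x < 0}" unfolding assms(5)[symmetric] by blast
  then have "r a > 0" using assms(3) \<open>r a \<noteq> 0\<close> by simp
  have notin: "x \<notin> D" if "r x > 0" "x \<in> W" for x
  proof
    assume "x \<in> D"
    then have "x \<in> {x \<in> W. r x < 0}" using that(2) unfolding assms(5)[symmetric] by blast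
    then show False using that(1) by simp
  qed
  have "isCont r a"
    using has_derivative_continuous[OF smooth_on_has_derivative[OF assms(4,3), of "[]"]] by simp
  then have "\<forall>\<^sub>F x in at a. r x > 0"
    unfolding isCont_def using \<open>r a > 0\<close> by (rule order_tendstoD)
  moreover have "\<forall>\<^sub>F x in at a. x \<in> W"
    using assms(3,4) unfolding smooth_on_def by (intro eventually_at_in_open') auto
  ultimately have "\<forall>\<^sub>F x in at a. x \<notin> D"
    by eventually_elim (rule notin)
  then obtain V where V: "open V" "a \<in> V" "\<forall>x\<in>V. x \<noteq> a \<longrightarrow> x \<notin> D"
    unfolding eventually_at_topological by blast
  have "V \<inter> D = {}"
  proof (intro equals0I)
    fix x assume "x \<in> V \<inter> D"
    then show False using V(3) \<open>a \<notin> D\<close> by (cases "x = a") auto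
  qed
  moreover have "a \<in> closure D" using assms(2) by (simp add: frontier_def)
  ultimately show False using V(1,2) open_Int_closure_eq_empty by blast
qed

theorem corollary9:
  fixes D :: "(complex ^ 'n) set" and a :: "complex ^ 'n"
  assumes "is_domain D"
    and "smooth_boundary_point D a"
    and "finite_type_boundary_point D a"
    and "C_convex_boundary_point D a"
  shows "local_peak_point D a \<and>
    (\<exists>U G. open U \<and> a \<in> U \<and> is_domain G \<and> closure (D \<inter> U) - {a} \<subseteq> G \<and>
       a \<in> frontier G \<and> peak_point G a)"
proof -
  have D: "open D" using assms(1) by (simp add: is_domain_def)
  have fr: "a \<in> frontier D" using assms(3) by (simp add: finite_type_boundary_point_def)
  have aD: "a \<notin> D" "a \<in> closure D" using D fr by (auto simp: frontier_def interior_open)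
  obtain r W where W: "a \<in> W" "smooth_on W r" "D \<inter> W = {x \<in> W. r x < 0}"
    and dr: "frechet_derivative r (at a) \<noteq> (\<lambda>v. 0)" and ct: "contact_type r a < \<infinity>"
    using assms(3) unfolding finite_type_boundary_point_def smooth_defining_function_def by blast
  obtain U0 where U0: "open U0" "a \<in> U0" "C_convex (D \<inter> U0)"
    using assms(4) unfolding C_convex_boundary_point_def by blast
  have openW: "open W" using W(2) by (simp add: smooth_on_def)
  have ra: "r a = 0" by (rule smooth_defining_function_zero[OF D fr W])
  obtain u where u: "iter_deriv [u] r a \<noteq> 0" using dr by (auto simp: fun_eq_iff)
  have lin: "linear (\<lambda>v. iter_deriv [v] r p)" if "p \<in> W" for p
    using iter_deriv_linear_slot[OF W(2) that, of "[]" "[]"] by simp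
  have u': "complex_differential r a u \<noteq> 0"
    using u unfolding complex_differential_def by (metis Re_complex_linear_part zero_complex.sel(1))
  define n where "n = (1 / complex_differential r a u) *s u"
  have n: "complex_differential r a n = 1"
    using u' unfolding n_def complex_differential_def complex_linear_part_scale[OF lin[OF W(1)]] by simp
  \<comment> \<open>One direction u with nonzero derivative at all points of the ball makes every
    zero of r there regular, so the result on complex tangent planes applies at each of
    them.\<close>
  have "\<exists>\<delta>>0. cball a \<delta> \<subseteq> W \<inter> U0 \<and> (\<forall>p\<in>ball a \<delta>. iter_deriv [u] r p \<noteq> 0)"
  proof -
    have "isCont (iter_deriv [u] r) a"
      by (rule has_derivative_continuous[OF smooth_on_has_derivative[OF W(2,1)]])
    then obtain \<delta>1 where \<delta>1: "\<delta>1 > 0" "\<And>p. dist a p < \<delta>1 \<Longrightarrow> iter_deriv [u] r p \<noteq> 0"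
      using continuous_at_avoid[of a "iter_deriv [u] r" 0] u by blast
    have "open (W \<inter> U0)" "a \<in> W \<inter> U0" using openW U0 W(1) by auto
    then obtain \<delta>2 where \<delta>2: "\<delta>2 > 0" "cball a \<delta>2 \<subseteq> W \<inter> U0"
      using open_contains_cball by blast
    have "cball a (min \<delta>1 \<delta>2) \<subseteq> cball a \<delta>2" by auto
    then show ?thesis using \<delta>1 \<delta>2 by (intro exI[of _ "min \<delta>1 \<delta>2"]) auto
  qed
  then obtain \<delta> where \<delta>: "\<delta> > 0" "cball a \<delta> \<subseteq> W \<inter> U0"
    "\<And>p. p \<in> ball a \<delta> \<Longrightarrow> iter_deriv [u] r p \<noteq> 0" by blast
  have sub: "p \<in> W \<and> p \<in> U0" if "p \<in> ball a \<delta>" for p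
    using \<delta>(2) ball_subset_cball that by blast
  have D_iff: "x \<in> D \<longleftrightarrow> r x < 0" if "x \<in> W" for x
  proof -
    have "x \<in> D \<longleftrightarrow> x \<in> D \<inter> W" using that by blast
    then show ?thesis unfolding W(3) using that by simp
  qed
  have support: "r q \<ge> 0" if pq: "p \<in> ball a \<delta>" "q \<in> ball a \<delta>" "r p = 0"
    "complex_differential r p (q - p) = 0" for p q
  proof (rule ccontr)
    assume "\<not> r q \<ge> 0"
    then have q: "q \<in> D \<inter> U0" using sub[OF pq(2)] D_iff[of q] by simp
    have p: "p \<notin> D \<inter> U0" using sub[OF pq(1)] D_iff[of p] pq(3) by simp
    have deriv: "(r has_derivative (\<lambda>v. iter_deriv [v] r p)) (at p)"
      using smooth_on_has_derivative[OF W(2), of p "[]"] sub[OF pq(1)] by simp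
    have WU: "open (W \<inter> U0)" "p \<in> W \<inter> U0" using openW U0(1) sub[OF pq(1)] by auto
    have "x \<in> D \<inter> U0" if "x \<in> W \<inter> U0" "r x < 0" for x
      using that D_iff[of x] by simp
    then have "complex_linear_part (\<lambda>v. iter_deriv [v] r p) (q - p) \<noteq> 0"
      by (rule C_convex_misses_complex_tangent[OF U0(3) p deriv pq(3) \<delta>(3)[OF pq(1)] WU _ q])
    then show False using pq(4) by (simp add: complex_differential_def)
  qed
  obtain K where K: "\<forall>v. v \<noteq> 0 \<longrightarrow> (\<exists>j\<le>K. \<exists>m\<le>j. polycoeff j (taylor_form r a) v (\<i> *s v) m \<noteq> 0)"
    using contact_type_finite_imp_line_type[OF W(2,1) ct] by blast
  interpret finite_line_type r a n W \<delta> K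
    by unfold_locales (use W(2) \<delta> ra n support K in auto)
  obtain w d where d: "d > 0" and w: "w a = 0" "\<And>x. complex_differentiable w x"
    "\<And>z. z \<in> ball a d \<Longrightarrow> z \<noteq> a \<Longrightarrow> r z \<le> 0 \<Longrightarrow> w z \<notin> \<real>\<^sub>\<le>\<^sub>0"
    using holomorphic_support_function by blast
  \<comment> \<open>Half, so that the closed ball, which contains
    \<open>closure (D \<inter> U)\<close>, stays inside both open balls.\<close>
  define \<rho> where "\<rho> = min d \<delta> / 2"
  have \<rho>: "\<rho> > 0" "\<rho> < d" "\<rho> < \<delta>" using d \<delta>(1) by (auto simp: \<rho>_def min_def)
  obtain U where U: "open U" "a \<in> U" "U \<subseteq> ball a \<rho>" "connected {x \<in> U. r x < 0}" "{x \<in> U. r x < 0} \<noteq> {}"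
    using connected_sublevel_box[OF \<rho>(1)] by blast
  have U_W: "U \<subseteq> W" using U(3) \<rho>(3) sub by fastforce
  have DU: "D \<inter> U = {x \<in> U. r x < 0}" using D_iff U_W by blast
  define S where "S = closure (D \<inter> U)"
  have S_cball: "S \<subseteq> cball a \<rho>"
    unfolding S_def using U(3) by (intro closure_minimal) auto
  have S_ball: "z \<in> ball a d" "z \<in> ball a \<delta>" if "z \<in> S" for z
    using S_cball that \<rho> by auto
  have aS: "a \<in> S"
    unfolding S_def using open_Int_closure_subset[OF U(1), of D] aD U(2) by (auto simp: Int_commute)
  have r_le: "r z \<le> 0" if "z \<in> S" for z
  proof (rule continuous_le_on_closure[of "D \<inter> U" r])
    show "continuous_on (closure (D \<inter> U)) r"
      using smooth_on_continuous_on[OF W(2), of "[]"] S_ball sub unfolding S_def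
      by (auto intro: continuous_on_subset)
  qed (use that DU in \<open>auto simp: S_def\<close>)
  have w_avoid: "w z \<notin> \<real>\<^sub>\<le>\<^sub>0" if "z \<in> S - {a}" for z
    using w(3)[OF S_ball(1)] r_le that by blast
  have DU_S: "D \<inter> U \<subseteq> S - {a}" unfolding S_def using closure_subset[of "D \<inter> U"] aD(1) by blast
  have "connected (D \<inter> U)" unfolding DU by (rule U(4))
  \<comment> \<open>A set between a connected set and its closure is connected; this is where the
    special shape of U pays off.\<close>
  then have conn: "connected (S - {a})"
    by (rule connected_intermediate_closure[OF _ DU_S]) (simp add: S_def Diff_subset)
  have "closed S" by (simp add: S_def)
  moreover have "S - {a} \<noteq> {}" using DU_S U(5) unfolding DU by blast
  moreover have "a \<in> closure (S - {a})" using closure_mono[OF DU_S] aS by (auto simp: S_def)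
  ultimately obtain G f where G: "is_domain G" "S - {a} \<subseteq> G" "a \<in> frontier G"
    and f: "f \<in> algebra_A G" "f a = 1" "\<And>x. x \<in> closure G - {a} \<Longrightarrow> cmod (f x) < 1"
    using peak_domain_of_support_function[OF _ aS conn _ _ w(2,1) w_avoid] by blast
  have S_G: "S \<subseteq> closure G"
    using G(2,3) closure_subset[of G] by (auto simp: frontier_def)
  have peakG: "peak_point G a"
    unfolding peak_point_def using G f by blast
  \<comment> \<open>The larger domain also settles the local claim: f restricts to
    \<open>D \<inter> U\<close>, whose closure lies in that of G.\<close>
  have "f \<in> algebra_A (D \<inter> U)"
    using f(1) DU_S G(2) S_G unfolding algebra_A_def holomorphic_vec_on_def S_def
    by (auto intro: continuous_on_subset)
  moreover have "is_domain (D \<inter> U)"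
    using D U(1,5) \<open>connected (D \<inter> U)\<close> unfolding DU[symmetric] by (simp add: is_domain_def open_Int)
  moreover have "a \<in> frontier (D \<inter> U)"
    using aS aD(1) D U(1) by (simp add: frontier_def S_def interior_open open_Int)
  ultimately have "peak_point (D \<inter> U) a"
    unfolding peak_point_def using f(2,3) S_G unfolding S_def by blast
  then have "local_peak_point D a"
    unfolding local_peak_point_def using fr U(1,2) by blast
  then show ?thesis using U(1,2) G peakG unfolding S_def by blast
qed

end
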